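(* Let $A$ be a connected graded algebra over a commutative ring $\mathbf{k}$ with unit. (1) Suppose that, for homogeneous elements $a_1,\dots,a_N\in A_{>0}$, the $\mathbf{k}$-module $H_1(\overline{\mathrm{B}}(A))$ is additively generated by the classes $[a_1],\dots,[a_N]$. Then $A$ is multiplicatively generated by $a_1,\dots,a_N$. (2) Suppose that, for homogeneous elements $a_1,\dots,a_N\in A_{>0}$, the $\mathbf{k}$-module $H_1(\overline{\mathrm{B}}(A))$ is additively generated by the $N$ elements $[a_1],\dots,[a_N]$ modulo $R$ homogeneous relations $$\sum_{i=1}^N\lambda_{ri}[a_i]=0\in H_1(\overline{\mathrm{B}}(A)),\quad r=1,\dots,R,\ \lambda_{ri}\in\mathbf{k}$$ (i.e. all linear relations between the $[a_i]$ are linear combinations of these). Let $T(x_1,\dots,x_N)$ be the tensor algebra with $\deg x_i=\deg a_i$, and suppose that homogeneous polynomials $P_{j,\alpha},Q_{j,\alpha},K_{r,\beta},L_{r,\beta}\in T(x_1,\dots,x_N)$ lying in the augmentation ideal are such that $$\sum_{i=1}^N\lambda_{ri}\cdot a_i=d_{\overline{\mathrm{B}},2}\Big(\sum_\beta K_{r,\beta}(a_1,\dots,a_N)\otimes L_{r,\beta}(a_1,\dots,a_N)\Big)\in I(A),\quad r=1,\dots,R,$$ and the homogeneous elements $$\sum_\alpha P_{j,\alpha}(a_1,\dots,a_N)\otimes Q_{j,\alpha}(a_1,\dots,a_N)\in I(A)\otimes I(A),\quad j=1,\dots,M,$$ are cycles in the bar construction whose classes generate the $\mathbf{k}$-module $H_2(\overline{\mathrm{B}}(A))$.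 Then $A$ has the presentation (via $x_i\mapsto a_i$) $$A\cong T(x_1,\dots,x_N)\Big/\Big(\sum_{i=1}^N\lambda_{ri}x_i=\sum_\beta\overline{K}_{r,\beta}\cdot L_{r,\beta},\ r=1,\dots,R;\ \ \sum_\alpha\overline{P}_{j,\alpha}\cdot Q_{j,\alpha}=0,\ j=1,\dots,M\Big).$$ Here $N,M,R$ can be infinite of any cardinality.
   Context: All tensor products are over $\mathbf{k}$. Algebras are associative with unit and graded by a commutative monoid $G$ with a homomorphism $G\to\mathbb{Z}$, which induces a $\mathbb{Z}$-grading; $A$ is connected if, for the $\mathbb{Z}$-grading, $A_{<0}=0$ and $A_0=\mathbf{k}\cdot1$. $A$ need not be a free $\mathbf{k}$-module. $I(A)$ is the kernel of the augmentation $\varepsilon:A\to A_0\cong\mathbf{k}$. For homogeneous $a$, $\overline{a}:=(-1)^{1+\deg a}a$ (with $\deg$ the $\mathbb{Z}$-degree). The bar construction $\overline{\mathrm{B}}(A)$ is the chain complex $\overline{\mathrm{B}}_n(A)=I(A)^{\otimes n}$ with $$d_{\overline{\mathrm{B}},n}(a_1\otimes\dots\otimes a_n)=\sum_{i=1}^{n-1}\overline{a}_1\otimes\dots\otimes\overline{a}_{i-1}\otimes\overline{a}_i a_{i+1}\otimes a_{i+2}\otimes\dots\otimes a_n;$$ in particular $d_{\overline{\mathrm{B}},1}=0$, $d_{\overline{\mathrm{B}},2}(x\otimes y)=\overline{x}y$, $d_{\overline{\mathrm{B}},3}(x\otimes y\otimes z)=\overline{x}y\otimes z+\overline{x}\otimes\overline{y}z$.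 $[a]\in H_1(\overline{\mathrm{B}}(A))$ denotes the class of the cycle $a\in\overline{\mathrm{B}}_1(A)=I(A)$. In the presentation, the quotient is by the two-sided ideal generated by the indicated (homogeneous) relations. All sums (over $i$ for fixed $r$, over $\alpha$ for fixed $j$, over $\beta$ for fixed $r$) are finite. *)

theory Defs
  imports Complex_Main "HOL-Library.Poly_Mapping" "HOL-Algebra.QuotRing" "HOL-Algebra.Module"
begin

section \<open>Graded algebras\<close>

text \<open>
  The ground ring is a type \<open>'k\<close> of class \<^class>\<open>comm_ring_1\<close>, the algebra a type \<open>'a\<close> of class
  \<^class>\<open>ring_1\<close> with a scalar multiplication \<open>scale\<close>, the grading monoid a type \<open>'g\<close> of class
  \<^class>\<open>comm_monoid_add\<close> with a homomorphism \<open>\<delta>\<close> to the integers. The family \<open>gr\<close> consists of the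
  homogeneous components, of which the algebra is the direct sum (\<open>direct_sum\<close>).
\<close>

locale graded_algebra = Modules.module scale
  for scale :: "'k::comm_ring_1 \<Rightarrow> 'a::ring_1 \<Rightarrow> 'a" +
  fixes \<delta> :: "'g::comm_monoid_add \<Rightarrow> int"
    and gr :: "'g \<Rightarrow> 'a set"
  assumes scale_mult_left: "scale c x * y = scale c (x * y)"
    and scale_mult_right: "x * scale c y = scale c (x * y)"
    and delta_zero: "\<delta> 0 = 0"
    and delta_add: "\<delta> (g + h) = \<delta> g + \<delta> h"
    and subspace_gr: "subspace (gr g)"
    and direct_sum: "\<exists>!f :: 'g \<Rightarrow>\<^sub>0 'a. (\<forall>g. Poly_Mapping.lookup f g \<in> gr g) \<and> (\<Sum>g\<in>Poly_Mapping.keys f. Poly_Mapping.lookup f g) = x"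
    and one_gr: "1 \<in> gr 0"
    and mult_gr: "x \<in> gr g \<Longrightarrow> y \<in> gr h \<Longrightarrow> x * y \<in> gr (g + h)"

definition decomp :: "('g \<Rightarrow> 'a::comm_monoid_add set) \<Rightarrow> 'a \<Rightarrow> 'g \<Rightarrow>\<^sub>0 'a" where
  "decomp gr x = (THE f. (\<forall>g. Poly_Mapping.lookup f g \<in> gr g) \<and> (\<Sum>g\<in>Poly_Mapping.keys f. Poly_Mapping.lookup f g) = x)"

definition int_gr ::
  "('k::comm_ring_1 \<Rightarrow> 'a::ring_1 \<Rightarrow> 'a) \<Rightarrow> ('g \<Rightarrow> int) \<Rightarrow> ('g \<Rightarrow> 'a set) \<Rightarrow> int \<Rightarrow> 'a set" where
  "int_gr scale \<delta> gr n = Modules.module.span scale (\<Union>g\<in>{g. \<delta> g = n}. gr g)"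

text \<open>
  The map \<open>c \<mapsto> c \<cdot> 1\<close> is required to be an isomorphism onto the degree zero part, so that the
  projection to degree zero is an augmentation.
\<close>

locale connected_graded_algebra = graded_algebra +
  assumes neg_trivial: "n < 0 \<Longrightarrow> int_gr scale \<delta> gr n = {0}"
    and zero_part: "int_gr scale \<delta> gr 0 = range (\<lambda>c. scale c 1)"
    and inj_unit: "inj (\<lambda>c. scale c 1)"

definition augmentation :: "('g \<Rightarrow> int) \<Rightarrow> ('g \<Rightarrow> 'a::comm_monoid_add set) \<Rightarrow> 'a \<Rightarrow> 'a" where
  "augmentation \<delta> gr x = (\<Sum>g\<in>{g \<in> Poly_Mapping.keys (decomp gr x). \<delta> g = 0}. Poly_Mapping.lookup (decomp gr x) g)"

definition aug_ideal :: "('g \<Rightarrow> int) \<Rightarrow> ('g \<Rightarrow> 'a::comm_monoid_add set) \<Rightarrow> 'a set" where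
  "aug_ideal \<delta> gr = {x. augmentation \<delta> gr x = 0}"

text \<open>
  The linear extension of \<open>x \<mapsto> (-1) ^ (1 + deg x) x\<close> from homogeneous elements.
\<close>

definition bar_sign :: "('g \<Rightarrow> int) \<Rightarrow> ('g \<Rightarrow> 'a::ab_group_add set) \<Rightarrow> 'a \<Rightarrow> 'a" where
  "bar_sign \<delta> gr x =
    (\<Sum>g\<in>Poly_Mapping.keys (decomp gr x).
      if even (1 + \<delta> g) then Poly_Mapping.lookup (decomp gr x) g else - Poly_Mapping.lookup (decomp gr x) g)"

definition subalgebra :: "('k \<Rightarrow> 'a::ring_1 \<Rightarrow> 'a) \<Rightarrow> 'a set \<Rightarrow> bool" where
  "subalgebra scale B \<longleftrightarrow>
    1 \<in> B \<and> (\<forall>x\<in>B. \<forall>y\<in>B. x - y \<in> B \<and> x * y \<in> B) \<and> (\<forall>c. \<forall>x\<in>B. scale c x \<in> B)"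


section \<open>Modules, quotient modules and homology\<close>

definition ring_on :: "'r::ring_1 set \<Rightarrow> 'r ring" where
  "ring_on S = \<lparr>carrier = S, mult = (*), one = 1, zero = 0, add = (+)\<rparr>"

text \<open>
  In the module records below, the fields \<open>mult\<close> and \<open>one\<close> inherited from rings carry no meaning.
\<close>

definition fscale :: "'k::comm_ring_1 \<Rightarrow> ('b \<Rightarrow>\<^sub>0 'k) \<Rightarrow> 'b \<Rightarrow>\<^sub>0 'k" where
  "fscale c p = Poly_Mapping.map (\<lambda>x. c * x) p"

definition free_module :: "'b set \<Rightarrow> ('k::comm_ring_1, 'b \<Rightarrow>\<^sub>0 'k) module" where
  "free_module S =
    \<lparr>carrier = {p. Poly_Mapping.keys p \<subseteq> S}, mult = undefined, one = undefined,
     zero = 0, add = (+), smult = fscale\<rparr>"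

definition quot_module :: "('k, 'm) module \<Rightarrow> 'm set \<Rightarrow> ('k, 'm set) module" where
  "quot_module M N =
    \<lparr>carrier = a_rcosets\<^bsub>M\<^esub> N, mult = undefined, one = undefined,
     zero = N, add = set_add M,
     smult = (\<lambda>c X. \<Union>x\<in>X. N +>\<^bsub>M\<^esub> (c \<odot>\<^bsub>M\<^esub> x))\<rparr>"

definition submodule_span :: "('k::comm_ring_1, 'm) module \<Rightarrow> 'm set \<Rightarrow> 'm set" where
  "submodule_span M S = (\<lambda>N. submodule N (ring_on (UNIV :: 'k set)) M) hull S"


section \<open>The bar construction\<close>

text \<open>
  The \<open>n\<close>-th tensor power of \<open>I\<close> over the ground ring is the free module on the words of length
  \<open>n\<close> in \<open>I\<close> modulo the relations expressing additivity and homogeneity in each slot.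
\<close>

definition words :: "'a set \<Rightarrow> nat \<Rightarrow> 'a list set" where
  "words I n = {w. length w = n \<and> set w \<subseteq> I}"

definition tensor_relations ::
  "('k::comm_ring_1 \<Rightarrow> 'a::ab_group_add \<Rightarrow> 'a) \<Rightarrow> 'a set \<Rightarrow> nat \<Rightarrow> ('a list \<Rightarrow>\<^sub>0 'k) set" where
  "tensor_relations scale I n =
    {Poly_Mapping.single (u @ [x + y] @ v) 1
       - Poly_Mapping.single (u @ [x] @ v) 1 - Poly_Mapping.single (u @ [y] @ v) 1 |
       u x y v. x \<in> I \<and> y \<in> I \<and> set u \<subseteq> I \<and> set v \<subseteq> I \<and> length u + 1 + length v = n}
    \<union> {Poly_Mapping.single (u @ [scale c x] @ v) 1 - Poly_Mapping.single (u @ [x] @ v) c |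
       c u x v. x \<in> I \<and> set u \<subseteq> I \<and> set v \<subseteq> I \<and> length u + 1 + length v = n}"

definition tensor_null ::
  "('k::comm_ring_1 \<Rightarrow> 'a::ab_group_add \<Rightarrow> 'a) \<Rightarrow> 'a set \<Rightarrow> nat \<Rightarrow> ('a list \<Rightarrow>\<^sub>0 'k) set" where
  "tensor_null scale I n =
    submodule_span (free_module (words I n)) (tensor_relations scale I n)"

definition tensor_power ::
  "('k::comm_ring_1 \<Rightarrow> 'a::ab_group_add \<Rightarrow> 'a) \<Rightarrow> 'a set \<Rightarrow> nat
    \<Rightarrow> ('k, ('a list \<Rightarrow>\<^sub>0 'k) set) module" where
  "tensor_power scale I n =
    quot_module (free_module (words I n)) (tensor_null scale I n)"

definition pure_tensor ::
  "('k::comm_ring_1 \<Rightarrow> 'a::ab_group_add \<Rightarrow> 'a) \<Rightarrow> 'a set \<Rightarrow> 'a list \<Rightarrow> ('a list \<Rightarrow>\<^sub>0 'k) set" where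
  "pure_tensor scale I w =
    tensor_null scale I (length w)
      +>\<^bsub>free_module (words I (length w)) :: ('k, 'a list \<Rightarrow>\<^sub>0 'k) module\<^esub> Poly_Mapping.single w 1"

text \<open>
  The differential on words: adjacent letters at positions \<open>i\<close>, \<open>i + 1\<close> (counted from 0) are
  multiplied, with signs on the letters up to position \<open>i\<close>. It is extended linearly to the
  free module and then passes to cosets; the union in \<open>bar_d\<close> is over all representatives.
\<close>

definition bar_d_word ::
  "('g \<Rightarrow> int) \<Rightarrow> ('g \<Rightarrow> 'a::ring_1 set) \<Rightarrow> 'a list \<Rightarrow> 'a list \<Rightarrow>\<^sub>0 'k::comm_ring_1" where
  "bar_d_word \<delta> gr w =
    (\<Sum>i<length w - 1.
      Poly_Mapping.single
        (map (bar_sign \<delta> gr) (take i w) @ [bar_sign \<delta> gr (w ! i) * w ! (i + 1)] @ drop (i + 2) w) 1)"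

definition bar_d_free ::
  "('g \<Rightarrow> int) \<Rightarrow> ('g \<Rightarrow> 'a::ring_1 set) \<Rightarrow> ('a list \<Rightarrow>\<^sub>0 'k::comm_ring_1) \<Rightarrow> 'a list \<Rightarrow>\<^sub>0 'k" where
  "bar_d_free \<delta> gr p = (\<Sum>w\<in>Poly_Mapping.keys p. fscale (Poly_Mapping.lookup p w) (bar_d_word \<delta> gr w))"

definition bar_module ::
  "('k::comm_ring_1 \<Rightarrow> 'a::ring_1 \<Rightarrow> 'a) \<Rightarrow> ('g \<Rightarrow> int) \<Rightarrow> ('g \<Rightarrow> 'a set) \<Rightarrow> nat
    \<Rightarrow> ('k, ('a list \<Rightarrow>\<^sub>0 'k) set) module" where
  "bar_module scale \<delta> gr n = tensor_power scale (aug_ideal \<delta> gr) n"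

definition bar_tensor ::
  "('k::comm_ring_1 \<Rightarrow> 'a::ring_1 \<Rightarrow> 'a) \<Rightarrow> ('g \<Rightarrow> int) \<Rightarrow> ('g \<Rightarrow> 'a set)
    \<Rightarrow> 'a list \<Rightarrow> ('a list \<Rightarrow>\<^sub>0 'k) set" where
  "bar_tensor scale \<delta> gr w = pure_tensor scale (aug_ideal \<delta> gr) w"

definition bar_d ::
  "('k::comm_ring_1 \<Rightarrow> 'a::ring_1 \<Rightarrow> 'a) \<Rightarrow> ('g \<Rightarrow> int) \<Rightarrow> ('g \<Rightarrow> 'a set) \<Rightarrow> nat
    \<Rightarrow> ('a list \<Rightarrow>\<^sub>0 'k) set \<Rightarrow> ('a list \<Rightarrow>\<^sub>0 'k) set" where
  "bar_d scale \<delta> gr n X =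
    (\<Union>p\<in>X. tensor_null scale (aug_ideal \<delta> gr) (n - 1)
      +>\<^bsub>free_module (words (aug_ideal \<delta> gr) (n - 1)) :: ('k, 'a list \<Rightarrow>\<^sub>0 'k) module\<^esub> bar_d_free \<delta> gr p)"

text \<open>
  In degree 0 the truncated subtraction is harmless: \<open>bar_d\<close> is then the zero endomorphism of the
  0-th chain module, so all 0-chains are cycles.
\<close>

definition bar_cycles ::
  "('k::comm_ring_1 \<Rightarrow> 'a::ring_1 \<Rightarrow> 'a) \<Rightarrow> ('g \<Rightarrow> int) \<Rightarrow> ('g \<Rightarrow> 'a set) \<Rightarrow> nat
    \<Rightarrow> ('a list \<Rightarrow>\<^sub>0 'k) set set" where
  "bar_cycles scale \<delta> gr n =
    {X \<in> carrier (bar_module scale \<delta> gr n).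
      bar_d scale \<delta> gr n X = \<zero>\<^bsub>bar_module scale \<delta> gr (n - 1)\<^esub>}"

definition bar_boundaries ::
  "('k::comm_ring_1 \<Rightarrow> 'a::ring_1 \<Rightarrow> 'a) \<Rightarrow> ('g \<Rightarrow> int) \<Rightarrow> ('g \<Rightarrow> 'a set) \<Rightarrow> nat
    \<Rightarrow> ('a list \<Rightarrow>\<^sub>0 'k) set set" where
  "bar_boundaries scale \<delta> gr n =
    bar_d scale \<delta> gr (n + 1) ` carrier (bar_module scale \<delta> gr (n + 1))"

definition bar_homology ::
  "('k::comm_ring_1 \<Rightarrow> 'a::ring_1 \<Rightarrow> 'a) \<Rightarrow> ('g \<Rightarrow> int) \<Rightarrow> ('g \<Rightarrow> 'a set) \<Rightarrow> nat
    \<Rightarrow> ('k, ('a list \<Rightarrow>\<^sub>0 'k) set set) module" where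
  "bar_homology scale \<delta> gr n =
    quot_module ((bar_module scale \<delta> gr n)\<lparr>carrier := bar_cycles scale \<delta> gr n\<rparr>)
      (bar_boundaries scale \<delta> gr n)"

definition bar_class ::
  "('k::comm_ring_1 \<Rightarrow> 'a::ring_1 \<Rightarrow> 'a) \<Rightarrow> ('g \<Rightarrow> int) \<Rightarrow> ('g \<Rightarrow> 'a set) \<Rightarrow> nat
    \<Rightarrow> ('a list \<Rightarrow>\<^sub>0 'k) set \<Rightarrow> ('a list \<Rightarrow>\<^sub>0 'k) set set" where
  "bar_class scale \<delta> gr n X =
    bar_boundaries scale \<delta> gr n
      +>\<^bsub>(bar_module scale \<delta> gr n)\<lparr>carrier := bar_cycles scale \<delta> gr n\<rparr>\<^esub> X"

definition bar_homogeneous ::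
  "('k::comm_ring_1 \<Rightarrow> 'a::ring_1 \<Rightarrow> 'a) \<Rightarrow> ('g::comm_monoid_add \<Rightarrow> int) \<Rightarrow> ('g \<Rightarrow> 'a set) \<Rightarrow> nat
    \<Rightarrow> 'g \<Rightarrow> ('a list \<Rightarrow>\<^sub>0 'k) set set" where
  "bar_homogeneous scale \<delta> gr n g =
    submodule_span (bar_module scale \<delta> gr n)
      {bar_tensor scale \<delta> gr w | w.
        w \<in> words (aug_ideal \<delta> gr) n \<and> (\<exists>ds. list_all2 (\<lambda>x d. x \<in> gr d) w ds \<and> sum_list ds = g)}"


section \<open>Tensor algebras and presentations\<close>

text \<open>
  Words are wrapped in a datatype so that concatenation can be the addition of a monoid; the
  convolution product of \<^theory>\<open>HOL-Library.Poly_Mapping\<close> then makes \<open>'i word \<Rightarrow>\<^sub>0 'k\<close> the tensor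
  algebra on generators indexed by \<open>'i\<close>.
\<close>

datatype 'i word = Word (letters: "'i list")

instantiation word :: (type) monoid_add
begin

definition zero_word :: "'i word" where
  "zero_word = Word []"

definition plus_word :: "'i word \<Rightarrow> 'i word \<Rightarrow> 'i word" where
  "plus_word u v = Word (letters u @ letters v)"

instance
  by standard (simp_all add: zero_word_def plus_word_def)

end

definition tensor_algebra :: "'i set \<Rightarrow> ('i word \<Rightarrow>\<^sub>0 'k::comm_ring_1) set" where
  "tensor_algebra X = {p. \<forall>w\<in>Poly_Mapping.keys p. set (letters w) \<subseteq> X}"

definition tvar :: "'i \<Rightarrow> 'i word \<Rightarrow>\<^sub>0 'k::comm_ring_1" where
  "tvar i = Poly_Mapping.single (Word [i]) 1"

definition tensor_gr ::
  "('i \<Rightarrow> 'g::comm_monoid_add) \<Rightarrow> 'g \<Rightarrow> ('i word \<Rightarrow>\<^sub>0 'k::comm_ring_1) set" where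
  "tensor_gr dg g = {p. \<forall>w\<in>Poly_Mapping.keys p. (\<Sum>i\<leftarrow>letters w. dg i) = g}"

definition tensor_eval ::
  "('k::comm_ring_1 \<Rightarrow> 'a::ring_1 \<Rightarrow> 'a) \<Rightarrow> ('i \<Rightarrow> 'a) \<Rightarrow> ('i word \<Rightarrow>\<^sub>0 'k) \<Rightarrow> 'a" where
  "tensor_eval scale a p = (\<Sum>w\<in>Poly_Mapping.keys p. scale (Poly_Mapping.lookup p w) (\<Prod>i\<leftarrow>letters w. a i))"

text \<open>
  The graded algebra \<open>A\<close> is presented by the generators \<open>a i\<close> of degree \<open>dg i\<close>, for \<open>i \<in> X\<close>, and the
  relations \<open>\<rho> = 0\<close>, for \<open>\<rho> \<in> rels\<close>. (Ideals of \<^theory>\<open>HOL-Algebra.Ideal\<close> are two-sided.)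
\<close>

definition has_presentation ::
  "('k::comm_ring_1 \<Rightarrow> 'a::ring_1 \<Rightarrow> 'a) \<Rightarrow> ('g::comm_monoid_add \<Rightarrow> 'a set)
    \<Rightarrow> 'i set \<Rightarrow> ('i \<Rightarrow> 'a) \<Rightarrow> ('i \<Rightarrow> 'g) \<Rightarrow> ('i word \<Rightarrow>\<^sub>0 'k) set \<Rightarrow> bool" where
  "has_presentation scale gr X a dg rels \<longleftrightarrow>
    (let T = ring_on (tensor_algebra X :: ('i word \<Rightarrow>\<^sub>0 'k) set); J = Idl\<^bsub>T\<^esub> rels in
      \<exists>h \<in> ring_iso (T Quot J) (ring_on (UNIV :: 'a set)).
        (\<forall>c. \<forall>p \<in> carrier T. h (J +>\<^bsub>T\<^esub> fscale c p) = scale c (h (J +>\<^bsub>T\<^esub> p)))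
        \<and> (\<forall>g. \<forall>p \<in> carrier T \<inter> tensor_gr dg g. h (J +>\<^bsub>T\<^esub> p) \<in> gr g)
        \<and> (\<forall>i\<in>X. h (J +>\<^bsub>T\<^esub> tvar i) = a i))"

end

theory Submission
  imports Defs
begin

text \<open>
  Write \<open>T\<close> for the tensor algebra, \<open>T'\<close> and \<open>A'\<close> for the augmentation ideals, \<open>J\<close> for the ideal
  generated by the relations and \<open>J'\<close> for the kernel of the evaluation \<open>T \<rightarrow> A\<close>. The hypothesis on
  \<open>H\<^sub>1\<close> says that \<open>A'\<close> is spanned by the \<open>a\<^sub>i\<close> modulo \<open>A' A'\<close>, and induction on the degree
  gives the surjectivity of \<open>T \<rightarrow> A\<close>.

  Lifting factors defines a map \<open>A' \<otimes> A' \<rightarrow> T / (J + J' T' + T' J')\<close>, \<open>u \<otimes> v \<mapsto> bar U * V\<close>, which does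
  not depend on the lifts \<open>U\<close>, \<open>V\<close>. Since \<open>bar (bar x * y) = - x * bar y\<close>, it kills the boundaries of
  3-chains; it kills the chosen 2-cycles because of the quadratic relations, and therefore all 2-cycles.
  Modulo the linear relations, each element of \<open>J'\<close> is a sum of terms \<open>bar U * V\<close> for which the
  corresponding sum of \<open>u \<otimes> v\<close> is a 2-cycle. Hence \<open>J' = J + J' T' + T' J'\<close>, and as all these
  submodules are graded and \<open>T'\<close> lives in positive degrees, \<open>J' = J\<close> by induction on the degree.
\<close>

text \<open>Since A need not be free over the ground ring, T \<rightarrow> A may have no linear
  section. The map on A' \<otimes> A' is therefore built on the free module of words from arbitrary
  lifts, and dividing its target by J' T' + T' J' makes the choice harmless. This coarse target
  costs nothing: in the extra terms the factor from J' has smaller degree, which is what the last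
  induction can handle. The homology is treated in the same spirit. Statements about cosets are
  rewritten as statements about elements of free modules modulo tensor relations, until H_1 and H_2
  enter only through equations between sums of products in A. Injectivity of the unit map of A is
  what keeps J' inside T'. The degree inductions use only the induced Z-grading.\<close>

lemma lookup_fscale [simp]: "Poly_Mapping.lookup (fscale c p) k = c * Poly_Mapping.lookup p k"
  by (simp add: fscale_def Poly_Mapping.map.rep_eq when_def)

section \<open>Free modules as finitely supported functions\<close>

interpretation fs: Modules.module fscale
  by standard (auto intro!: poly_mapping_eqI simp: lookup_add algebra_simps)

lemma fscale_single [simp]: "fscale c (Poly_Mapping.single k d) = Poly_Mapping.single k (c * d)"
  by (rule poly_mapping_eqI) (simp add: lookup_single when_def)

lemma poly_mapping_sum_single:
  "(\<Sum>k\<in>Poly_Mapping.keys p. Poly_Mapping.single k (Poly_Mapping.lookup p k)) = (p :: 'b \<Rightarrow>\<^sub>0 'k::comm_monoid_add)"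
  by (rule poly_mapping_eqI) (simp add: lookup_sum lookup_single when_def in_keys_iff)

lemma poly_mapping_add_induct [case_names single add]:
  assumes "\<And>k c. Q (Poly_Mapping.single k c)" and "\<And>p q. Q p \<Longrightarrow> Q q \<Longrightarrow> Q (p + q)"
  shows "Q (p :: 'b \<Rightarrow>\<^sub>0 'k::comm_monoid_add)"
proof -
  \<comment> \<open>Zero is a one-term function with coefficient 0, so it needs no case of its
    own.\<close>
  have 0: "Q 0" using assms(1)[of undefined 0] by simp
  have "Q (\<Sum>k\<in>K. Poly_Mapping.single k (Poly_Mapping.lookup p k))" if "finite K" for K
    using that by induction (auto intro: assms 0)
  then show ?thesis using poly_mapping_sum_single[of p] by (metis finite_keys)
qed

lemma keys_fscale: "Poly_Mapping.keys (fscale c p) \<subseteq> Poly_Mapping.keys p"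
  by (auto simp: in_keys_iff)

text \<open>The carrier of \<open>free_module S\<close> as a bare set. Arguments about submodules
  run with \<open>fs.subspace\<close> and are transferred to the module records by
  \<open>submodule_free_module_iff\<close>.\<close>

definition free_on :: "'b set \<Rightarrow> ('b \<Rightarrow>\<^sub>0 'k::comm_ring_1) set" where
  "free_on S = {p. Poly_Mapping.keys p \<subseteq> S}"

lemma subspace_free_on: "fs.subspace (free_on S)"
proof (rule fs.subspaceI)
  show "p + q \<in> free_on S" if "p \<in> free_on S" "q \<in> free_on S" for p q
    using that keys_add[of p q] by (auto simp: free_on_def)
  show "fscale c p \<in> free_on S" if "p \<in> free_on S" for c p
    using that keys_fscale[of c p] by (auto simp: free_on_def)
qed (simp add: free_on_def)

lemma single_in_free_on: "k \<in> S \<Longrightarrow> Poly_Mapping.single k c \<in> free_on S"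
  by (simp add: free_on_def)

text \<open>Serves as linear induction: with \<open>V\<close> the preimage of a subspace under a
  linear map, a membership claim for all of \<open>free_on S\<close> reduces to the basis.\<close>

lemma free_on_le:
  fixes V :: "('b \<Rightarrow>\<^sub>0 'k::comm_ring_1) set"
  assumes "fs.subspace V" and "\<And>k. k \<in> S \<Longrightarrow> Poly_Mapping.single k 1 \<in> V"
  shows "free_on S \<subseteq> V"
proof
  fix p :: "'b \<Rightarrow>\<^sub>0 'k" assume p: "p \<in> free_on S"
  have "fscale (Poly_Mapping.lookup p k) (Poly_Mapping.single k 1) \<in> V" if "k \<in> Poly_Mapping.keys p" for k
    using p that assms by (auto simp: free_on_def intro!: fs.subspace_scale simp del: fscale_single)
  then have "(\<Sum>k\<in>Poly_Mapping.keys p. Poly_Mapping.single k (Poly_Mapping.lookup p k)) \<in> V"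
    by (intro fs.subspace_sum[OF assms(1)]) simp
  then show "p \<in> V" by (simp add: poly_mapping_sum_single)
qed

section \<open>Linear extension from free modules\<close>

text \<open>Evaluation, the bar differential, \<open>mul\<close>, \<open>letter\<close>,
  \<open>phi\<close> and the linear polynomials \<open>lin\<close> all have this shape, so linearity
  is proved once.\<close>

definition lin_ext :: "('k::comm_ring_1 \<Rightarrow> 'v::ab_group_add \<Rightarrow> 'v) \<Rightarrow> ('b \<Rightarrow> 'v) \<Rightarrow> ('b \<Rightarrow>\<^sub>0 'k) \<Rightarrow> 'v" where
  "lin_ext scale f p = (\<Sum>k\<in>Poly_Mapping.keys p. scale (Poly_Mapping.lookup p k) (f k))"

lemma (in Modules.module) lin_ext_single [simp]: "lin_ext scale f (Poly_Mapping.single k c) = scale c (f k)"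
  by (simp add: lin_ext_def)

lemma (in Modules.module) module_hom_lin_ext: "module_hom fscale scale (lin_ext scale f)"
proof -
  have add: "lin_ext scale f (p + q) = lin_ext scale f p + lin_ext scale f q" for p q
    unfolding lin_ext_def by (rule setsum_keys_plus_distrib) (auto simp: scale_left_distrib)
  have sc: "lin_ext scale f (fscale c p) = scale c (lin_ext scale f p)" for c p
    by (induction p rule: poly_mapping_add_induct)
      (simp_all add: add fs.scale_right_distrib scale_right_distrib)
  show ?thesis
    by (intro module_hom.intro module_hom_axioms.intro fs.module_axioms module_axioms add sc)
qed

lemma (in Modules.module) subspace_hom_vimage:
  assumes "module_hom s1 scale f" "subspace V"
  shows "module.subspace s1 {x. f x \<in> V}"
  using module_hom.subspace_vimage[OF assms] by (simp add: vimage_def)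

lemma (in Modules.module) subspace_hom_eq:
  assumes "module_hom s1 scale f" "module_hom s1 scale h"
  shows "module.subspace s1 {x. f x = h x}"
proof -
  interpret f: module_hom s1 scale f by fact
  interpret h: module_hom s1 scale h by fact
  show ?thesis by (rule f.m1.subspaceI) (auto simp: f.add h.add f.scale h.scale f.zero h.zero)
qed

lemma (in Modules.module) lin_ext_in:
  assumes "subspace V" "p \<in> free_on S" "\<And>k. k \<in> S \<Longrightarrow> f k \<in> V"
  shows "lin_ext scale f p \<in> V"
  unfolding lin_ext_def
  by (intro subspace_sum[OF assms(1)] subspace_scale[OF assms(1)] assms(3)) (use assms(2) in \<open>auto simp: free_on_def\<close>)

lemma hom_eq_on_free:
  assumes "module_hom fscale sc f" "module_hom fscale sc h"
    and "\<And>k. k \<in> S \<Longrightarrow> f (Poly_Mapping.single k 1) = h (Poly_Mapping.single k 1)" and "p \<in> free_on S"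
  shows "f p = h p"
proof -
  interpret f: module_hom fscale sc f by fact
  have "free_on S \<subseteq> {p. f p = h p}"
    by (rule free_on_le[OF f.m2.subspace_hom_eq[OF assms(1,2)]]) (use assms in auto)
  then show ?thesis using assms by auto
qed

section \<open>Graded algebras\<close>

text \<open>Sign, augmentation and degree projections all rescale homogeneous components by
  integers. Treating them together gives linearity, commutation with each other and commutation with
  evaluation in one go.\<close>

definition weight :: "('g \<Rightarrow> 'a::ring_1 set) \<Rightarrow> ('g \<Rightarrow> int) \<Rightarrow> 'a \<Rightarrow> 'a" where
  "weight gr w x = (\<Sum>g\<in>Poly_Mapping.keys (decomp gr x). of_int (w g) * Poly_Mapping.lookup (decomp gr x) g)"

definition proj :: "('g \<Rightarrow> int) \<Rightarrow> ('g \<Rightarrow> 'a::ring_1 set) \<Rightarrow> int \<Rightarrow> 'a \<Rightarrow> 'a" where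
  "proj \<delta> gr n = weight gr (\<lambda>g. if \<delta> g = n then 1 else 0)"

lemma bar_sign_weight: "bar_sign \<delta> gr = weight gr (\<lambda>g. if even (1 + \<delta> g) then 1 else - 1)"
  unfolding bar_sign_def weight_def fun_eq_iff by (auto intro!: sum.cong)

lemma augmentation_proj: "augmentation \<delta> gr = proj \<delta> (gr :: 'g \<Rightarrow> 'a::ring_1 set) 0"
  unfolding augmentation_def weight_def proj_def fun_eq_iff
  by (intro allI sum.mono_neutral_cong_left) auto

context graded_algebra
begin

lemma decomp_ex:
  "(\<forall>g. Poly_Mapping.lookup (decomp gr x) g \<in> gr g)
    \<and> (\<Sum>g\<in>Poly_Mapping.keys (decomp gr x). Poly_Mapping.lookup (decomp gr x) g) = x"
  unfolding decomp_def by (rule theI') (rule direct_sum)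

lemma lookup_decomp_gr: "Poly_Mapping.lookup (decomp gr x) g \<in> gr g"
  using decomp_ex by blast

lemma sum_decomp: "(\<Sum>g\<in>Poly_Mapping.keys (decomp gr x). Poly_Mapping.lookup (decomp gr x) g) = x"
  using decomp_ex by blast

lemma decomp_eqI:
  assumes "\<And>g. Poly_Mapping.lookup f g \<in> gr g"
    and "(\<Sum>g\<in>Poly_Mapping.keys f. Poly_Mapping.lookup f g) = x"
  shows "decomp gr x = f"
  using direct_sum[of x] decomp_ex[of x] assms by (metis (no_types, lifting))

lemma decomp_add: "decomp gr (x + y) = decomp gr x + decomp gr y"
proof (rule decomp_eqI)
  show "Poly_Mapping.lookup (decomp gr x + decomp gr y) g \<in> gr g" for g
    by (simp add: lookup_add subspace_add[OF subspace_gr] lookup_decomp_gr)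
  show "(\<Sum>g\<in>Poly_Mapping.keys (decomp gr x + decomp gr y). Poly_Mapping.lookup (decomp gr x + decomp gr y) g) = x + y"
    using setsum_keys_plus_distrib[of "\<lambda>g y. y" "decomp gr x" "decomp gr y"] by (simp add: sum_decomp)
qed

lemma decomp_gr: "x \<in> gr g \<Longrightarrow> decomp gr x = Poly_Mapping.single g x"
  by (rule decomp_eqI) (auto simp: lookup_single when_def subspace_0[OF subspace_gr])

lemma weight_add: "weight gr w (x + y) = weight gr w x + weight gr w y"
  unfolding weight_def decomp_add
  by (rule setsum_keys_plus_distrib) (auto simp: algebra_simps)

lemma weight_gr: "x \<in> gr g \<Longrightarrow> weight gr w x = of_int (w g) * x"
  by (simp add: weight_def decomp_gr)

lemma gr_induct [case_names gr add]:
  assumes "\<And>g x. x \<in> gr g \<Longrightarrow> Q x" and "\<And>x y. Q x \<Longrightarrow> Q y \<Longrightarrow> Q (x + y)"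
  shows "Q x"
proof -
  have 0: "Q 0" using assms(1) subspace_0[OF subspace_gr] by blast
  have "Q (\<Sum>g\<in>K. Poly_Mapping.lookup (decomp gr x) g)" if "finite K" for K
    using that by induction (auto intro: assms(2) assms(1)[OF lookup_decomp_gr] 0)
  then show ?thesis using sum_decomp[of x] by (metis finite_keys)
qed

lemma scale_gr: "x \<in> gr g \<Longrightarrow> scale c x \<in> gr g"
  by (rule subspace_scale[OF subspace_gr])

lemma weight_scale: "weight gr w (scale c x) = scale c (weight gr w x)"
  by (induction x rule: gr_induct)
    (simp_all add: weight_gr[OF scale_gr] weight_gr scale_right_distrib weight_add scale_mult_right)

lemma module_hom_weight: "module_hom scale scale (weight gr w)"
  by (intro module_hom.intro module_hom_axioms.intro module_axioms weight_add weight_scale)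

sublocale weight: module_hom scale scale "weight gr w" for w
  by (rule module_hom_weight)

text \<open>\<open>weight\<close> multiplies by integers inside the ring, whereas closure of the
  homogeneous components is known for scalars.\<close>

lemma of_int_mult_scale: "of_int n * x = scale (of_int n) x"
proof (induction n rule: int_induct[where k = 0])
  case base show ?case by simp
next
  case (step1 i) then show ?case by (simp add: distrib_right scale_left_distrib)
next
  case (step2 i) then show ?case by (simp add: left_diff_distrib scale_left_diff_distrib)
qed

lemma of_int_mult_gr: "x \<in> gr g \<Longrightarrow> of_int n * x \<in> gr g"
  by (simp add: of_int_mult_scale scale_gr)

lemma weight_weight: "weight gr v (weight gr w x) = weight gr (\<lambda>g. v g * w g) x"
  by (induction x rule: gr_induct)
    (simp_all add: weight_gr weight_gr[OF of_int_mult_gr] weight_add mult.assoc)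

lemma proj_gr: "x \<in> gr g \<Longrightarrow> proj \<delta> gr n x = (if \<delta> g = n then x else 0)"
  by (simp add: proj_def weight_gr)

lemma module_hom_proj: "module_hom scale scale (proj \<delta> gr n)"
  unfolding proj_def by (rule module_hom_weight)

sublocale proj: module_hom scale scale "proj \<delta> gr n" for n
  by (rule module_hom_proj)

lemma proj_proj: "proj \<delta> gr m (proj \<delta> gr n x) = (if m = n then proj \<delta> gr n x else 0)"
  by (induction x rule: gr_induct) (simp_all add: proj_gr proj.add)

lemma sum_proj: "\<exists>K. finite K \<and> x = (\<Sum>n\<in>K. proj \<delta> gr n x)"
proof (intro exI conjI)
  \<comment> \<open>Several G-degrees may have the same image under \<delta>; swapping the double
    sum over Z-degrees and G-degrees counts each component once.\<close>
  let ?K = "\<delta> ` Poly_Mapping.keys (decomp gr x)"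
  have "(\<Sum>n\<in>?K. proj \<delta> gr n x)
      = (\<Sum>n\<in>?K. \<Sum>g\<in>Poly_Mapping.keys (decomp gr x). if \<delta> g = n then Poly_Mapping.lookup (decomp gr x) g else 0)"
    by (auto simp: proj_def weight_def intro!: sum.cong)
  also have "\<dots> = (\<Sum>g\<in>Poly_Mapping.keys (decomp gr x). Poly_Mapping.lookup (decomp gr x) g)"
    by (subst sum.swap) (auto intro!: sum.cong)
  finally show "x = (\<Sum>n\<in>?K. proj \<delta> gr n x)" by (simp add: sum_decomp)
qed simp

lemma proj_mult_proj:
  "proj \<delta> gr n (proj \<delta> gr k x * proj \<delta> gr m y) = (if k + m = n then proj \<delta> gr k x * proj \<delta> gr m y else 0)"
proof (induction x rule: gr_induct)
  case (gr g x)
  then show ?case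
  proof (induction y rule: gr_induct)
    case (gr h y)
    then show ?case by (simp add: proj_gr proj_gr[OF mult_gr] delta_add)
  next
    case (add y z)
    then show ?case by (auto simp add: proj.add algebra_simps)
  qed
next
  case (add x z)
  then show ?case by (auto simp add: proj.add algebra_simps)
qed

text \<open>The degree inductions below rest on this: only products of components whose degrees add
  up to n contribute to the degree n part of a product.\<close>

lemma proj_mult_in:
  assumes V: "subspace V" and "\<And>k m. k + m = n \<Longrightarrow> proj \<delta> gr k x * proj \<delta> gr m y \<in> V"
  shows "proj \<delta> gr n (x * y) \<in> V"
proof -
  obtain K L where K: "x = (\<Sum>k\<in>K. proj \<delta> gr k x)" and L: "y = (\<Sum>m\<in>L. proj \<delta> gr m y)"
    using sum_proj by metis
  have "x * y = (\<Sum>k\<in>K. \<Sum>m\<in>L. proj \<delta> gr k x * proj \<delta> gr m y)"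
    by (subst K, subst L) (simp add: sum_product)
  then have "proj \<delta> gr n (x * y) = (\<Sum>k\<in>K. \<Sum>m\<in>L. proj \<delta> gr n (proj \<delta> gr k x * proj \<delta> gr m y))"
    by (simp add: proj.sum)
  also have "\<dots> \<in> V"
    by (intro subspace_sum[OF V]) (auto simp: proj_mult_proj assms subspace_0[OF V])
  finally show ?thesis .
qed

lemma aug_ideal_proj: "aug_ideal \<delta> gr = {x. proj \<delta> gr 0 x = 0}"
  by (simp add: aug_ideal_def augmentation_proj)

abbreviation "bar \<equiv> bar_sign \<delta> gr"

lemma module_hom_bar: "module_hom scale scale bar"
  unfolding bar_sign_weight by (rule module_hom_weight)

sublocale bar: module_hom scale scale bar
  by (rule module_hom_bar)

lemma bar_gr: "x \<in> gr g \<Longrightarrow> bar x = (if even (\<delta> g) then - x else x)"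
  by (simp add: bar_sign_weight weight_gr)

lemma bar_bar [simp]: "bar (bar x) = x"
  by (induction x rule: gr_induct) (auto simp add: bar_gr bar.add bar.neg)

text \<open>The exponent 1 + deg contributes its 1 once on the left and twice on the right. The
  resulting sign makes the two terms of d d cancel.\<close>

lemma bar_mult: "bar (x * y) = - (bar x * bar y)"
proof (induction x rule: gr_induct)
  case (gr g x)
  then show ?case
    by (induction y rule: gr_induct)
      (auto simp add: bar_gr bar_gr[OF mult_gr] delta_add bar.add algebra_simps)
next
  case (add x z)
  then show ?case by (simp add: bar.add algebra_simps)
qed

lemma proj_bar: "proj \<delta> gr n (bar x) = bar (proj \<delta> gr n x)"
  unfolding proj_def bar_sign_weight weight_weight by (simp only: mult.commute)

lemma bar_in_aug_ideal [simp]: "bar x \<in> aug_ideal \<delta> gr \<longleftrightarrow> x \<in> aug_ideal \<delta> gr"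
proof -
  have "proj \<delta> gr 0 (bar x) = 0 \<longleftrightarrow> proj \<delta> gr 0 x = 0"
    unfolding proj_bar using bar_bar[of "proj \<delta> gr 0 x"] bar.zero by metis
  then show ?thesis by (simp add: aug_ideal_proj)
qed

lemma subspace_aug_ideal: "subspace (aug_ideal \<delta> gr)"
  unfolding aug_ideal_proj by (rule proj.subspace_kernel)

end

section \<open>The tensor algebra\<close>

lemma fscale_conv_mult: "fscale c p = Poly_Mapping.single 0 c * p" for p :: "'b::monoid_add \<Rightarrow>\<^sub>0 'k::comm_ring_1"
  by (simp add: fscale_def mult_map_scale_conv_mult)

lemma single_zero_mult_commute:
  "Poly_Mapping.single 0 c * p = p * Poly_Mapping.single 0 c" for p :: "'b::monoid_add \<Rightarrow>\<^sub>0 'k::comm_ring_1"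
  by (induction p rule: poly_mapping_add_induct) (simp_all add: mult_single algebra_simps)

lemma fscale_mult_left: "fscale c p * q = fscale c (p * q)"
  for p :: "'b::monoid_add \<Rightarrow>\<^sub>0 'k::comm_ring_1"
  by (simp add: fscale_conv_mult mult.assoc)

lemma fscale_mult_right: "p * fscale c q = fscale c (p * q)"
  for p :: "'b::monoid_add \<Rightarrow>\<^sub>0 'k::comm_ring_1"
  by (metis fscale_conv_mult mult.assoc single_zero_mult_commute)

lemma letters_zero [simp]: "letters 0 = []"
  by (simp add: zero_word_def)

lemma letters_plus [simp]: "letters (u + v) = letters u @ letters v"
  by (simp add: plus_word_def)

abbreviation word_degree :: "('i \<Rightarrow> 'g::comm_monoid_add) \<Rightarrow> 'i word \<Rightarrow> 'g" where
  "word_degree dg u \<equiv> (\<Sum>i\<leftarrow>letters u. dg i)"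

lemma subspace_tensor_gr: "fs.subspace (tensor_gr dg g)"
  using subspace_free_on[of "{u. word_degree dg u = g}"]
  by (simp add: tensor_gr_def free_on_def subset_eq)

lemma single_tensor_gr: "Poly_Mapping.single u c \<in> tensor_gr dg (word_degree dg u)"
  by (simp add: tensor_gr_def)

text \<open>A word has one degree, so its coefficient in the total sum can only come from the
  component of that degree. This yields uniqueness of the decomposition into homogeneous
  polynomials.\<close>

lemma lookup_lookup_tensor_gr:
  assumes f: "\<And>g. Poly_Mapping.lookup f g \<in> tensor_gr dg g"
  shows "Poly_Mapping.lookup (Poly_Mapping.lookup f g) u
    = (if word_degree dg u = g
       then Poly_Mapping.lookup (\<Sum>g\<in>Poly_Mapping.keys f. Poly_Mapping.lookup f g) u else 0)"
proof -
  have z: "Poly_Mapping.lookup (Poly_Mapping.lookup f h) u = 0" if "h \<noteq> word_degree dg u" for h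
    using f[of h] that by (auto simp: tensor_gr_def in_keys_iff)
  have "Poly_Mapping.lookup (\<Sum>g\<in>Poly_Mapping.keys f. Poly_Mapping.lookup f g) u
      = (\<Sum>h\<in>Poly_Mapping.keys f. Poly_Mapping.lookup (Poly_Mapping.lookup f h) u)"
    by (simp add: lookup_sum)
  also have "\<dots> = (\<Sum>h\<in>Poly_Mapping.keys f. if h = word_degree dg u then Poly_Mapping.lookup (Poly_Mapping.lookup f h) u else 0)"
    by (rule sum.cong) (auto simp: z)
  also have "\<dots> = Poly_Mapping.lookup (Poly_Mapping.lookup f (word_degree dg u)) u"
    by (auto simp: in_keys_iff)
  finally show ?thesis using z by auto
qed

lemma tensor_gr_decomposition:
  fixes p :: "'i word \<Rightarrow>\<^sub>0 'k::comm_ring_1"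
  shows "\<exists>f. (\<forall>g. Poly_Mapping.lookup f g \<in> tensor_gr dg g)
    \<and> (\<Sum>g\<in>Poly_Mapping.keys f. Poly_Mapping.lookup f g) = p"
proof (induction p rule: poly_mapping_add_induct)
  case (single u c)
  show ?case
    by (rule exI[of _ "Poly_Mapping.single (word_degree dg u) (Poly_Mapping.single u c)"])
      (auto simp: lookup_single when_def single_tensor_gr fs.subspace_0[OF subspace_tensor_gr])
next
  case (add p q)
  then obtain f h where f: "\<And>g. Poly_Mapping.lookup f g \<in> tensor_gr dg g"
      "(\<Sum>g\<in>Poly_Mapping.keys f. Poly_Mapping.lookup f g) = p"
    and h: "\<And>g. Poly_Mapping.lookup h g \<in> tensor_gr dg g"
      "(\<Sum>g\<in>Poly_Mapping.keys h. Poly_Mapping.lookup h g) = q"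
    by blast
  have "(\<Sum>g\<in>Poly_Mapping.keys (f + h). Poly_Mapping.lookup (f + h) g) = p + q"
    using setsum_keys_plus_distrib[of "\<lambda>g y. y" f h] f(2) h(2) by simp
  then show ?case
    using f(1) h(1) by (intro exI[of _ "f + h"]) (simp add: lookup_add fs.subspace_add[OF subspace_tensor_gr])
qed

text \<open>The grading is put on polynomials in all indices of the type, where letters outside a
  given set may have any degree; consequences of positivity are therefore restricted to
  \<open>tensor_algebra X\<close>.\<close>

lemma graded_algebra_tensor:
  fixes \<delta> :: "'g::comm_monoid_add \<Rightarrow> int" and dg :: "'i \<Rightarrow> 'g"
  assumes "\<delta> 0 = 0" and "\<And>g h. \<delta> (g + h) = \<delta> g + \<delta> h"
  shows "graded_algebra (fscale :: 'k::comm_ring_1 \<Rightarrow> _) \<delta> (tensor_gr dg)"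
proof (intro graded_algebra.intro graded_algebra_axioms.intro fs.module_axioms assms
    fscale_mult_left fscale_mult_right subspace_tensor_gr)
  show "\<exists>!f. (\<forall>g. Poly_Mapping.lookup f g \<in> tensor_gr dg g)
      \<and> (\<Sum>g\<in>Poly_Mapping.keys f. Poly_Mapping.lookup f g) = p"
    for p :: "'i word \<Rightarrow>\<^sub>0 'k"
  proof (rule ex_ex1I[OF tensor_gr_decomposition], elim conjE, intro poly_mapping_eqI)
    fix f h :: "'g \<Rightarrow>\<^sub>0 'i word \<Rightarrow>\<^sub>0 'k" and g u
    assume "\<forall>g. Poly_Mapping.lookup f g \<in> tensor_gr dg g" "\<forall>g. Poly_Mapping.lookup h g \<in> tensor_gr dg g"
      and "sum (Poly_Mapping.lookup f) (Poly_Mapping.keys f) = p" "sum (Poly_Mapping.lookup h) (Poly_Mapping.keys h) = p"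
    then show "Poly_Mapping.lookup (Poly_Mapping.lookup f g) u = Poly_Mapping.lookup (Poly_Mapping.lookup h g) u"
      using lookup_lookup_tensor_gr[of f dg g u] lookup_lookup_tensor_gr[of h dg g u] by simp
  qed
  show "1 \<in> (tensor_gr dg 0 :: ('i word \<Rightarrow>\<^sub>0 'k) set)"
    by (simp add: tensor_gr_def)
  show "p * q \<in> tensor_gr dg (g + h)" if "p \<in> tensor_gr dg g" "q \<in> tensor_gr dg h"
    for p q :: "'i word \<Rightarrow>\<^sub>0 'k" and g h
    using that by (auto simp: tensor_gr_def dest!: subsetD[OF keys_mult])
qed

lemma tensor_algebra_free_on: "tensor_algebra Y = free_on {u. set (letters u) \<subseteq> Y}"
  by (auto simp: tensor_algebra_def free_on_def)

lemma subspace_tensor_algebra: "fs.subspace (tensor_algebra Y)"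
  unfolding tensor_algebra_free_on by (rule subspace_free_on)

lemma one_tensor_algebra: "1 \<in> tensor_algebra Y"
  by (simp add: tensor_algebra_def)

lemma tvar_tensor_algebra: "i \<in> Y \<Longrightarrow> tvar i \<in> tensor_algebra Y"
  by (auto simp: tensor_algebra_def tvar_def)

lemma mult_tensor_algebra:
  assumes "p \<in> tensor_algebra Y" "q \<in> tensor_algebra Y"
  shows "p * q \<in> tensor_algebra Y"
  unfolding tensor_algebra_def
proof (intro CollectI ballI)
  fix w assume "w \<in> Poly_Mapping.keys (p * q)"
  then obtain u v where "w = u + v" "u \<in> Poly_Mapping.keys p" "v \<in> Poly_Mapping.keys q"
    using keys_mult[of p q] by blast
  then show "set (letters w) \<subseteq> Y" using assms by (simp add: tensor_algebra_def)
qed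

lemma tensor_eval_lin_ext: "tensor_eval scale a = lin_ext scale (\<lambda>u. \<Prod>i\<leftarrow>letters u. a i)"
  by (simp add: tensor_eval_def lin_ext_def fun_eq_iff)

lemma ring_ring_on:
  assumes "1 \<in> S" and "\<And>x y. x \<in> S \<Longrightarrow> y \<in> S \<Longrightarrow> x - y \<in> S" and "\<And>x y. x \<in> S \<Longrightarrow> y \<in> S \<Longrightarrow> x * y \<in> S"
  shows "ring (ring_on S)"
proof -
  have 0: "0 \<in> S" using assms(1,2) by (metis diff_self)
  have m: "- x \<in> S" if "x \<in> S" for x using assms(2)[OF 0 that] by simp
  have "x + y \<in> S" if "x \<in> S" "y \<in> S" for x y using assms(2)[OF that(1) m[OF that(2)]] by simp
  moreover have "\<exists>y\<in>S. y + x = 0" if "x \<in> S" for x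
    using m[OF that] by (intro bexI[of _ "- x"]) auto
  ultimately show ?thesis
    using 0 assms
    by (intro ringI abelian_groupI monoidI)
      (simp_all add: ring_on_def add.assoc mult.assoc add.commute distrib_left distrib_right)
qed

section \<open>Evaluation of noncommutative polynomials\<close>

context graded_algebra
begin

abbreviation ev :: "('i \<Rightarrow> 'a) \<Rightarrow> ('i word \<Rightarrow>\<^sub>0 'k) \<Rightarrow> 'a" where
  "ev \<equiv> tensor_eval scale"

lemma module_hom_ev: "module_hom fscale scale (ev a)"
  unfolding tensor_eval_lin_ext by (rule module_hom_lin_ext)

sublocale ev: module_hom fscale scale "ev a" for a
  by (rule module_hom_ev)

lemma ev_single: "ev a (Poly_Mapping.single u c) = scale c (\<Prod>i\<leftarrow>letters u. a i)"
  by (simp add: tensor_eval_lin_ext)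

lemma ev_mult: "ev a (p * q) = ev a p * ev a q"
proof (induction p rule: poly_mapping_add_induct)
  case (single u c)
  show ?case
    by (induction q rule: poly_mapping_add_induct)
      (simp_all add: mult_single ev_single ev.add algebra_simps scale_mult_left scale_mult_right)
qed (simp add: ev.add algebra_simps)

lemma ev_one: "ev a 1 = 1"
  using ev_single[of a 0 1] by simp

lemma ev_tvar: "ev a (tvar i) = a i"
  by (simp add: tvar_def ev_single)

lemma prod_list_gr:
  "(\<And>i. i \<in> set l \<Longrightarrow> a i \<in> gr (dg i)) \<Longrightarrow> (\<Prod>i\<leftarrow>l. a i) \<in> gr (\<Sum>i\<leftarrow>l. dg i)"
  by (induction l) (auto intro: one_gr mult_gr)

end

section \<open>Evaluation at homogeneous elements of positive degree\<close>

locale graded_evaluation = graded_algebra scale \<delta> gr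
  for scale :: "'k::comm_ring_1 \<Rightarrow> 'a::ring_1 \<Rightarrow> 'a"
    and \<delta> :: "'g::comm_monoid_add \<Rightarrow> int" and gr :: "'g \<Rightarrow> 'a set" +
  fixes X :: "'i set" and a :: "'i \<Rightarrow> 'a" and dg :: "'i \<Rightarrow> 'g"
  assumes a_gr: "i \<in> X \<Longrightarrow> a i \<in> gr (dg i)"
    and dg_pos: "i \<in> X \<Longrightarrow> 0 < \<delta> (dg i)"
begin

abbreviation TX :: "('i word \<Rightarrow>\<^sub>0 'k) set" where
  "TX \<equiv> tensor_algebra X"

sublocale T: graded_algebra "fscale :: 'k \<Rightarrow> ('i word \<Rightarrow>\<^sub>0 'k) \<Rightarrow> _" \<delta> "tensor_gr dg"
  by (rule graded_algebra_tensor) (rule delta_zero delta_add)+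

abbreviation IT :: "('i word \<Rightarrow>\<^sub>0 'k) set" where
  "IT \<equiv> TX \<inter> aug_ideal \<delta> (tensor_gr dg)"

abbreviation e :: "('i word \<Rightarrow>\<^sub>0 'k) \<Rightarrow> 'a" where
  "e \<equiv> ev a"

lemma weight_single:
  "weight (tensor_gr dg) w (Poly_Mapping.single u c)
    = Poly_Mapping.single u (of_int (w (word_degree dg u)) * c :: 'k)"
proof -
  have "(of_int n :: 'i word \<Rightarrow>\<^sub>0 'k) = Poly_Mapping.single 0 (of_int n)" for n
    by simp
  then show ?thesis
    by (simp only: T.weight_gr[OF single_tensor_gr] mult_single) simp
qed

lemma weight_TX: "p \<in> TX \<Longrightarrow> weight (tensor_gr dg) w p \<in> TX"
proof -
  have "free_on {u. set (letters u) \<subseteq> X} \<subseteq> {p. weight (tensor_gr dg) w p \<in> TX}"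
    by (rule free_on_le[OF fs.subspace_hom_vimage[OF T.module_hom_weight subspace_tensor_algebra]])
      (auto simp: weight_single tensor_algebra_def)
  then show "p \<in> TX \<Longrightarrow> weight (tensor_gr dg) w p \<in> TX"
    by (auto simp: tensor_algebra_free_on)
qed

lemma proj_TX: "p \<in> TX \<Longrightarrow> proj \<delta> (tensor_gr dg) n p \<in> TX"
  unfolding proj_def by (rule weight_TX)

lemma bar_TX: "p \<in> TX \<Longrightarrow> T.bar p \<in> TX"
  unfolding bar_sign_weight by (rule weight_TX)

text \<open>Each letter has the degree of its value, so a word and its value are homogeneous of the
  same degree and are rescaled by the same integer. The rest is linearity.\<close>

lemma ev_weight:
  assumes "p \<in> TX"
  shows "e (weight (tensor_gr dg) w p) = weight gr w (e p)"
proof (rule hom_eq_on_free[where S = "{u. set (letters u) \<subseteq> X}"])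
  show "module_hom fscale scale (\<lambda>p. e (weight (tensor_gr dg) w p))"
    using module_hom_compose[OF T.module_hom_weight module_hom_ev] by (simp add: o_def)
  show "module_hom fscale scale (\<lambda>p. weight gr w (e p))"
    using module_hom_compose[OF module_hom_ev module_hom_weight] by (simp add: o_def)
  fix u assume "u \<in> {u. set (letters u) \<subseteq> X}"
  then have "(\<Prod>i\<leftarrow>letters u. a i) \<in> gr (word_degree dg u)"
    by (intro prod_list_gr a_gr) auto
  then show "e (weight (tensor_gr dg) w (Poly_Mapping.single u 1)) = weight gr w (e (Poly_Mapping.single u 1))"
    by (simp add: weight_single ev_single weight_gr of_int_mult_scale)
qed (use assms in \<open>simp add: tensor_algebra_free_on\<close>)

lemma ev_proj: "p \<in> TX \<Longrightarrow> e (proj \<delta> (tensor_gr dg) n p) = proj \<delta> gr n (e p)"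
  unfolding proj_def by (rule ev_weight)

lemma ev_bar: "p \<in> TX \<Longrightarrow> e (T.bar p) = bar (e p)"
  unfolding bar_sign_weight by (rule ev_weight)

lemma ev_gr: "p \<in> TX \<Longrightarrow> p \<in> tensor_gr dg g \<Longrightarrow> e p \<in> gr g"
proof -
  have "free_on {u. set (letters u) \<subseteq> X \<and> word_degree dg u = g} \<subseteq> {p. e p \<in> gr g}"
    by (rule free_on_le[OF subspace_hom_vimage[OF module_hom_ev subspace_gr]])
      (auto simp: ev_single intro!: prod_list_gr a_gr)
  then show "p \<in> TX \<Longrightarrow> p \<in> tensor_gr dg g \<Longrightarrow> e p \<in> gr g"
    by (auto simp: tensor_algebra_def free_on_def tensor_gr_def subset_eq)
qed

lemma delta_word_pos:
  assumes "set (letters u) \<subseteq> X" "letters u \<noteq> []"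
  shows "0 < \<delta> (word_degree dg u)"
proof -
  have "0 \<le> \<delta> (\<Sum>i\<leftarrow>l. dg i) \<and> (l \<noteq> [] \<longrightarrow> 0 < \<delta> (\<Sum>i\<leftarrow>l. dg i))" if "set l \<subseteq> X" for l
    using that by (induction l) (auto simp: delta_zero delta_add dest: dg_pos)
  then show ?thesis using assms by blast
qed

lemma proj_single:
  "proj \<delta> (tensor_gr dg) n (Poly_Mapping.single u c)
    = (if \<delta> (word_degree dg u) = n then Poly_Mapping.single u (c :: 'k) else 0)"
  by (rule T.proj_gr[OF single_tensor_gr])

lemma proj_neg_TX:
  assumes "p \<in> TX" "n < 0"
  shows "proj \<delta> (tensor_gr dg) n p = 0"
proof -
  have "free_on {u. set (letters u) \<subseteq> X} \<subseteq> {p. proj \<delta> (tensor_gr dg) n p \<in> {0 :: 'i word \<Rightarrow>\<^sub>0 'k}}"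
  proof (rule free_on_le[OF fs.subspace_hom_vimage[OF T.module_hom_proj fs.subspace_single_0]])
    fix u assume "u \<in> {u. set (letters u) \<subseteq> X}"
    then have "\<delta> (word_degree dg u) \<ge> 0"
      using delta_word_pos[of u] delta_zero by (cases "letters u") auto
    then have "proj \<delta> (tensor_gr dg) n (Poly_Mapping.single u (1 :: 'k)) = 0"
      using assms(2) proj_single[of n u 1] by simp
    then show "Poly_Mapping.single u 1 \<in> {p. proj \<delta> (tensor_gr dg) n p \<in> {0 :: 'i word \<Rightarrow>\<^sub>0 'k}}"
      by simp
  qed
  then show ?thesis using assms(1) by (auto simp: tensor_algebra_free_on)
qed

text \<open>All letters have positive degree, so the empty word is the only one of degree 0 and the
  degree zero part is the constant term.\<close>

lemma proj_zero_TX: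
  assumes "p \<in> TX"
  shows "proj \<delta> (tensor_gr dg) 0 p = Poly_Mapping.single 0 (Poly_Mapping.lookup p 0)"
proof (rule hom_eq_on_free[where S = "{u. set (letters u) \<subseteq> X}" and sc = fscale, OF T.module_hom_proj])
  show "module_hom fscale fscale (\<lambda>p :: 'i word \<Rightarrow>\<^sub>0 'k. Poly_Mapping.single (0 :: 'i word) (Poly_Mapping.lookup p 0))"
    by (intro module_hom.intro module_hom_axioms.intro fs.module_axioms) (simp_all add: lookup_add single_add)
  fix u assume "u \<in> {u. set (letters u) \<subseteq> X}"
  then show "proj \<delta> (tensor_gr dg) 0 (Poly_Mapping.single u 1)
      = Poly_Mapping.single 0 (Poly_Mapping.lookup (Poly_Mapping.single u (1 :: 'k)) 0)"
    using delta_word_pos[of u] by (cases u; cases "letters u = []") (auto simp: proj_single zero_word_def lookup_single when_def delta_zero)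
qed (use assms in \<open>simp add: tensor_algebra_free_on\<close>)

lemma IT_iff: "p \<in> IT \<longleftrightarrow> p \<in> TX \<and> Poly_Mapping.lookup p 0 = 0"
proof -
  have "Poly_Mapping.single (0 :: 'i word) c = 0 \<longleftrightarrow> c = 0" for c :: 'k
    by (metis lookup_single_eq lookup_zero single_zero)
  then show ?thesis using proj_zero_TX by (auto simp: T.aug_ideal_proj)
qed

lemma bar_IT: "p \<in> IT \<Longrightarrow> T.bar p \<in> IT"
  using bar_TX by auto

lemma ev_IT: "p \<in> IT \<Longrightarrow> e p \<in> aug_ideal \<delta> gr"
  using ev_proj[of p 0] by (simp add: aug_ideal_proj T.aug_ideal_proj)

lemma subspace_IT: "fs.subspace IT"
  by (rule fs.subspace_inter[OF subspace_tensor_algebra T.subspace_aug_ideal])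

lemma tvar_IT: "i \<in> X \<Longrightarrow> tvar i \<in> IT"
  unfolding IT_iff by (simp add: tvar_tensor_algebra) (simp add: tvar_def lookup_single when_def zero_word_def)

end

section \<open>Quotient modules\<close>

lemma ring_on_simps [simp]:
  "carrier (ring_on S) = S" "x \<otimes>\<^bsub>ring_on S\<^esub> y = x * y" "x \<oplus>\<^bsub>ring_on S\<^esub> y = x + y"
  "\<one>\<^bsub>ring_on S\<^esub> = 1" "\<zero>\<^bsub>ring_on S\<^esub> = 0"
  by (simp_all add: ring_on_def)

lemma cring_ground_ring: "cring (ring_on (UNIV :: 'k::comm_ring_1 set))"
proof -
  interpret ring "ring_on (UNIV :: 'k set)" by (rule ring_ring_on) simp_all
  show ?thesis by unfold_locales (simp add: mult.commute)
qed

lemma quot_module_simps [simp]: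
  "carrier (quot_module M N) = a_rcosets\<^bsub>M\<^esub> N" "\<zero>\<^bsub>quot_module M N\<^esub> = N"
  "X \<oplus>\<^bsub>quot_module M N\<^esub> Y = X <+>\<^bsub>M\<^esub> Y"
  "c \<odot>\<^bsub>quot_module M N\<^esub> X = (\<Union>x\<in>X. N +>\<^bsub>M\<^esub> (c \<odot>\<^bsub>M\<^esub> x))"
  by (simp_all add: quot_module_def)

lemma abelian_subgroup_submodule:
  assumes "module R M" "submodule N R M"
  shows "abelian_subgroup N M"
  by (intro abelian_subgroupI3 additive_subgroupI submodule.axioms(1)[OF assms(2)] module.axioms(2)[OF assms(1)])

text \<open>Scalar multiplication on a quotient is a union over representatives. The cosets in this
  union coincide, because representatives differ by elements of \<open>N\<close> and
  \<open>N\<close> is closed under scalars.\<close>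

lemma quot_module_smult_coset:
  assumes M: "module (ring_on (UNIV :: 'k::comm_ring_1 set)) M"
    and N: "submodule N (ring_on (UNIV :: 'k set)) M" and x: "x \<in> carrier M"
  shows "c \<odot>\<^bsub>quot_module M N\<^esub> (N +>\<^bsub>M\<^esub> x) = N +>\<^bsub>M\<^esub> (c \<odot>\<^bsub>M\<^esub> x)"
proof -
  interpret module "ring_on (UNIV :: 'k set)" M by fact
  interpret N: submodule N "ring_on (UNIV :: 'k set)" M by fact
  interpret abelian_subgroup N M by (rule abelian_subgroup_submodule[OF M N])
  have "N +>\<^bsub>M\<^esub> (c \<odot>\<^bsub>M\<^esub> y) = N +>\<^bsub>M\<^esub> (c \<odot>\<^bsub>M\<^esub> x)" if y: "y \<in> N +>\<^bsub>M\<^esub> x" for y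
  proof -
    obtain h where h: "h \<in> N" "y = h \<oplus>\<^bsub>M\<^esub> x" using y by (auto simp: a_r_coset_def')
    then have "c \<odot>\<^bsub>M\<^esub> y = c \<odot>\<^bsub>M\<^esub> h \<oplus>\<^bsub>M\<^esub> c \<odot>\<^bsub>M\<^esub> x"
      using x by (simp add: smult_r_distr)
    then have "c \<odot>\<^bsub>M\<^esub> y \<in> N +>\<^bsub>M\<^esub> (c \<odot>\<^bsub>M\<^esub> x)"
      using h(1) by (auto simp: a_r_coset_def')
    then show ?thesis
      by (rule a_repr_independence[symmetric]) (use x a_subgroup in simp_all)
  qed
  then show ?thesis unfolding quot_module_simps using a_rcos_self[OF x] by (intro equalityI UN_least) blast+
qed

lemma module_quot_module:
  assumes M: "module (ring_on (UNIV :: 'k::comm_ring_1 set)) M"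
    and N: "submodule N (ring_on (UNIV :: 'k set)) M"
  shows "module (ring_on (UNIV :: 'k set)) (quot_module M N)"
proof -
  interpret module "ring_on (UNIV :: 'k set)" M by fact
  interpret N: submodule N "ring_on (UNIV :: 'k set)" M by fact
  interpret abelian_subgroup N M by (rule abelian_subgroup_submodule[OF M N])
  note sm = quot_module_smult_coset[OF M N]
  have coset: "\<exists>x\<in>carrier M. X = N +>\<^bsub>M\<^esub> x" if "X \<in> a_rcosets\<^bsub>M\<^esub> N" for X
    using that by (auto simp: A_RCOSETS_def')
  have in_rcosets: "N +>\<^bsub>M\<^esub> x \<in> a_rcosets\<^bsub>M\<^esub> N" if "x \<in> carrier M" for x
    using that by (auto simp: A_RCOSETS_def')
  have N0: "N = N +>\<^bsub>M\<^esub> \<zero>\<^bsub>M\<^esub>"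
    using a_coset_add_zero[OF a_subset] by simp
  have ab: "abelian_group (quot_module M N)"
  proof (rule abelian_groupI)
    fix X assume "X \<in> carrier (quot_module M N)"
    then obtain x where x: "x \<in> carrier M" "X = N +>\<^bsub>M\<^esub> x" using coset by auto
    then have "N +>\<^bsub>M\<^esub> (\<ominus>\<^bsub>M\<^esub> x) <+>\<^bsub>M\<^esub> X = N"
      using N0 by (simp add: a_rcos_sum M.l_neg)
    then show "\<exists>Y\<in>carrier (quot_module M N). Y \<oplus>\<^bsub>quot_module M N\<^esub> X = \<zero>\<^bsub>quot_module M N\<^esub>"
      using x by (intro bexI[of _ "N +>\<^bsub>M\<^esub> (\<ominus>\<^bsub>M\<^esub> x)"]) (simp_all add: in_rcosets)
    have "N <+>\<^bsub>M\<^esub> X = X"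
      using x N0 a_rcos_sum[of "\<zero>\<^bsub>M\<^esub>" x] by simp
    then show "\<zero>\<^bsub>quot_module M N\<^esub> \<oplus>\<^bsub>quot_module M N\<^esub> X = X" by simp
  qed (auto dest!: coset simp: a_rcos_sum in_rcosets M.a_assoc M.a_comm M.a_lcomm a_subgroup_in_rcosets)
  let ?Q = "quot_module M N"
  have add: "(N +>\<^bsub>M\<^esub> x) \<oplus>\<^bsub>?Q\<^esub> (N +>\<^bsub>M\<^esub> y) = N +>\<^bsub>M\<^esub> (x \<oplus>\<^bsub>M\<^esub> y)"
    if "x \<in> carrier M" "y \<in> carrier M" for x y
    using that by (simp add: a_rcos_sum)
  have sc: "c \<odot>\<^bsub>M\<^esub> x \<in> carrier M" if "x \<in> carrier M" for c x
    using that by simp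
  show ?thesis
  proof (rule moduleI[OF cring_ground_ring ab])
    fix b c X Y assume "X \<in> carrier ?Q" "Y \<in> carrier ?Q"
    then obtain x y where x: "x \<in> carrier M" "X = N +>\<^bsub>M\<^esub> x" and y: "y \<in> carrier M" "Y = N +>\<^bsub>M\<^esub> y"
      using coset by (metis quot_module_simps(1))
    note xy = x(1) y(1)
    show "c \<odot>\<^bsub>?Q\<^esub> X \<in> carrier ?Q"
      unfolding x sm[OF xy(1)] using in_rcosets[OF sc[OF xy(1)]] by simp
    show "(b \<oplus>\<^bsub>ring_on UNIV\<^esub> c) \<odot>\<^bsub>?Q\<^esub> X = b \<odot>\<^bsub>?Q\<^esub> X \<oplus>\<^bsub>?Q\<^esub> c \<odot>\<^bsub>?Q\<^esub> X"
      unfolding x sm[OF xy(1)] add[OF sc[OF xy(1)] sc[OF xy(1)]] by (subst smult_l_distr) (use xy in simp_all)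
    show "c \<odot>\<^bsub>?Q\<^esub> (X \<oplus>\<^bsub>?Q\<^esub> Y) = c \<odot>\<^bsub>?Q\<^esub> X \<oplus>\<^bsub>?Q\<^esub> c \<odot>\<^bsub>?Q\<^esub> Y"
      unfolding x y sm[OF xy(1)] sm[OF xy(2)] add[OF xy] add[OF sc[OF xy(1)] sc[OF xy(2)]] sm[OF M.a_closed[OF xy]]
      by (subst smult_r_distr) (use xy in simp_all)
    show "(b \<otimes>\<^bsub>ring_on UNIV\<^esub> c) \<odot>\<^bsub>?Q\<^esub> X = b \<odot>\<^bsub>?Q\<^esub> (c \<odot>\<^bsub>?Q\<^esub> X)"
      unfolding x sm[OF xy(1)] sm[OF sc[OF xy(1)]] by (subst smult_assoc1) (use xy in simp_all)
    show "\<one>\<^bsub>ring_on (UNIV :: 'k set)\<^esub> \<odot>\<^bsub>?Q\<^esub> X = X"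
      unfolding x sm[OF xy(1)] by (subst smult_one) (use xy in simp_all)
  qed
qed

section \<open>Linear maps from submodules of free modules\<close>

text \<open>A bridge between two styles of linear algebra: the source is a subspace of a type, the
  target a module record. The passages from words to chains and from cycles to homology classes,
  \<open>tens\<close> and \<open>cl\<close>, are both of this kind.\<close>

locale linear_on =
  fixes V :: "('b \<Rightarrow>\<^sub>0 'k::comm_ring_1) set" and M :: "('k, 'm) module" and f :: "('b \<Rightarrow>\<^sub>0 'k) \<Rightarrow> 'm"
  assumes sub: "fs.subspace V"
    and mod: "module (ring_on (UNIV :: 'k set)) M"
    and closed: "x \<in> V \<Longrightarrow> f x \<in> carrier M"
    and add: "x \<in> V \<Longrightarrow> y \<in> V \<Longrightarrow> f (x + y) = f x \<oplus>\<^bsub>M\<^esub> f y"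
    and smult: "x \<in> V \<Longrightarrow> f (fscale c x) = c \<odot>\<^bsub>M\<^esub> f x"
begin

sublocale M: module "ring_on (UNIV :: 'k set)" M
  by (rule mod)

lemma zero: "f 0 = \<zero>\<^bsub>M\<^esub>"
  using smult[OF fs.subspace_0[OF sub], of 0] M.smult_l_null[OF closed[OF fs.subspace_0[OF sub]]] by simp

lemma minus:
  assumes x: "x \<in> V"
  shows "f (- x) = \<ominus>\<^bsub>M\<^esub> f x"
proof -
  note mx = fs.subspace_neg[OF sub x]
  have "f (- x) \<oplus>\<^bsub>M\<^esub> f x = \<zero>\<^bsub>M\<^esub>" using add[OF mx x] zero by simp
  then show ?thesis using M.minus_equality closed x mx by simp
qed

lemma eq_iff_diff: "x \<in> V \<Longrightarrow> y \<in> V \<Longrightarrow> f x = f y \<longleftrightarrow> f (x - y) = \<zero>\<^bsub>M\<^esub>"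
proof -
  assume xy: "x \<in> V" "y \<in> V"
  have "f (x - y) = f x \<oplus>\<^bsub>M\<^esub> (\<ominus>\<^bsub>M\<^esub> f y)"
    using add[of x "- y"] minus[of y] fs.subspace_neg[OF sub, of y] xy by simp
  moreover have "f x = f y" if "f x \<oplus>\<^bsub>M\<^esub> (\<ominus>\<^bsub>M\<^esub> f y) = \<zero>\<^bsub>M\<^esub>"
    using M.minus_equality[OF that] closed xy by simp
  ultimately show "f x = f y \<longleftrightarrow> f (x - y) = \<zero>\<^bsub>M\<^esub>"
    using closed xy by (auto simp: M.r_neg)
qed

lemma finsum: "(\<And>i. i \<in> A \<Longrightarrow> g i \<in> V) \<Longrightarrow> finite A \<Longrightarrow> (\<Oplus>\<^bsub>M\<^esub>i\<in>A. f (g i)) = f (\<Sum>i\<in>A. g i)"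
proof (induction A rule: infinite_finite_induct)
  case (insert i A)
  have "sum g A \<in> V" by (rule fs.subspace_sum[OF sub]) (use insert in auto)
  then show ?case using insert by (simp add: add closed Pi_def)
qed (auto simp: zero)

lemma submodule_image:
  assumes "fs.subspace U" "U \<subseteq> V"
  shows "submodule (f ` U) (ring_on (UNIV :: 'k set)) M"
proof (rule M.submoduleI)
  show "\<zero>\<^bsub>M\<^esub> \<in> f ` U" using zero fs.subspace_0[OF assms(1)] by force
  show "\<ominus>\<^bsub>M\<^esub> y \<in> f ` U" if "y \<in> f ` U" for y
    using that assms fs.subspace_neg[OF assms(1)] by (auto simp: minus[symmetric] subset_eq)
  show "y \<oplus>\<^bsub>M\<^esub> z \<in> f ` U" if "y \<in> f ` U" "z \<in> f ` U" for y z
    using that assms fs.subspace_add[OF assms(1)] by (auto simp: add[symmetric] subset_eq)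
  show "c \<odot>\<^bsub>M\<^esub> y \<in> f ` U" if "y \<in> f ` U" for c y
    using that assms fs.subspace_scale[OF assms(1)] by (auto simp: smult[symmetric] subset_eq)
qed (use assms closed in auto)

lemma linear_on_subspace: "fs.subspace U \<Longrightarrow> U \<subseteq> V \<Longrightarrow> linear_on U M f"
  by (rule linear_on.intro) (use mod closed add smult in blast)+

lemma linear_on_restrict:
  assumes "submodule Z (ring_on (UNIV :: 'k set)) M" "\<And>x. x \<in> V \<Longrightarrow> f x \<in> Z"
  shows "linear_on V (M\<lparr>carrier := Z\<rparr>) f"
  by (rule linear_on.intro[OF sub submodule.submodule_is_module[OF assms(1) mod]]) (simp_all add: assms(2) add smult)

text \<open>Applied twice: from words to tensor powers, and from cycles to homology.\<close>

lemma linear_on_quot: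
  assumes N: "submodule N (ring_on (UNIV :: 'k set)) M"
  shows "linear_on V (quot_module M N) (\<lambda>x. N +>\<^bsub>M\<^esub> f x)"
proof -
  interpret N: abelian_subgroup N M by (rule abelian_subgroup_submodule[OF mod N])
  show ?thesis
    by (intro linear_on.intro sub module_quot_module[OF mod N])
      (auto simp: A_RCOSETS_def' closed add smult N.a_rcos_sum quot_module_smult_coset[OF mod N]
        simp del: quot_module_simps(4))
qed

lemma quot_eq_zero_iff:
  assumes N: "submodule N (ring_on (UNIV :: 'k set)) M" and "x \<in> V"
  shows "N +>\<^bsub>M\<^esub> f x = N \<longleftrightarrow> f x \<in> N"
proof -
  interpret N: abelian_subgroup N M by (rule abelian_subgroup_submodule[OF mod N])
  show ?thesis
    using N.a_rcos_self[OF closed[OF assms(2)]] M.a_coset_join2[OF closed[OF assms(2)] N.a_subgroup] by auto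
qed

lemma quot_surj:
  assumes "f ` V = carrier M"
  shows "(\<lambda>x. N +>\<^bsub>M\<^esub> f x) ` V = carrier (quot_module M N)"
  unfolding quot_module_simps A_RCOSETS_def' assms[symmetric] by auto

end

lemma free_module_simps [simp]:
  "carrier (free_module S) = free_on S" "\<zero>\<^bsub>free_module S\<^esub> = 0"
  "p \<oplus>\<^bsub>free_module S\<^esub> q = p + q" "c \<odot>\<^bsub>free_module S\<^esub> p = fscale c p"
  by (simp_all add: free_module_def free_on_def)

lemma module_free_module: "module (ring_on (UNIV :: 'k::comm_ring_1 set)) (free_module S :: ('k, 'b \<Rightarrow>\<^sub>0 'k) module)"
proof -
  note sub = subspace_free_on[of S]
  have "\<exists>q\<in>free_on S. q + p = 0" if "p \<in> free_on S" for p :: "'b \<Rightarrow>\<^sub>0 'k"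
    using fs.subspace_neg[OF sub that] by (intro bexI[of _ "- p"]) auto
  then have "abelian_group (free_module S :: ('k, 'b \<Rightarrow>\<^sub>0 'k) module)"
    by (intro abelian_groupI) (simp_all add: fs.subspace_add[OF sub] fs.subspace_0[OF sub] add.assoc add.commute)
  then show ?thesis
    by (intro moduleI cring_ground_ring)
      (simp_all add: fs.subspace_scale[OF sub] fs.scale_left_distrib fs.scale_right_distrib)
qed

lemma linear_on_free_module: "linear_on (free_on S) (free_module S) (\<lambda>p. p)"
  by (intro linear_on.intro subspace_free_on module_free_module) auto

lemma submodule_free_module_iff:
  fixes N :: "('b \<Rightarrow>\<^sub>0 'k::comm_ring_1) set"
  shows "submodule N (ring_on (UNIV :: 'k set)) (free_module S) \<longleftrightarrow> fs.subspace N \<and> N \<subseteq> free_on S"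
proof
  assume N: "submodule N (ring_on (UNIV :: 'k set)) (free_module S)"
  note E = module.submoduleE[OF module_free_module N, simplified]
  have "0 \<in> N" using E(2) E(4)[of _ 0] by (metis ex_in_conv fs.scale_zero_left)
  then show "fs.subspace N \<and> N \<subseteq> free_on S" using E by (auto intro: fs.subspaceI)
next
  assume "fs.subspace N \<and> N \<subseteq> free_on S"
  then show "submodule N (ring_on (UNIV :: 'k set)) (free_module S)"
    using linear_on.submodule_image[OF linear_on_free_module, of N] by simp
qed

text \<open>The assumption keeps the hull meaningful: a set outside the carrier lies in no
  submodule, and its hull would be an intersection over the empty family.\<close>

lemma submodule_span_free_module:
  assumes "R \<subseteq> free_on S"
  shows "submodule_span (free_module S) R = fs.span R"
  unfolding submodule_span_def submodule_free_module_iff fs.span_def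
proof (rule hull_unique)
  show "R \<subseteq> fs.subspace hull R" by (rule hull_subset)
  show "fs.subspace (fs.subspace hull R) \<and> fs.subspace hull R \<subseteq> free_on S"
    using fs.span_minimal[OF assms subspace_free_on] fs.subspace_span[of R] by (simp only: fs.span_def simp_thms)
  show "fs.subspace hull R \<subseteq> N" if "R \<subseteq> N" "fs.subspace N \<and> N \<subseteq> free_on S" for N
    using that by (intro hull_minimal) auto
qed

lemma submodule_span_least:
  "T \<subseteq> N \<Longrightarrow> submodule N (ring_on UNIV) M \<Longrightarrow> submodule_span M T \<subseteq> N"
  unfolding submodule_span_def by (rule hull_minimal)

section \<open>Homology of the bar construction in low degrees\<close>

lemma bar_d_free_lin_ext: "bar_d_free \<delta> gr = lin_ext fscale (bar_d_word \<delta> gr)"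
  by (simp add: bar_d_free_def lin_ext_def fun_eq_iff)

lemma bar_d_word_1: "bar_d_word \<delta> gr [x] = 0"
  by (simp add: bar_d_word_def)

lemma bar_d_word_2: "bar_d_word \<delta> gr [x, y] = Poly_Mapping.single [bar_sign \<delta> gr x * y] 1"
  by (simp add: bar_d_word_def)

lemma bar_d_word_3:
  "bar_d_word \<delta> gr [x, y, z] = Poly_Mapping.single [bar_sign \<delta> gr x * y, z] 1
    + Poly_Mapping.single [bar_sign \<delta> gr x, bar_sign \<delta> gr y * z] 1"
  by (simp add: bar_d_word_def numeral_2_eq_2 lessThan_Suc)

lemma words_1: "w \<in> words S 1 \<longleftrightarrow> (\<exists>x\<in>S. w = [x])"
  by (cases w) (auto simp: words_def)

lemma words_2: "w \<in> words S 2 \<longleftrightarrow> (\<exists>x\<in>S. \<exists>y\<in>S. w = [x, y])"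
  by (auto simp: words_def numeral_2_eq_2 length_Suc_conv)

lemma words_3: "w \<in> words S 3 \<longleftrightarrow> (\<exists>x\<in>S. \<exists>y\<in>S. \<exists>z\<in>S. w = [x, y, z])"
  by (auto simp: words_def numeral_3_eq_3 length_Suc_conv)

text \<open>Below, \<open>'a\<close> is the type of the ground ring and \<open>'b\<close> that of the algebra.\<close>

context connected_graded_algebra
begin

abbreviation "I \<equiv> aug_ideal \<delta> gr"

abbreviation F :: "nat \<Rightarrow> ('b list \<Rightarrow>\<^sub>0 'a) set" where
  "F n \<equiv> free_on (words I n)"

abbreviation N :: "nat \<Rightarrow> ('b list \<Rightarrow>\<^sub>0 'a) set" where
  "N n \<equiv> tensor_null scale I n"

abbreviation d :: "('b list \<Rightarrow>\<^sub>0 'a) \<Rightarrow> ('b list \<Rightarrow>\<^sub>0 'a)" where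
  "d \<equiv> bar_d_free \<delta> gr"

sublocale d: module_hom fscale fscale d
  unfolding bar_d_free_lin_ext by (rule fs.module_hom_lin_ext)

lemma d_single: "d (Poly_Mapping.single w c) = fscale c (bar_d_word \<delta> gr w)"
  by (simp add: bar_d_free_lin_ext)

lemma gr_neg: "x \<in> gr g \<Longrightarrow> \<delta> g < 0 \<Longrightarrow> x = 0"
  using neg_trivial[of "\<delta> g"] span_base[of x "\<Union>h\<in>{h. \<delta> h = \<delta> g}. gr h"]
  by (auto simp: int_gr_def)

lemma proj_neg: "n < 0 \<Longrightarrow> proj \<delta> gr n x = 0"
  by (induction x rule: gr_induct) (auto simp: proj_gr proj.add dest: gr_neg)

lemma proj_zero_part: "\<exists>c. proj \<delta> gr 0 x = scale c 1"
proof -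
  have "proj \<delta> gr 0 x \<in> int_gr scale \<delta> gr 0"
  proof (induction x rule: gr_induct)
    case (gr g x)
    then show ?case by (auto simp: proj_gr int_gr_def span_zero intro!: span_base)
  next
    case (add x y)
    then show ?case by (simp add: proj.add int_gr_def span_add)
  qed
  then show ?thesis by (auto simp: zero_part)
qed

text \<open>A product of components lands in degree 0 only if one degree is negative or both are 0.
  Components of negative degree vanish by connectedness, those of degree 0 vanish in
  \<open>I\<close>.\<close>

lemma mult_aug_ideal:
  assumes "x \<in> I" "y \<in> I"
  shows "x * y \<in> I"
proof -
  have "proj \<delta> gr 0 (x * y) \<in> {0}"
  proof (rule proj_mult_in[OF subspace_single_0])
    fix k m :: int assume "k + m = 0"
    then consider "k < 0" | "m < 0" | "k = 0" by linarith
    then show "proj \<delta> gr k x * proj \<delta> gr m y \<in> {0}"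
      using assms by cases (auto simp: proj_neg aug_ideal_proj)
  qed
  then show ?thesis by (simp add: aug_ideal_proj)
qed

lemma add_aug_ideal: "x \<in> I \<Longrightarrow> y \<in> I \<Longrightarrow> x + y \<in> I"
  by (rule subspace_add[OF subspace_aug_ideal])

lemma scale_aug_ideal: "x \<in> I \<Longrightarrow> scale c x \<in> I"
  by (rule subspace_scale[OF subspace_aug_ideal])

section \<open>Tensor relations and the differential on words\<close>

lemma tensor_relations_le:
  assumes "\<And>u x y v. x \<in> I \<Longrightarrow> y \<in> I \<Longrightarrow> set u \<subseteq> I \<Longrightarrow> set v \<subseteq> I \<Longrightarrow> length u + 1 + length v = n \<Longrightarrow>
      Poly_Mapping.single (u @ [x + y] @ v) 1 - Poly_Mapping.single (u @ [x] @ v) 1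
        - Poly_Mapping.single (u @ [y] @ v) 1 \<in> V"
    and "\<And>c u x v. x \<in> I \<Longrightarrow> set u \<subseteq> I \<Longrightarrow> set v \<subseteq> I \<Longrightarrow> length u + 1 + length v = n \<Longrightarrow>
      Poly_Mapping.single (u @ [scale c x] @ v) 1 - Poly_Mapping.single (u @ [x] @ v) c \<in> V"
  shows "tensor_relations scale I n \<subseteq> V"
  unfolding tensor_relations_def using assms by blast

lemma tensor_relations_subset: "tensor_relations scale I n \<subseteq> F n"
proof -
  have w: "Poly_Mapping.single (u @ [x] @ v) c \<in> F n"
    if "x \<in> I" "set u \<subseteq> I" "set v \<subseteq> I" "length u + 1 + length v = n" for u x v c
    using that by (intro single_in_free_on) (auto simp: words_def)
  show ?thesis
    by (rule tensor_relations_le)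
      (intro fs.subspace_diff[OF subspace_free_on] w add_aug_ideal scale_aug_ideal; assumption)+
qed

lemma tensor_null_span: "N n = fs.span (tensor_relations scale I n)"
  unfolding tensor_null_def by (rule submodule_span_free_module[OF tensor_relations_subset])

lemma subspace_null: "fs.subspace (N n)"
  by (simp add: tensor_null_span)

lemma null_subset: "N n \<subseteq> F n"
  unfolding tensor_null_span by (rule fs.span_minimal[OF tensor_relations_subset subspace_free_on])

lemma null_add:
  assumes "x \<in> I" "y \<in> I" "set u \<subseteq> I" "set v \<subseteq> I" "length u + 1 + length v = n"
  shows "Poly_Mapping.single (u @ [x + y] @ v) 1 - Poly_Mapping.single (u @ [x] @ v) 1
    - Poly_Mapping.single (u @ [y] @ v) 1 \<in> N n"
  unfolding tensor_null_span tensor_relations_def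
  by (rule fs.span_base, rule UnI1) (use assms in blast)

lemma null_scale:
  assumes "x \<in> I" "set u \<subseteq> I" "set v \<subseteq> I" "length u + 1 + length v = n"
  shows "Poly_Mapping.single (u @ [scale c x] @ v) 1 - Poly_Mapping.single (u @ [x] @ v) c \<in> N n"
  unfolding tensor_null_span tensor_relations_def
  by (rule fs.span_base, rule UnI2) (use assms in blast)

lemma null_le:
  assumes "fs.subspace V"
    and "\<And>u x y v. x \<in> I \<Longrightarrow> y \<in> I \<Longrightarrow> set u \<subseteq> I \<Longrightarrow> set v \<subseteq> I \<Longrightarrow> length u + 1 + length v = n \<Longrightarrow>
      Poly_Mapping.single (u @ [x + y] @ v) 1 - Poly_Mapping.single (u @ [x] @ v) 1
        - Poly_Mapping.single (u @ [y] @ v) 1 \<in> V"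
    and "\<And>c u x v. x \<in> I \<Longrightarrow> set u \<subseteq> I \<Longrightarrow> set v \<subseteq> I \<Longrightarrow> length u + 1 + length v = n \<Longrightarrow>
      Poly_Mapping.single (u @ [scale c x] @ v) 1 - Poly_Mapping.single (u @ [x] @ v) c \<in> V"
  shows "N n \<subseteq> V"
  unfolding tensor_null_span
  by (rule fs.span_minimal[OF tensor_relations_le assms(1)]) (rule assms; assumption)+

lemma null_1_le:
  assumes "fs.subspace V"
    and "\<And>x y. x \<in> I \<Longrightarrow> y \<in> I \<Longrightarrow>
      Poly_Mapping.single [x + y] 1 - Poly_Mapping.single [x] 1 - Poly_Mapping.single [y] 1 \<in> V"
    and "\<And>c x. x \<in> I \<Longrightarrow> Poly_Mapping.single [scale c x] 1 - Poly_Mapping.single [x] c \<in> V"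
  shows "N 1 \<subseteq> V"
  using assms by (intro null_le) auto

lemma length_split_2:
  "length u + 1 + length v = 2 \<longleftrightarrow> (\<exists>z. u = [] \<and> v = [z]) \<or> (\<exists>z. u = [z] \<and> v = [])"
  by (cases u; cases v) auto

lemma null_2_le:
  assumes V: "fs.subspace V"
    and "\<And>x y z. x \<in> I \<Longrightarrow> y \<in> I \<Longrightarrow> z \<in> I \<Longrightarrow>
      Poly_Mapping.single [x + y, z] 1 - Poly_Mapping.single [x, z] 1 - Poly_Mapping.single [y, z] 1 \<in> V"
    and "\<And>x y z. x \<in> I \<Longrightarrow> y \<in> I \<Longrightarrow> z \<in> I \<Longrightarrow>
      Poly_Mapping.single [z, x + y] 1 - Poly_Mapping.single [z, x] 1 - Poly_Mapping.single [z, y] 1 \<in> V"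
    and "\<And>c x z. x \<in> I \<Longrightarrow> z \<in> I \<Longrightarrow> Poly_Mapping.single [scale c x, z] 1 - Poly_Mapping.single [x, z] c \<in> V"
    and "\<And>c x z. x \<in> I \<Longrightarrow> z \<in> I \<Longrightarrow> Poly_Mapping.single [z, scale c x] 1 - Poly_Mapping.single [z, x] c \<in> V"
  shows "N 2 \<subseteq> V"
  by (rule null_le[OF V]; simp only: length_split_2; elim disjE exE conjE; simp add: assms)

lemma length_split_3:
  "length u + 1 + length v = 3 \<longleftrightarrow> (\<exists>y z. u = [] \<and> v = [y, z]) \<or> (\<exists>y z. u = [y] \<and> v = [z]) \<or> (\<exists>y z. u = [y, z] \<and> v = [])"
  by (cases u; cases "tl u"; cases v; cases "tl v") auto

lemma d_null_2: "d ` N 2 \<subseteq> N 1"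
proof -
  have "N 2 \<subseteq> {p. d p \<in> N 1}"
  proof (rule null_2_le[OF fs.subspace_hom_vimage[OF d.module_hom_axioms subspace_null]])
    fix x y z assume "x \<in> I" "y \<in> I" "z \<in> I"
    then show "Poly_Mapping.single [x + y, z] 1 - Poly_Mapping.single [x, z] 1 - Poly_Mapping.single [y, z] 1 \<in> {p. d p \<in> N 1}"
      "Poly_Mapping.single [z, x + y] 1 - Poly_Mapping.single [z, x] 1 - Poly_Mapping.single [z, y] 1 \<in> {p. d p \<in> N 1}"
      using null_add[of "bar x * z" "bar y * z" "[]" "[]" 1] null_add[of "bar z * x" "bar z * y" "[]" "[]" 1]
      by (simp_all add: d.diff d_single bar_d_word_2 bar.add distrib_left distrib_right mult_aug_ideal)
  next
    fix c x z assume "x \<in> I" "z \<in> I"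
    then show "Poly_Mapping.single [scale c x, z] 1 - Poly_Mapping.single [x, z] c \<in> {p. d p \<in> N 1}"
      "Poly_Mapping.single [z, scale c x] 1 - Poly_Mapping.single [z, x] c \<in> {p. d p \<in> N 1}"
      using null_scale[of "bar x * z" "[]" "[]" 1 c] null_scale[of "bar z * x" "[]" "[]" 1 c]
      by (simp_all add: d.diff d_single bar_d_word_2 bar.scale scale_mult_left scale_mult_right mult_aug_ideal)
  qed
  then show ?thesis by blast
qed

lemma d_free_2: "d ` F 2 \<subseteq> F 1"
proof -
  have "F 2 \<subseteq> {p. d p \<in> F 1}"
    by (rule free_on_le[OF fs.subspace_hom_vimage[OF d.module_hom_axioms subspace_free_on]])
      (auto simp: words_2 words_1[simplified] d_single bar_d_word_2 intro!: single_in_free_on mult_aug_ideal)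
  then show ?thesis by blast
qed

lemma d_free_3: "d ` F 3 \<subseteq> F 2"
proof -
  have "F 3 \<subseteq> {p. d p \<in> F 2}"
    by (rule free_on_le[OF fs.subspace_hom_vimage[OF d.module_hom_axioms subspace_free_on]])
      (auto simp: words_2 words_3 d_single bar_d_word_3
        intro!: fs.subspace_add[OF subspace_free_on] single_in_free_on mult_aug_ideal)
  then show ?thesis by blast
qed

lemma d_free_1: "p \<in> F 1 \<Longrightarrow> d p = 0"
proof -
  have "F 1 \<subseteq> {p. d p \<in> {0}}"
    by (rule free_on_le[OF fs.subspace_hom_vimage[OF d.module_hom_axioms fs.subspace_single_0]])
      (auto simp: words_1[simplified] d_single bar_d_word_1)
  then show "p \<in> F 1 \<Longrightarrow> d p = 0" by auto
qed

text \<open>The differential of a three-letter word has two terms, and altering one letter changes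
  each of them by a tensor relation of its own; the two relations are added here.\<close>

lemma null_add_pair:
  assumes "p1 - q1 - r1 \<in> N n" "p2 - q2 - r2 \<in> N n"
  shows "(p1 + p2) - (q1 + q2) - (r1 + r2) \<in> N n"
  using fs.subspace_add[OF subspace_null assms] by (simp add: algebra_simps)

lemma null_scale_pair:
  assumes "p1 - q1 \<in> N n" "p2 - q2 \<in> N n"
  shows "(p1 + p2) - (q1 + q2) \<in> N n"
  using fs.subspace_add[OF subspace_null assms] by (simp add: algebra_simps)

lemma d_null_3: "d ` N 3 \<subseteq> N 2"
proof -
  have "N 3 \<subseteq> {p. d p \<in> N 2}"
  proof (rule null_le[OF fs.subspace_hom_vimage[OF d.module_hom_axioms subspace_null]])
    fix u x y v assume I: "x \<in> I" "y \<in> I" "set u \<subseteq> I" "set v \<subseteq> I" and "length u + 1 + length v = 3"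
    then consider z t where "u = []" "v = [z, t]" | z t where "u = [z]" "v = [t]" | z t where "u = [z, t]" "v = []"
      unfolding length_split_3 by blast
    then have "d (Poly_Mapping.single (u @ [x + y] @ v) 1) - d (Poly_Mapping.single (u @ [x] @ v) 1)
        - d (Poly_Mapping.single (u @ [y] @ v) 1) \<in> N 2"
    proof cases
      case (1 z t)
      with I null_add[of "bar x * z" "bar y * z" "[]" "[t]" 2] null_add[of "bar x" "bar y" "[]" "[bar z * t]" 2]
      show ?thesis
        by (simp add: d_single bar_d_word_3 bar.add distrib_left distrib_right mult_aug_ideal null_add_pair)
    next
      case (2 z t)
      with I null_add[of "bar z * x" "bar z * y" "[]" "[t]" 2] null_add[of "bar x * t" "bar y * t" "[bar z]" "[]" 2]
      show ?thesis
        by (simp add: d_single bar_d_word_3 bar.add distrib_left distrib_right mult_aug_ideal null_add_pair)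
    next
      case (3 z t)
      with I null_add[of "x" "y" "[bar z * t]" "[]" 2] null_add[of "bar t * x" "bar t * y" "[bar z]" "[]" 2]
      show ?thesis
        by (simp add: d_single bar_d_word_3 bar.add distrib_left distrib_right mult_aug_ideal null_add_pair)
    qed
    then show "Poly_Mapping.single (u @ [x + y] @ v) 1 - Poly_Mapping.single (u @ [x] @ v) 1
        - Poly_Mapping.single (u @ [y] @ v) 1 \<in> {p. d p \<in> N 2}"
      by (simp add: d.diff)
  next
    fix c u x v assume I: "x \<in> I" "set u \<subseteq> I" "set v \<subseteq> I" and "length u + 1 + length v = 3"
    then consider z t where "u = []" "v = [z, t]" | z t where "u = [z]" "v = [t]" | z t where "u = [z, t]" "v = []"
      unfolding length_split_3 by blast
    then have "d (Poly_Mapping.single (u @ [scale c x] @ v) 1) - d (Poly_Mapping.single (u @ [x] @ v) c) \<in> N 2"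
    proof cases
      case (1 z t)
      with I null_scale[of "bar x * z" "[]" "[t]" 2 c] null_scale[of "bar x" "[]" "[bar z * t]" 2 c]
      show ?thesis
        by (simp add: d_single bar_d_word_3 bar.scale scale_mult_left fs.scale_right_distrib mult_aug_ideal null_scale_pair)
    next
      case (2 z t)
      with I null_scale[of "bar z * x" "[]" "[t]" 2 c] null_scale[of "bar x * t" "[bar z]" "[]" 2 c]
      show ?thesis
        by (simp add: d_single bar_d_word_3 bar.scale scale_mult_left scale_mult_right fs.scale_right_distrib mult_aug_ideal null_scale_pair)
    next
      case (3 z t)
      with I null_scale[of "x" "[bar z * t]" "[]" 2 c] null_scale[of "bar t * x" "[bar z]" "[]" 2 c]
      show ?thesis
        by (simp add: d_single bar_d_word_3 bar.scale scale_mult_right fs.scale_right_distrib mult_aug_ideal null_scale_pair)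
    qed
    then show "Poly_Mapping.single (u @ [scale c x] @ v) 1 - Poly_Mapping.single (u @ [x] @ v) c \<in> {p. d p \<in> N 2}"
      by (simp add: d.diff)
  qed
  then show ?thesis by blast
qed

lemma d_d_3: "p \<in> F 3 \<Longrightarrow> d (d p) \<in> N 1"
proof -
  have "F 3 \<subseteq> {p. d (d p) \<in> N 1}"
  proof (rule free_on_le)
    show "fs.subspace {p. d (d p) \<in> N 1}"
      using fs.subspace_hom_vimage[OF module_hom_compose[OF d.module_hom_axioms d.module_hom_axioms] subspace_null]
      by simp
    fix w assume "w \<in> words I 3"
    then obtain x y z where w: "w = [x, y, z]" and I: "x \<in> I" "y \<in> I" "z \<in> I" by (auto simp: words_3)
    have 0: "x * (bar y * z) \<in> I" using I by (simp add: mult_aug_ideal)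
    \<comment> \<open>In the free module [t] + [-t] is not zero, so d d vanishes only modulo tensor
      relations. For t = \<open>x * (bar y * z)\<close>, additivity at t + (-t) and homogeneity at
      the scalar 0 combine to [t] + [-t].\<close>
    have "Poly_Mapping.single [x * (bar y * z) + scale (- 1) (x * (bar y * z))] 1 - Poly_Mapping.single [x * (bar y * z)] 1
        - Poly_Mapping.single [scale (- 1) (x * (bar y * z))] 1 \<in> N 1"
      and "Poly_Mapping.single [scale 0 (x * (bar y * z))] 1 - Poly_Mapping.single [x * (bar y * z)] 0 \<in> N 1"
      using null_add[OF 0 scale_aug_ideal[OF 0, of "- 1"], of "[]" "[]" 1] null_scale[OF 0, of "[]" "[]" 1 0] by simp_all
    from fs.subspace_diff[OF subspace_null this(2,1)] show "Poly_Mapping.single w 1 \<in> {p. d (d p) \<in> N 1}"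
      by (simp add: w d_single bar_d_word_3 d.add bar_d_word_2 bar_mult mult.assoc add.commute)
  qed
  then show "p \<in> F 3 \<Longrightarrow> d (d p) \<in> N 1" by auto
qed

section \<open>Chains, cycles and homology classes through representatives\<close>

abbreviation tens :: "nat \<Rightarrow> ('b list \<Rightarrow>\<^sub>0 'a) \<Rightarrow> ('b list \<Rightarrow>\<^sub>0 'a) set" where
  "tens n p \<equiv> N n +>\<^bsub>free_module (words I n) :: ('a, 'b list \<Rightarrow>\<^sub>0 'a) module\<^esub> p"

abbreviation "B \<equiv> bar_module scale \<delta> gr"
abbreviation "H \<equiv> bar_homology scale \<delta> gr"

abbreviation cycles :: "nat \<Rightarrow> ('b list \<Rightarrow>\<^sub>0 'a) set" where
  "cycles n \<equiv> {p \<in> F n. d p \<in> N (n - 1)}"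

abbreviation cl :: "nat \<Rightarrow> ('b list \<Rightarrow>\<^sub>0 'a) \<Rightarrow> ('b list \<Rightarrow>\<^sub>0 'a) set set" where
  "cl n p \<equiv> bar_class scale \<delta> gr n (tens n p)"

lemma submodule_null: "submodule (N n) (ring_on (UNIV :: 'a set)) (free_module (words I n))"
  unfolding submodule_free_module_iff using subspace_null null_subset by blast

lemma linear_on_tens: "linear_on (F n) (B n) (tens n)"
  unfolding bar_module_def tensor_power_def
  by (rule linear_on.linear_on_quot[OF linear_on_free_module submodule_null])

lemma tens_eq_zero_iff: "p \<in> F n \<Longrightarrow> tens n p = N n \<longleftrightarrow> p \<in> N n"
  by (rule linear_on.quot_eq_zero_iff[OF linear_on_free_module submodule_null])

lemma zero_bar_module: "\<zero>\<^bsub>B n\<^esub> = N n"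
  by (simp add: bar_module_def tensor_power_def)

lemma tens_surj: "tens n ` F n = carrier (B n)"
  unfolding bar_module_def tensor_power_def
  by (rule linear_on.quot_surj[OF linear_on_free_module]) simp

lemma tens_eq_iff: "p \<in> F n \<Longrightarrow> q \<in> F n \<Longrightarrow> tens n p = tens n q \<longleftrightarrow> p - q \<in> N n"
  using linear_on.eq_iff_diff[OF linear_on_tens] tens_eq_zero_iff[of "p - q" n]
    fs.subspace_diff[OF subspace_free_on, of p _ q] by (simp add: zero_bar_module)

text \<open>\<open>bar_d\<close> is a union over all representatives. As \<open>d\<close> maps
  tensor relations to tensor relations, each of them yields the same coset, so one suffices.\<close>

lemma bar_d_tens:
  assumes "d ` F n \<subseteq> F (n - 1)" "d ` N n \<subseteq> N (n - 1)" "p \<in> F n"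
  shows "bar_d scale \<delta> gr n (tens n p) = tens (n - 1) (d p)"
proof -
  have mem: "q \<in> tens n p \<longleftrightarrow> q - p \<in> N n" for q
    unfolding a_r_coset_def' by (auto intro: bexI[of _ "q - p"])
  have "tens (n - 1) (d q) = tens (n - 1) (d p)" if "q \<in> tens n p" for q
  proof -
    have "q - p \<in> N n" using that mem by blast
    then have "q \<in> F n"
      using fs.subspace_add[OF subspace_free_on _ assms(3), of "q - p"] null_subset[of n] by auto
    moreover have "d q - d p \<in> N (n - 1)"
      using \<open>q - p \<in> N n\<close> assms(2) by (auto simp: d.diff[symmetric])
    ultimately show ?thesis using assms(1,3) by (subst tens_eq_iff) auto
  qed
  moreover have "p \<in> tens n p" by (simp add: mem fs.subspace_0[OF subspace_null])
  ultimately show ?thesis unfolding bar_d_def by blast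
qed

text \<open>These are the properties of \<open>d\<close> that homology in degree n requires. Only n
  = 1 and n = 2 occur later, so they are assumed here and verified for those two degrees in
  \<open>low_degree_conditions\<close>.\<close>

context
  fixes n :: nat
  assumes dF: "d ` F n \<subseteq> F (n - 1)" and dN: "d ` N n \<subseteq> N (n - 1)"
    and dF_Suc: "d ` F (n + 1) \<subseteq> F n" and dN_Suc: "d ` N (n + 1) \<subseteq> N n"
    and dd: "\<And>q. q \<in> F (n + 1) \<Longrightarrow> d (d q) \<in> N (n - 1)"
begin

lemma tens_cycles_iff: "p \<in> F n \<Longrightarrow> tens n p \<in> bar_cycles scale \<delta> gr n \<longleftrightarrow> d p \<in> N (n - 1)"
  using linear_on.closed[OF linear_on_tens] dF
  by (auto simp: bar_cycles_def bar_d_tens[OF dF dN] zero_bar_module tens_eq_zero_iff image_subset_iff)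

lemma bar_cycles_image: "bar_cycles scale \<delta> gr n = tens n ` cycles n"
proof -
  have "bar_cycles scale \<delta> gr n \<subseteq> tens n ` F n"
    by (auto simp: bar_cycles_def tens_surj)
  then show ?thesis using tens_cycles_iff by blast
qed

lemma subspace_cycles: "fs.subspace (cycles n)"
  using fs.subspace_inter[OF subspace_free_on fs.subspace_hom_vimage[OF d.module_hom_axioms subspace_null]]
  by (simp add: Collect_conj_eq)

lemma bar_boundaries_image: "bar_boundaries scale \<delta> gr n = tens n ` d ` F (n + 1)"
proof -
  have "bar_d scale \<delta> gr (n + 1) (tens (n + 1) q) = tens n (d q)" if "q \<in> F (n + 1)" for q
    using bar_d_tens[of "n + 1" q] dF_Suc dN_Suc that by simp
  then show ?thesis
    unfolding bar_boundaries_def tens_surj[symmetric] by (auto simp: image_image)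
qed

lemma boundaries_subset: "d ` F (n + 1) \<subseteq> cycles n"
  using dF_Suc dd by blast

lemma linear_on_tens_cycles:
  "linear_on (cycles n) ((B n)\<lparr>carrier := bar_cycles scale \<delta> gr n\<rparr>) (tens n)"
proof -
  have sub: "cycles n \<subseteq> F n" by blast
  show ?thesis
    unfolding bar_cycles_image
    by (rule linear_on.linear_on_restrict[OF linear_on.linear_on_subspace[OF linear_on_tens subspace_cycles sub]])
      (rule linear_on.submodule_image[OF linear_on_tens subspace_cycles sub], blast)
qed

lemma submodule_boundaries:
  "submodule (bar_boundaries scale \<delta> gr n) (ring_on (UNIV :: 'a set)) ((B n)\<lparr>carrier := bar_cycles scale \<delta> gr n\<rparr>)"
  unfolding bar_boundaries_image
  by (rule linear_on.submodule_image[OF linear_on_tens_cycles d.subspace_image[OF subspace_free_on] boundaries_subset])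

lemma linear_on_cl: "linear_on (cycles n) (H n) (cl n)"
  unfolding bar_homology_def bar_class_def
  by (rule linear_on.linear_on_quot[OF linear_on_tens_cycles submodule_boundaries])

text \<open>Boundaries are the cosets of elements \<open>d q\<close>, and equality of cosets is
  congruence modulo tensor relations.\<close>

lemma cl_eq_zero_iff:
  assumes "p \<in> cycles n"
  shows "cl n p = \<zero>\<^bsub>H n\<^esub> \<longleftrightarrow> (\<exists>q\<in>F (n + 1). p - d q \<in> N n)"
proof -
  have "cl n p = \<zero>\<^bsub>H n\<^esub> \<longleftrightarrow> tens n p \<in> bar_boundaries scale \<delta> gr n"
    unfolding bar_homology_def bar_class_def quot_module_simps
    by (rule linear_on.quot_eq_zero_iff[OF linear_on_tens_cycles submodule_boundaries assms])
  also have "\<dots> \<longleftrightarrow> (\<exists>q\<in>F (n + 1). tens n p = tens n (d q))"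
    by (auto simp: bar_boundaries_image)
  also have "\<dots> \<longleftrightarrow> (\<exists>q\<in>F (n + 1). p - d q \<in> N n)"
    using assms dF_Suc tens_eq_iff by (intro bex_cong refl) (auto simp: image_subset_iff)
  finally show ?thesis .
qed

end

text \<open>The sums and differences stay unevaluated so as to match the assumptions above at n = 1
  and n = 2. On representatives of degree 1 the differential is zero, so degree 0 contributes only
  the fact that its subspaces contain 0.\<close>

lemma low_degree_conditions:
  "d ` F 1 \<subseteq> F (1 - 1)" "d ` N 1 \<subseteq> N (1 - 1)" "d ` F (1 + 1) \<subseteq> F 1" "d ` N (1 + 1) \<subseteq> N 1"
  "q \<in> F (1 + 1) \<Longrightarrow> d (d q) \<in> N (1 - 1)"
  "d ` F 2 \<subseteq> F (2 - 1)" "d ` N 2 \<subseteq> N (2 - 1)" "d ` F (2 + 1) \<subseteq> F 2" "d ` N (2 + 1) \<subseteq> N 2"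
  "q \<in> F (2 + 1) \<Longrightarrow> d (d q) \<in> N (2 - 1)"
proof -
  note one = d_free_1 fs.subspace_0[OF subspace_null] fs.subspace_0[OF subspace_free_on]
  show "d ` F 1 \<subseteq> F (1 - 1)" using one by auto
  show "d ` N 1 \<subseteq> N (1 - 1)" using one null_subset[of 1] by auto
  have eq: "1 + 1 = (2 :: nat)" "2 - 1 = (1 :: nat)" "2 + 1 = (3 :: nat)" by simp_all
  show "d ` F (1 + 1) \<subseteq> F 1" "d ` F 2 \<subseteq> F (2 - 1)" unfolding eq by (rule d_free_2)+
  show "d ` N (1 + 1) \<subseteq> N 1" "d ` N 2 \<subseteq> N (2 - 1)" unfolding eq by (rule d_null_2)+
  show "q \<in> F (1 + 1) \<Longrightarrow> d (d q) \<in> N (1 - 1)"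
    unfolding eq using d_free_2 one by (auto simp: image_subset_iff)
  show "d ` F (2 + 1) \<subseteq> F 2" unfolding eq by (rule d_free_3)
  show "d ` N (2 + 1) \<subseteq> N 2" unfolding eq by (rule d_null_3)
  show "q \<in> F (2 + 1) \<Longrightarrow> d (d q) \<in> N (2 - 1)" unfolding eq by (rule d_d_3)
qed

lemma H1_linear: "linear_on (cycles 1) (H 1) (cl 1)"
  and H2_linear: "linear_on (cycles 2) (H 2) (cl 2)"
  by (rule linear_on_cl; rule low_degree_conditions; assumption)+

lemma H1_zero_iff: "p \<in> cycles 1 \<Longrightarrow> cl 1 p = \<zero>\<^bsub>H 1\<^esub> \<longleftrightarrow> (\<exists>q\<in>F (1 + 1). p - d q \<in> N 1)"
  and H2_zero_iff: "p \<in> cycles 2 \<Longrightarrow> cl 2 p = \<zero>\<^bsub>H 2\<^esub> \<longleftrightarrow> (\<exists>q\<in>F (2 + 1). p - d q \<in> N 2)"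
  by (rule cl_eq_zero_iff; (rule low_degree_conditions)?; assumption)+

lemma tens_2_cycles_iff: "p \<in> F 2 \<Longrightarrow> tens 2 p \<in> bar_cycles scale \<delta> gr 2 \<longleftrightarrow> d p \<in> N (2 - 1)"
  by (rule tens_cycles_iff; (rule low_degree_conditions)?; assumption)

lemma cycles_1: "cycles 1 = F 1"
  using d_free_1 fs.subspace_0[OF subspace_null] by auto

lemma bar_tensor_tens: "length w = n \<Longrightarrow> bar_tensor scale \<delta> gr w = tens n (Poly_Mapping.single w 1)"
  by (auto simp: bar_tensor_def pure_tensor_def)

section \<open>Low-degree homology as equations in A\<close>

definition mul :: "('b list \<Rightarrow>\<^sub>0 'a) \<Rightarrow> 'b" where
  "mul = lin_ext scale (\<lambda>w. bar (w ! 0) * w ! 1)"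

text \<open>Induces the identification of degree one chains with \<open>I\<close>; under it the
  differential from degree 2 becomes \<open>mul\<close>, see \<open>letter_d\<close>.\<close>

definition letter :: "('b list \<Rightarrow>\<^sub>0 'a) \<Rightarrow> 'b" where
  "letter = lin_ext scale hd"

sublocale mul: module_hom fscale scale mul
  unfolding mul_def by (rule module_hom_lin_ext)

sublocale letter: module_hom fscale scale letter
  unfolding letter_def by (rule module_hom_lin_ext)

lemma mul_single [simp]: "mul (Poly_Mapping.single [x, y] c) = scale c (bar x * y)"
  by (simp add: mul_def)

lemma letter_single [simp]: "letter (Poly_Mapping.single [x] c) = scale c x"
  by (simp add: letter_def)

lemma letter_d: "p \<in> F 2 \<Longrightarrow> letter (d p) = mul p"
proof (rule hom_eq_on_free[where f = "\<lambda>p. letter (d p)" and S = "words I 2" and sc = scale])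
  show "module_hom fscale scale (\<lambda>p. letter (d p))"
    using module_hom_compose[OF d.module_hom_axioms letter.module_hom_axioms] by (simp add: o_def)
  show "module_hom fscale scale mul" by (rule mul.module_hom_axioms)
  show "letter (d (Poly_Mapping.single w 1)) = mul (Poly_Mapping.single w 1)" if "w \<in> words I 2" for w
    using that by (auto simp: words_2 d_single bar_d_word_2)
qed

lemma letter_aug_ideal: "p \<in> F 1 \<Longrightarrow> letter p \<in> I"
  unfolding letter_def by (rule lin_ext_in[OF subspace_aug_ideal]) (auto simp: words_1[simplified])

lemma letter_null: "p \<in> N 1 \<Longrightarrow> letter p = 0"
proof -
  have "N 1 \<subseteq> {p. letter p \<in> {0}}"
    by (rule null_1_le[OF subspace_hom_vimage[OF letter.module_hom_axioms subspace_single_0]])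
      (simp_all add: letter.diff)
  then show "p \<in> N 1 \<Longrightarrow> letter p = 0" by auto
qed

lemma single_null_1: "x \<in> I \<Longrightarrow> y \<in> I \<Longrightarrow>
    Poly_Mapping.single [x + y] 1 - (Poly_Mapping.single [x] 1 + Poly_Mapping.single [y] 1) \<in> N 1"
  using null_add[of x y "[]" "[]" 1] by (simp add: algebra_simps)

text \<open>Tensor relations merge a combination of one-letter words into a single word. Hence
  \<open>letter\<close> is injective modulo tensor relations, which is
  \<open>null_1_iff\<close>.\<close>

lemma minus_letter_null: "p \<in> F 1 \<Longrightarrow> p - Poly_Mapping.single [letter p] 1 \<in> N 1"
proof -
  let ?V = "{p \<in> F 1. p - Poly_Mapping.single [letter p] 1 \<in> N 1}"
  note 0 = subspace_0[OF subspace_aug_ideal]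
  have "fs.subspace ?V"
  proof (rule fs.subspaceI)
    \<comment> \<open>The word [0] is a nonzero element of the free module; homogeneity at the
      scalar 0 makes it null.\<close>
    have "Poly_Mapping.single [scale 0 0] 1 - Poly_Mapping.single [0] 0 \<in> N 1"
      using null_scale[OF 0, of "[]" "[]" 1 0] by simp
    then have "- Poly_Mapping.single [0] 1 \<in> N 1"
      using fs.subspace_neg[OF subspace_null] by simp
    then show "0 \<in> ?V" using fs.subspace_0[OF subspace_free_on] by simp
  next
    fix p q assume "p \<in> ?V" "q \<in> ?V"
    then have F: "p \<in> F 1" "q \<in> F 1" and N: "p - Poly_Mapping.single [letter p] 1 \<in> N 1"
      "q - Poly_Mapping.single [letter q] 1 \<in> N 1" by blast+
    from fs.subspace_diff[OF subspace_null fs.subspace_add[OF subspace_null N]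
        single_null_1[OF letter_aug_ideal[OF F(1)] letter_aug_ideal[OF F(2)]]]
    have "p + q - Poly_Mapping.single [letter (p + q)] 1 \<in> N 1"
      by (simp add: letter.add)
    then show "p + q \<in> ?V"
      using fs.subspace_add[OF subspace_free_on F] by blast
  next
    fix c p assume "p \<in> ?V"
    then have F: "p \<in> F 1" and N: "p - Poly_Mapping.single [letter p] 1 \<in> N 1" by blast+
    have "Poly_Mapping.single [scale c (letter p)] 1 - Poly_Mapping.single [letter p] c \<in> N 1"
      using null_scale[OF letter_aug_ideal[OF F], of "[]" "[]" 1 c] by simp
    from fs.subspace_diff[OF subspace_null fs.subspace_scale[OF subspace_null N, of c] this]
    have "fscale c p - Poly_Mapping.single [letter (fscale c p)] 1 \<in> N 1"
      by (simp add: letter.scale fs.scale_right_diff_distrib)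
    then show "fscale c p \<in> ?V"
      using fs.subspace_scale[OF subspace_free_on F] by blast
  qed
  then have "F 1 \<subseteq> ?V"
    by (rule free_on_le) (auto simp: words_1[simplified] fs.subspace_0[OF subspace_null] intro: single_in_free_on)
  then show "p \<in> F 1 \<Longrightarrow> p - Poly_Mapping.single [letter p] 1 \<in> N 1" by auto
qed

lemma null_1_iff: "p \<in> F 1 \<Longrightarrow> p \<in> N 1 \<longleftrightarrow> letter p = 0"
proof -
  assume p: "p \<in> F 1"
  have "p - 0 \<in> N 1" if "letter p = 0"
  proof -
    have "0 - Poly_Mapping.single [letter 0] 1 \<in> N 1"
      by (rule minus_letter_null) (rule fs.subspace_0[OF subspace_free_on])
    from fs.subspace_diff[OF subspace_null minus_letter_null[OF p] this]
    show ?thesis using that by (simp add: letter.zero)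
  qed
  then show ?thesis using letter_null by auto
qed

text \<open>All degree one chains are cycles, so H_1 is the quotient of \<open>I\<close> by the
  image of \<open>mul\<close>, that is, by the span of the products of two elements of
  \<open>I\<close>.\<close>

lemma H1_zero_letter_iff: "p \<in> F 1 \<Longrightarrow> cl 1 p = \<zero>\<^bsub>H 1\<^esub> \<longleftrightarrow> (\<exists>q\<in>F 2. letter p = mul q)"
proof -
  assume p: "p \<in> F 1"
  have "p - d q \<in> N 1 \<longleftrightarrow> letter p = mul q" if "q \<in> F 2" for q
    using that p d_free_2 fs.subspace_diff[OF subspace_free_on, of p _ "d q"]
    by (subst null_1_iff) (auto simp: letter.diff letter_d)
  then show ?thesis using H1_zero_iff[of p] p unfolding cycles_1 by (simp add: numeral_2_eq_2 del: One_nat_def)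
qed

lemma single_F1: "x \<in> I \<Longrightarrow> Poly_Mapping.single [x] c \<in> F 1"
  by (auto intro: single_in_free_on simp: words_1[simplified])

lemma single_F2: "x \<in> I \<Longrightarrow> y \<in> I \<Longrightarrow> Poly_Mapping.single [x, y] c \<in> F 2"
  by (auto intro: single_in_free_on simp: words_2)

lemma letter_lin_ext_single:
  "letter (lin_ext fscale (\<lambda>i. Poly_Mapping.single [a i] 1) c) = lin_ext scale a c"
  by (simp add: lin_ext_def[of fscale] lin_ext_def[of scale a] letter.sum)

text \<open>The chains whose letter has the desired form give a submodule of H_1 that contains the
  generators, hence all of H_1.\<close>

lemma H1_generators:
  assumes a: "\<And>i. i \<in> X \<Longrightarrow> a i \<in> I"
    and gen: "submodule_span (H 1) ((\<lambda>i. bar_class scale \<delta> gr 1 (bar_tensor scale \<delta> gr [a i])) ` X) = carrier (H 1)"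
    and x: "x \<in> I"
  shows "\<exists>c\<in>free_on X. \<exists>q\<in>F 2. x = lin_ext scale a c + mul q"
proof -
  interpret c1: linear_on "F 1" "H 1" "cl 1" using H1_linear unfolding cycles_1 .
  let ?ac = "lin_ext scale a"
  interpret ac: module_hom fscale scale ?ac by (rule module_hom_lin_ext)
  let ?U = "{p \<in> F 1. \<exists>c\<in>free_on X. \<exists>q\<in>F 2. letter p = ?ac c + mul q}"
  have U_I: "p \<in> ?U" if "p \<in> F 1" "c \<in> free_on X" "q \<in> F 2" "letter p = ?ac c + mul q" for p c q
    using that by blast
  note add_closed = fs.subspace_add[OF subspace_free_on] and scale_closed = fs.subspace_scale[OF subspace_free_on]
  have U: "fs.subspace ?U"
  proof (rule fs.subspaceI)
    show "0 \<in> ?U"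
      by (intro CollectI conjI bexI[of _ 0] fs.subspace_0[OF subspace_free_on])
        (simp add: letter.zero ac.zero mul.zero)
  next
    fix p p' assume "p \<in> ?U" "p' \<in> ?U"
    then obtain c q c' q' where *: "c \<in> free_on X" "q \<in> F 2" "c' \<in> free_on X" "q' \<in> F 2"
      "letter p = ?ac c + mul q" "letter p' = ?ac c' + mul q'" and p: "p \<in> F 1" "p' \<in> F 1" by blast
    then have "letter (p + p') = ?ac (c + c') + mul (q + q')"
      by (simp add: letter.add ac.add mul.add)
    then show "p + p' \<in> ?U"
      by (intro U_I[OF add_closed[OF p] add_closed[OF *(1,3)] add_closed[OF *(2,4)]])
  next
    fix b p assume "p \<in> ?U"
    then obtain c q where *: "c \<in> free_on X" "q \<in> F 2" "letter p = ?ac c + mul q" and p: "p \<in> F 1" by blast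
    then have "letter (fscale b p) = ?ac (fscale b c) + mul (fscale b q)"
      by (simp add: letter.scale ac.scale mul.scale scale_right_distrib)
    then show "fscale b p \<in> ?U"
      by (rule U_I[OF scale_closed[OF p] scale_closed[OF *(1)] scale_closed[OF *(2)]])
  qed
  have "carrier (H 1) \<subseteq> cl 1 ` ?U"
    unfolding gen[symmetric]
  proof (rule submodule_span_least[OF _ c1.submodule_image[OF U]])
    show "(\<lambda>i. bar_class scale \<delta> gr 1 (bar_tensor scale \<delta> gr [a i])) ` X \<subseteq> cl 1 ` ?U"
    proof (rule image_subsetI)
      fix i assume i: "i \<in> X"
      have "letter (Poly_Mapping.single [a i] 1) = ?ac (Poly_Mapping.single i 1) + mul 0"
        by (simp add: mul.zero)
      then have "Poly_Mapping.single [a i] 1 \<in> ?U"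
        by (rule U_I[OF single_F1[OF a[OF i]] single_in_free_on[OF i] fs.subspace_0[OF subspace_free_on]])
      then show "bar_class scale \<delta> gr 1 (bar_tensor scale \<delta> gr [a i]) \<in> cl 1 ` ?U"
        by (subst bar_tensor_tens[of _ 1]) auto
    qed
  qed blast
  moreover have "cl 1 (Poly_Mapping.single [x] 1) \<in> carrier (H 1)" by (rule c1.closed[OF single_F1[OF x]])
  ultimately obtain p where p: "p \<in> ?U" "cl 1 (Poly_Mapping.single [x] 1) = cl 1 p" by blast
  \<comment> \<open>Equality of classes determines the chain of x only up to a boundary; that
    boundary is absorbed into the \<open>mul\<close> term.\<close>
  then have "cl 1 (Poly_Mapping.single [x] 1 - p) = \<zero>\<^bsub>H 1\<^esub>"
    using c1.eq_iff_diff[OF single_F1[OF x], of p] by blast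
  then obtain q where q: "q \<in> F 2" "letter (Poly_Mapping.single [x] 1 - p) = mul q"
    using H1_zero_letter_iff fs.subspace_diff[OF subspace_free_on single_F1[OF x], of p] p(1) by blast
  obtain c q' where c: "c \<in> free_on X" "q' \<in> F 2" "letter p = ?ac c + mul q'" using p(1) by blast
  have "x = ?ac c + mul (q + q')" using q(2) c(3) by (simp add: letter.diff mul.add algebra_simps)
  then show ?thesis using c q(1) fs.subspace_add[OF subspace_free_on] by blast
qed

text \<open>A vanishing class is a boundary, and \<open>letter\<close> turns boundaries into values
  of \<open>mul\<close>. Linear relations in H_1 thus become equations in A.\<close>

lemma H1_relation_iff:
  assumes a: "\<And>i. i \<in> X \<Longrightarrow> a i \<in> I" and c: "c \<in> free_on X"
  shows "(\<Oplus>\<^bsub>H 1\<^esub>i\<in>Poly_Mapping.keys c. Poly_Mapping.lookup c i \<odot>\<^bsub>H 1\<^esub>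
      bar_class scale \<delta> gr 1 (bar_tensor scale \<delta> gr [a i])) = \<zero>\<^bsub>H 1\<^esub>
    \<longleftrightarrow> (\<exists>q\<in>F 2. lin_ext scale a c = mul q)"
proof -
  interpret c1: linear_on "F 1" "H 1" "cl 1" using H1_linear unfolding cycles_1 .
  have aI: "i \<in> Poly_Mapping.keys c \<Longrightarrow> a i \<in> I" for i using a c by (auto simp: free_on_def)
  let ?g = "\<lambda>i. fscale (Poly_Mapping.lookup c i) (Poly_Mapping.single [a i] 1)"
  have g: "i \<in> Poly_Mapping.keys c \<Longrightarrow> ?g i \<in> F 1" for i
    using aI single_F1 by simp
  have "(\<Oplus>\<^bsub>H 1\<^esub>i\<in>Poly_Mapping.keys c. Poly_Mapping.lookup c i \<odot>\<^bsub>H 1\<^esub>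
      bar_class scale \<delta> gr 1 (bar_tensor scale \<delta> gr [a i])) = (\<Oplus>\<^bsub>H 1\<^esub>i\<in>Poly_Mapping.keys c. cl 1 (?g i))"
  proof (rule c1.M.finsum_cong')
    show "(\<lambda>i. cl 1 (?g i)) \<in> Poly_Mapping.keys c \<rightarrow> carrier (H 1)"
      using c1.closed[OF g] by blast
    show "Poly_Mapping.lookup c i \<odot>\<^bsub>H 1\<^esub> bar_class scale \<delta> gr 1 (bar_tensor scale \<delta> gr [a i]) = cl 1 (?g i)"
      if "i \<in> Poly_Mapping.keys c" for i
      using c1.smult[OF single_F1[OF aI[OF that], of 1], of "Poly_Mapping.lookup c i"] bar_tensor_tens[of "[a i]" 1]
      by simp
  qed simp
  also have "\<dots> = cl 1 (lin_ext fscale (\<lambda>i. Poly_Mapping.single [a i] 1) c)"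
    unfolding lin_ext_def by (rule c1.finsum[OF g]) simp_all
  finally have "?thesis = (cl 1 (lin_ext fscale (\<lambda>i. Poly_Mapping.single [a i] 1) c) = \<zero>\<^bsub>H 1\<^esub>
      \<longleftrightarrow> (\<exists>q\<in>F 2. lin_ext scale a c = mul q))" by simp
  moreover have "lin_ext fscale (\<lambda>i. Poly_Mapping.single [a i] 1) c \<in> F 1"
    by (rule fs.lin_ext_in[OF subspace_free_on c]) (use a single_F1 in blast)
  ultimately show ?thesis using H1_zero_letter_iff letter_lin_ext_single[of a c] by simp
qed

text \<open>Carries sums in the module record back to a representative, whose value under
  \<open>mul\<close> can be computed.\<close>

lemma finsum_bar_tensor_2:
  assumes "finite A" and "\<And>j. j \<in> A \<Longrightarrow> u j \<in> I" "\<And>j. j \<in> A \<Longrightarrow> v j \<in> I"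
  shows "(\<Oplus>\<^bsub>B 2\<^esub>j\<in>A. bar_tensor scale \<delta> gr [u j, v j]) = tens 2 (\<Sum>j\<in>A. Poly_Mapping.single [u j, v j] 1)"
    and "(\<Sum>j\<in>A. Poly_Mapping.single [u j, v j] 1) \<in> F 2"
    and "mul (\<Sum>j\<in>A. Poly_Mapping.single [u j, v j] 1) = (\<Sum>j\<in>A. bar (u j) * v j)"
proof -
  have F: "Poly_Mapping.single [u j, v j] 1 \<in> F 2" if "j \<in> A" for j
    using assms(2,3)[OF that] by (rule single_F2)
  interpret t: linear_on "F 2" "B 2" "tens 2" by (rule linear_on_tens)
  have t: "bar_tensor scale \<delta> gr [u j, v j] = tens 2 (Poly_Mapping.single [u j, v j] 1)" for j
    by (rule bar_tensor_tens) simp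
  show "(\<Oplus>\<^bsub>B 2\<^esub>j\<in>A. bar_tensor scale \<delta> gr [u j, v j]) = tens 2 (\<Sum>j\<in>A. Poly_Mapping.single [u j, v j] 1)"
    unfolding t by (rule t.finsum[OF F assms(1)])
  show "(\<Sum>j\<in>A. Poly_Mapping.single [u j, v j] 1) \<in> F 2"
    by (rule fs.subspace_sum[OF subspace_free_on F])
  show "mul (\<Sum>j\<in>A. Poly_Mapping.single [u j, v j] 1) = (\<Sum>j\<in>A. bar (u j) * v j)"
    by (simp add: mul.sum)
qed

lemma bar_d_tens_2: "p \<in> F 2 \<Longrightarrow> bar_d scale \<delta> gr 2 (tens 2 p) = tens 1 (d p)"
  using bar_d_tens[of 2 p] d_free_2 d_null_2 by simp

text \<open>Because \<open>letter\<close> kills tensor relations, an equality of 1-chains can be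
  read off as an identity in A.\<close>

lemma bar_tensor_eq_bar_d:
  assumes "x \<in> I" "p \<in> F 2" "bar_tensor scale \<delta> gr [x] = bar_d scale \<delta> gr 2 (tens 2 p)"
  shows "x = mul p"
proof -
  have dp: "d p \<in> F 1" using d_free_2 assms(2) by blast
  have "tens 1 (Poly_Mapping.single [x] 1) = tens 1 (d p)"
    using assms bar_tensor_tens[of "[x]" 1] bar_d_tens_2 by simp
  then have "letter (Poly_Mapping.single [x] 1 - d p) = 0"
    using letter_null tens_eq_iff[OF single_F1[OF assms(1)] dp] by blast
  then show ?thesis using letter_d[OF assms(2)] by (simp add: letter.diff)
qed

text \<open>In degree 1 a representative is null exactly when its \<open>letter\<close> vanishes,
  and \<open>letter_d\<close> turns this condition on \<open>d p\<close> into one on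
  \<open>mul p\<close>.\<close>

lemma tens_2_cycles_mul_iff: "p \<in> F 2 \<Longrightarrow> tens 2 p \<in> bar_cycles scale \<delta> gr 2 \<longleftrightarrow> mul p = 0"
  and cycles_2: "cycles 2 = {p \<in> F 2. mul p = 0}"
proof -
  have "d p \<in> N (2 - 1) \<longleftrightarrow> mul p = 0" if "p \<in> F 2" for p
    using null_1_iff[of "d p"] d_free_2 letter_d[OF that] that by auto
  then show "p \<in> F 2 \<Longrightarrow> tens 2 p \<in> bar_cycles scale \<delta> gr 2 \<longleftrightarrow> mul p = 0"
    and "cycles 2 = {p \<in> F 2. mul p = 0}"
    using tens_2_cycles_iff by blast+
qed

text \<open>Generation of H_2 recast as an induction principle: \<open>E\<close> stands for a linear
  property of representatives that holds for tensor relations, boundaries and the chosen cycles. It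
  is applied later to the preimage of \<open>W\<close> under \<open>phi\<close>.\<close>

lemma H2_generators:
  assumes Z: "\<And>j. j \<in> Ms \<Longrightarrow> z j \<in> F 2" "\<And>j. j \<in> Ms \<Longrightarrow> mul (z j) = 0"
    and gen: "submodule_span (H 2) ((\<lambda>j. cl 2 (z j)) ` Ms) = carrier (H 2)"
    and E: "fs.subspace E" "N 2 \<subseteq> E" "\<And>w. w \<in> words I 3 \<Longrightarrow> bar_d_word \<delta> gr w \<in> E"
      "\<And>j. j \<in> Ms \<Longrightarrow> z j \<in> E"
    and p: "p \<in> F 2" "mul p = 0"
  shows "p \<in> E"
proof -
  interpret c2: linear_on "cycles 2" "H 2" "cl 2" by (rule H2_linear)
  have "F 3 \<subseteq> {q. d q \<in> E}"
    by (rule free_on_le[OF fs.subspace_hom_vimage[OF d.module_hom_axioms E(1)]]) (simp add: d_single E(3) del: single_one)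
  have pc: "p \<in> cycles 2" using p cycles_2 by blast
  \<comment> \<open>\<open>E\<close> may contain elements that are not cycles, while
    \<open>cl 2\<close> is linear on cycles; hence the intersection.\<close>
  have "carrier (H 2) \<subseteq> cl 2 ` (cycles 2 \<inter> E)"
    unfolding gen[symmetric]
  proof (rule submodule_span_least[OF _ c2.submodule_image[OF fs.subspace_inter[OF c2.sub E(1)]]])
    show "(\<lambda>j. cl 2 (z j)) ` Ms \<subseteq> cl 2 ` (cycles 2 \<inter> E)"
      unfolding cycles_2 using Z E(4) by blast
  qed blast
  then obtain p' where p': "p' \<in> cycles 2" "p' \<in> E" "cl 2 p = cl 2 p'"
    using c2.closed[OF pc] by blast
  then have "cl 2 (p - p') = \<zero>\<^bsub>H 2\<^esub>"
    using c2.eq_iff_diff[OF pc p'(1)] by blast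
  then obtain q where "q \<in> F 3" "p - p' - d q \<in> N 2"
    using H2_zero_iff[OF fs.subspace_diff[OF c2.sub pc p'(1)]] by (auto simp: numeral_3_eq_3 numeral_2_eq_2)
  \<comment> \<open>The summands are a tensor relation, an element of \<open>E\<close> in the class
    of p, and a boundary.\<close>
  then have "(p - p' - d q) + p' + d q \<in> E"
    using \<open>F 3 \<subseteq> {q. d q \<in> E}\<close> E(2) p'(2) by (intro fs.subspace_add[OF E(1)]) auto
  then show ?thesis by simp
qed

end

section \<open>Generators\<close>

locale bar_generated =
  connected_graded_algebra scale \<delta> gr + graded_evaluation scale \<delta> gr X a dg
  for scale :: "'k::comm_ring_1 \<Rightarrow> 'a::ring_1 \<Rightarrow> 'a"
    and \<delta> :: "'g::comm_monoid_add \<Rightarrow> int" and gr :: "'g \<Rightarrow> 'a set"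
    and X :: "'i set" and a :: "'i \<Rightarrow> 'a" and dg :: "'i \<Rightarrow> 'g" +
  assumes generated: "x \<in> I \<Longrightarrow> \<exists>c\<in>free_on X. \<exists>q\<in>F 2. x = lin_ext scale a c + mul q"
begin

lemma proj_in_range_ev: "proj \<delta> gr n x \<in> e ` TX"
proof (induction "nat n" arbitrary: n x rule: less_induct)
  case less
  have R: "subspace (e ` TX)" by (rule ev.subspace_image[OF subspace_tensor_algebra])
  consider "n < 0" | "n = 0" | "n > 0" by linarith
  then show ?case
  proof cases
    case 1
    then show ?thesis using subspace_0[OF R] by (simp add: proj_neg)
  next
    case 2
    obtain c where "proj \<delta> gr n x = scale c 1" using proj_zero_part 2 by blast
    then have "proj \<delta> gr n x = e (fscale c 1)" by (simp add: ev.scale ev_one)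
    then show ?thesis using fs.subspace_scale[OF subspace_tensor_algebra one_tensor_algebra] by blast
  next
    case 3
    \<comment> \<open>The terms in the decomposition of \<open>proj \<delta> gr n x\<close> need not
      be homogeneous of degree n, so their degree n parts are tracked and the projection is applied
      once more at the end.\<close>
    have V: "subspace {x. proj \<delta> gr n x \<in> e ` TX}"
      by (rule subspace_hom_vimage[OF module_hom_proj R])
    have "proj \<delta> gr n x \<in> I" using 3 by (simp add: aug_ideal_proj proj_proj)
    then obtain c q where c: "c \<in> free_on X" and q: "q \<in> F 2" and x: "proj \<delta> gr n x = lin_ext scale a c + mul q"
      using generated by blast
    have "lin_ext scale a c \<in> {x. proj \<delta> gr n x \<in> e ` TX}"
    proof (rule lin_ext_in[OF V c])
      fix i assume "i \<in> X"
      then have "proj \<delta> gr n (a i) = a i \<or> proj \<delta> gr n (a i) = 0" and "e (tvar i) \<in> e ` TX"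
        by (simp_all add: proj_gr[OF a_gr] tvar_tensor_algebra)
      then show "a i \<in> {x. proj \<delta> gr n x \<in> e ` TX}"
        using subspace_0[OF R] by (auto simp: ev_tvar)
    qed
    moreover have "mul q \<in> {x. proj \<delta> gr n x \<in> e ` TX}"
      unfolding mul_def
    proof (rule lin_ext_in[OF V q])
      fix w assume "w \<in> words I 2"
      then obtain y z where w: "w = [y, z]" and yz: "y \<in> I" "z \<in> I" by (auto simp: words_2)
      have "proj \<delta> gr n (bar y * z) \<in> e ` TX"
      proof (rule proj_mult_in[OF R])
        fix k m assume km: "k + m = n"
        show "proj \<delta> gr k (bar y) * proj \<delta> gr m z \<in> e ` TX"
        \<comment> \<open>If both degrees are positive, each is below n and the induction hypothesis
          applies. Otherwise one factor is zero: A has no negative degrees, and elements of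
          \<open>I\<close> have no degree zero part.\<close>
        proof (cases "k > 0 \<and> m > 0")
          case True
          then have "nat k < nat n" "nat m < nat n" using km by auto
          then have "proj \<delta> gr k (bar y) \<in> e ` TX" "proj \<delta> gr m z \<in> e ` TX"
            using less.hyps[of k "bar y"] less.hyps[of m z] by simp_all
          then obtain p q where "p \<in> TX" "q \<in> TX" "proj \<delta> gr k (bar y) = e p" "proj \<delta> gr m z = e q" by blast
          then show ?thesis
            using imageI[OF mult_tensor_algebra, of p X q e] by (simp add: ev_mult)
        next
          case False
          then consider "k < 0" | "m < 0" | "k = 0" | "m = 0" by linarith
          then have "proj \<delta> gr k (bar y) = 0 \<or> proj \<delta> gr m z = 0"
            using yz bar_in_aug_ideal[of y] by cases (simp_all add: proj_neg aug_ideal_proj)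
          then show ?thesis using subspace_0[OF R] by auto
        qed
      qed
      then show "bar (w ! 0) * w ! 1 \<in> {x. proj \<delta> gr n x \<in> e ` TX}" by (simp add: w)
    qed
    ultimately have "proj \<delta> gr n (proj \<delta> gr n x) \<in> e ` TX"
      unfolding x by (simp add: proj.add subspace_add[OF R])
    then show ?thesis by (simp add: proj_proj)
  qed
qed

lemma ev_surj: "e ` TX = UNIV"
proof -
  have "x \<in> e ` TX" for x
  proof -
    obtain K where x: "x = (\<Sum>n\<in>K. proj \<delta> gr n x)" using sum_proj[of x] by blast
    show ?thesis
      by (subst x) (intro subspace_sum[OF ev.subspace_image[OF subspace_tensor_algebra]] proj_in_range_ev)
  qed
  then show ?thesis by blast
qed

lemma subalgebra_hull: "subalgebra scale hull (a ` X) = UNIV"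
proof -
  have univ: "UNIV \<subseteq> B" if B: "subalgebra scale B" and aX: "a ` X \<subseteq> B" for B
  proof -
    have 1: "1 \<in> B" and diff: "\<And>x y. x \<in> B \<Longrightarrow> y \<in> B \<Longrightarrow> x - y \<in> B"
      and mult: "\<And>x y. x \<in> B \<Longrightarrow> y \<in> B \<Longrightarrow> x * y \<in> B" and sc: "\<And>c x. x \<in> B \<Longrightarrow> scale c x \<in> B"
      using B by (auto simp: subalgebra_def)
    have 0: "0 \<in> B" using diff[OF 1 1] by simp
    have "x + y \<in> B" if "x \<in> B" "y \<in> B" for x y
      using diff[OF that(1) diff[OF 0 that(2)]] by simp
    then have sub: "subspace B" using 0 sc by (intro subspaceI)
    have "(\<Prod>i\<leftarrow>l. a i) \<in> B" if "set l \<subseteq> X" for l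
      using that by (induction l) (simp_all add: 1 mult aX[THEN subsetD])
    then have "TX \<subseteq> {p. e p \<in> B}"
      unfolding tensor_algebra_free_on
      by (intro free_on_le[OF subspace_hom_vimage[OF module_hom_ev sub]]) (simp add: ev_single del: single_one)
    then have "e ` TX \<subseteq> B" by (simp add: image_subset_iff subset_eq)
    then show "UNIV \<subseteq> B" using ev_surj by auto
  qed
  show ?thesis
    unfolding hull_def by (intro equalityI subset_UNIV Inter_greatest; elim CollectE conjE; rule univ)
qed

text \<open>Removing the degree zero part of a preimage leaves its value unchanged, since evaluation
  commutes with the projection and u has no degree zero part.\<close>

lemma IT_lift: "u \<in> I \<Longrightarrow> \<exists>U\<in>IT. e U = u"
proof -
  assume u: "u \<in> I"
  obtain p where p: "p \<in> TX" "e p = u" using ev_surj by (metis UNIV_I imageE)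
  let ?q = "proj \<delta> (tensor_gr dg) 0 p"
  have "e ?q = 0" using ev_proj[OF p(1), of 0] u p(2) by (simp add: aug_ideal_proj)
  then have "e (p - ?q) = u" using p(2) by (simp add: ev.diff)
  moreover have "p - ?q \<in> IT"
    using fs.subspace_diff[OF subspace_tensor_algebra p(1) proj_TX[OF p(1)]]
    by (simp add: T.aug_ideal_proj T.proj.diff T.proj_proj)
  ultimately show ?thesis by blast
qed

lemma mult_IT: "p \<in> IT \<Longrightarrow> q \<in> IT \<Longrightarrow> p * q \<in> IT"
proof -
  assume p: "p \<in> IT" and q: "q \<in> IT"
  have "proj \<delta> (tensor_gr dg) 0 (p * q) \<in> {0}"
  proof (rule T.proj_mult_in[OF fs.subspace_single_0])
    fix k m :: int assume "k + m = 0"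
    then consider "k < 0" | "m < 0" | "k = 0" by linarith
    then show "proj \<delta> (tensor_gr dg) k p * proj \<delta> (tensor_gr dg) m q \<in> {0}"
      using p q proj_neg_TX by cases (auto simp: T.aug_ideal_proj)
  qed
  then show ?thesis using mult_tensor_algebra p q by (auto simp: T.aug_ideal_proj)
qed

section \<open>The kernel of the evaluation and chosen lifts\<close>

definition kernel :: "('i word \<Rightarrow>\<^sub>0 'k) set" where
  "kernel = {p \<in> TX. e p = 0}"

text \<open>Evaluation respects degrees, so the constant term c of a polynomial in the kernel
  satisfies \<open>scale c 1 = 0\<close>; injectivity of the unit map then gives c = 0.\<close>

lemma kernel_IT: "kernel \<subseteq> IT"
proof
  fix p assume p: "p \<in> kernel"
  then have "e (proj \<delta> (tensor_gr dg) 0 p) = 0" by (simp add: kernel_def ev_proj proj.zero)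
  then have "scale (Poly_Mapping.lookup p 0) 1 = scale 0 1"
    using p by (simp add: kernel_def proj_zero_TX ev_single)
  then have "Poly_Mapping.lookup p 0 = 0" using inj_unit by (rule injD[rotated])
  then show "p \<in> IT" using p unfolding IT_iff kernel_def by blast
qed

lemma subspace_kernel: "fs.subspace kernel"
  using fs.subspace_inter[OF subspace_tensor_algebra ev.subspace_kernel] by (simp add: kernel_def Collect_conj_eq)

definition lift :: "'a \<Rightarrow> 'i word \<Rightarrow>\<^sub>0 'k" where
  "lift u = (SOME U. U \<in> IT \<and> e U = u)"

lemma lift: "u \<in> I \<Longrightarrow> lift u \<in> IT" "u \<in> I \<Longrightarrow> e (lift u) = u"
  using someI_ex[of "\<lambda>U. U \<in> IT \<and> e U = u"] IT_lift[of u] unfolding lift_def by blast+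

lemma IT_free_on: "IT = free_on {u. set (letters u) \<subseteq> X \<and> letters u \<noteq> []}"
proof -
  have "letters u = [] \<longleftrightarrow> u = 0" for u :: "'i word" by (cases u) (simp add: zero_word_def)
  then have "p \<in> TX \<and> Poly_Mapping.lookup p 0 = 0 \<longleftrightarrow> p \<in> free_on {u. set (letters u) \<subseteq> X \<and> letters u \<noteq> []}"
    for p :: "'i word \<Rightarrow>\<^sub>0 'k"
    unfolding tensor_algebra_def free_on_def by (auto simp: in_keys_iff)
  then show ?thesis using IT_iff by blast
qed

abbreviation lin :: "('i \<Rightarrow>\<^sub>0 'k) \<Rightarrow> 'i word \<Rightarrow>\<^sub>0 'k" where
  "lin \<equiv> lin_ext fscale tvar"

lemma ev_lin: "e (lin c) = lin_ext scale a c"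
  by (simp add: lin_ext_def ev.sum ev.scale ev_tvar)

lemma lin_TX: "c \<in> free_on X \<Longrightarrow> lin c \<in> TX"
  by (rule fs.lin_ext_in[OF subspace_tensor_algebra _ tvar_tensor_algebra])

text \<open>\<open>lift\<close> is an arbitrary section, so \<open>phi\<close> respects the relations of the tensor product only
  modulo \<open>kernel * IT + IT * kernel\<close>.\<close>

definition phi :: "('a list \<Rightarrow>\<^sub>0 'k) \<Rightarrow> 'i word \<Rightarrow>\<^sub>0 'k" where
  "phi = lin_ext fscale (\<lambda>w. T.bar (lift (w ! 0)) * lift (w ! 1))"

sublocale phi: module_hom fscale fscale phi
  unfolding phi_def by (rule fs.module_hom_lin_ext)

lemma phi_single: "phi (Poly_Mapping.single [x, y] c) = fscale c (T.bar (lift x) * lift y)"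
  by (simp add: phi_def)

end

section \<open>Ideals of the tensor algebra\<close>

lemma a_inv_ring_on:
  assumes "ring (ring_on S)" "x \<in> S" "- x \<in> S"
  shows "\<ominus>\<^bsub>ring_on S\<^esub> x = - x"
proof -
  interpret ring "ring_on S" by fact
  show ?thesis by (rule minus_equality) (use assms in simp_all)
qed

lemma ideal_ring_onI:
  assumes R: "ring (ring_on S)" and "V \<subseteq> S" "0 \<in> V"
    and add: "\<And>x y. x \<in> V \<Longrightarrow> y \<in> V \<Longrightarrow> x + y \<in> V" and neg: "\<And>x. x \<in> V \<Longrightarrow> - x \<in> V"
    and "\<And>x y. x \<in> S \<Longrightarrow> y \<in> V \<Longrightarrow> x * y \<in> V" "\<And>x y. x \<in> S \<Longrightarrow> y \<in> V \<Longrightarrow> y * x \<in> V"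
  shows "ideal V (ring_on S)"
proof (rule idealI[OF R])
  interpret ring "ring_on S" by fact
  have "\<ominus>\<^bsub>ring_on S\<^esub> x \<in> V" if "x \<in> V" for x
    using a_inv_ring_on[OF R, of x] neg[OF that] that assms(2) by (simp add: subset_eq)
  then show "subgroup V (add_monoid (ring_on S))"
    using assms by (intro add.subgroupI) (auto simp: a_inv_def)
qed (use assms in auto)

section \<open>Relations\<close>

text \<open>Hypotheses of the second part after translation into A. \<open>lam_span\<close> is
  completeness of the linear relations in H_1, read through \<open>H1_relation_iff\<close>;
  \<open>cycles_generated\<close> is generation of H_2 in the form of \<open>H2_generators\<close>.
  \<open>linrel\<close> and \<open>quadrel\<close> are parameters with defining equations so that
  they match the names in the theorem.\<close>

locale bar_presented = bar_generated scale \<delta> gr X a dg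
  for scale :: "'k::comm_ring_1 \<Rightarrow> 'a::ring_1 \<Rightarrow> 'a"
    and \<delta> :: "'g::comm_monoid_add \<Rightarrow> int" and gr :: "'g \<Rightarrow> 'a set"
    and X :: "'i set" and a :: "'i \<Rightarrow> 'a" and dg :: "'i \<Rightarrow> 'g" +
  fixes Rs :: "'r set" and lam :: "'r \<Rightarrow> 'i \<Rightarrow>\<^sub>0 'k"
    and Bs :: "'r \<Rightarrow> 'b set" and K L :: "'r \<Rightarrow> 'b \<Rightarrow> ('i word \<Rightarrow>\<^sub>0 'k)"
    and Ms :: "'m set"
    and As :: "'m \<Rightarrow> 'c set" and P Q :: "'m \<Rightarrow> 'c \<Rightarrow> ('i word \<Rightarrow>\<^sub>0 'k)"
    and linrel :: "'r \<Rightarrow> 'i word \<Rightarrow>\<^sub>0 'k" and quadrel :: "'m \<Rightarrow> 'i word \<Rightarrow>\<^sub>0 'k"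
  assumes linrel_def: "linrel r = lin (lam r) - (\<Sum>\<beta>\<in>Bs r. T.bar (K r \<beta>) * L r \<beta>)"
    and quadrel_def: "quadrel j = (\<Sum>\<alpha>\<in>As j. T.bar (P j \<alpha>) * Q j \<alpha>)"
    and lam: "r \<in> Rs \<Longrightarrow> lam r \<in> free_on X"
    and K: "r \<in> Rs \<Longrightarrow> \<beta> \<in> Bs r \<Longrightarrow> K r \<beta> \<in> IT" and L: "r \<in> Rs \<Longrightarrow> \<beta> \<in> Bs r \<Longrightarrow> L r \<beta> \<in> IT"
    and lam_eq: "r \<in> Rs \<Longrightarrow> lin_ext scale a (lam r) = (\<Sum>\<beta>\<in>Bs r. bar (e (K r \<beta>)) * e (L r \<beta>))"
    and lam_span: "c \<in> free_on X \<Longrightarrow> q \<in> F 2 \<Longrightarrow> lin_ext scale a c = mul q \<Longrightarrow> c \<in> fs.span (lam ` Rs)"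
    and P: "j \<in> Ms \<Longrightarrow> \<alpha> \<in> As j \<Longrightarrow> P j \<alpha> \<in> IT" and Q: "j \<in> Ms \<Longrightarrow> \<alpha> \<in> As j \<Longrightarrow> Q j \<alpha> \<in> IT"
    and PQ_cycle: "j \<in> Ms \<Longrightarrow> (\<Sum>\<alpha>\<in>As j. bar (e (P j \<alpha>)) * e (Q j \<alpha>)) = 0"
    and cycles_generated: "\<And>E q. fs.subspace E \<Longrightarrow> N 2 \<subseteq> E \<Longrightarrow>
      (\<And>w. w \<in> words I 3 \<Longrightarrow> bar_d_word \<delta> gr w \<in> E) \<Longrightarrow>
      (\<And>j. j \<in> Ms \<Longrightarrow> (\<Sum>\<alpha>\<in>As j. Poly_Mapping.single [e (P j \<alpha>), e (Q j \<alpha>)] 1) \<in> E) \<Longrightarrow>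
      q \<in> F 2 \<Longrightarrow> mul q = 0 \<Longrightarrow> q \<in> E"
    and linrel_gr: "r \<in> Rs \<Longrightarrow> \<exists>g. linrel r \<in> tensor_gr dg g"
    and quadrel_gr: "j \<in> Ms \<Longrightarrow> \<exists>g. quadrel j \<in> tensor_gr dg g"
begin

section \<open>The ideal generated by the relations\<close>

abbreviation "rels \<equiv> linrel ` Rs \<union> quadrel ` Ms"

definition J :: "('i word \<Rightarrow>\<^sub>0 'k) set" where
  "J = Idl\<^bsub>ring_on TX\<^esub> rels"

lemma ring_TX: "ring (ring_on TX)"
  by (rule ring_ring_on[OF one_tensor_algebra])
    (rule fs.subspace_diff[OF subspace_tensor_algebra] mult_tensor_algebra; assumption)+

sublocale TX: ring "ring_on TX"
  by (rule ring_TX)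

lemma bar_mult_TX: "U \<in> IT \<Longrightarrow> V \<in> IT \<Longrightarrow> T.bar U * V \<in> TX"
  using bar_TX mult_tensor_algebra by blast

lemma rels_TX: "rels \<subseteq> TX"
proof -
  have "linrel r \<in> TX" if "r \<in> Rs" for r
    unfolding linrel_def
    by (intro fs.subspace_diff[OF subspace_tensor_algebra] fs.subspace_sum[OF subspace_tensor_algebra]
        lin_TX bar_mult_TX lam K L that)
  moreover have "quadrel j \<in> TX" if "j \<in> Ms" for j
    unfolding quadrel_def by (intro fs.subspace_sum[OF subspace_tensor_algebra] bar_mult_TX P Q that)
  ultimately show ?thesis by blast
qed

lemma ideal_J: "ideal J (ring_on TX)"
  unfolding J_def by (rule TX.genideal_ideal) (use rels_TX in simp)

lemma rels_J: "rels \<subseteq> J"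
  unfolding J_def by (rule TX.genideal_self) (use rels_TX in simp)

lemma J_minimal: "ideal V (ring_on TX) \<Longrightarrow> rels \<subseteq> V \<Longrightarrow> J \<subseteq> V"
  unfolding J_def by (rule TX.genideal_minimal)

lemma J_TX: "J \<subseteq> TX"
  using ideal.axioms(1)[OF ideal_J, THEN additive_subgroup.a_subset] by simp

lemma J_mult_left: "x \<in> TX \<Longrightarrow> p \<in> J \<Longrightarrow> x * p \<in> J"
  using ideal.I_l_closed[OF ideal_J, of p x] by simp

lemma J_mult_right: "x \<in> TX \<Longrightarrow> p \<in> J \<Longrightarrow> p * x \<in> J"
  using ideal.I_r_closed[OF ideal_J, of p x] by simp

text \<open>Scalars act as multiplication by constant polynomials, which lie in the tensor algebra;
  so a ring ideal is a submodule.\<close>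

lemma subspace_J: "fs.subspace J"
proof (rule fs.subspaceI)
  show "0 \<in> J"
    using additive_subgroup.zero_closed[OF ideal.axioms(1)[OF ideal_J]] by simp
  show "p + q \<in> J" if "p \<in> J" "q \<in> J" for p q
    using additive_subgroup.a_closed[OF ideal.axioms(1)[OF ideal_J] that] by simp
  show "fscale c p \<in> J" if "p \<in> J" for c p
    unfolding fscale_conv_mult by (rule J_mult_left[OF _ that]) (simp add: tensor_algebra_def)
qed

lemma ideal_TX_I:
  assumes "fs.subspace V" "V \<subseteq> TX"
    and "\<And>x p. x \<in> TX \<Longrightarrow> p \<in> V \<Longrightarrow> x * p \<in> V" "\<And>x p. x \<in> TX \<Longrightarrow> p \<in> V \<Longrightarrow> p * x \<in> V"
  shows "ideal V (ring_on TX)"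
  by (rule ideal_ring_onI[OF ring_TX assms(2) fs.subspace_0[OF assms(1)] fs.subspace_add[OF assms(1)]
        fs.subspace_neg[OF assms(1)] assms(3,4)])

lemma ideal_kernel: "ideal kernel (ring_on TX)"
  by (rule ideal_TX_I[OF subspace_kernel]) (auto simp: kernel_def ev_mult mult_tensor_algebra)

lemma J_kernel: "J \<subseteq> kernel"
proof (rule J_minimal[OF ideal_kernel])
  have "e (linrel r) = 0" if "r \<in> Rs" for r
  proof -
    have "e (\<Sum>\<beta>\<in>Bs r. T.bar (K r \<beta>) * L r \<beta>) = (\<Sum>\<beta>\<in>Bs r. bar (e (K r \<beta>)) * e (L r \<beta>))"
      unfolding ev.sum ev_mult using K[OF that] by (intro sum.cong refl) (simp add: ev_bar)
    then show ?thesis by (simp add: linrel_def ev.diff ev_lin lam_eq[OF that])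
  qed
  moreover have "e (quadrel j) = 0" if "j \<in> Ms" for j
  proof -
    have "e (quadrel j) = (\<Sum>\<alpha>\<in>As j. bar (e (P j \<alpha>)) * e (Q j \<alpha>))"
      unfolding quadrel_def ev.sum ev_mult using P[OF that] by (intro sum.cong refl) (simp add: ev_bar)
    then show ?thesis using PQ_cycle[OF that] by simp
  qed
  ultimately show "rels \<subseteq> kernel" using rels_TX by (auto simp: kernel_def)
qed

text \<open>The polynomials all of whose projections lie in \<open>J\<close> form an ideal, and it
  contains the relations because they are homogeneous.\<close>

lemma proj_J: "p \<in> J \<Longrightarrow> proj \<delta> (tensor_gr dg) n p \<in> J"
proof -
  let ?V = "{p \<in> TX. \<forall>n. proj \<delta> (tensor_gr dg) n p \<in> J}"
  have "fs.subspace ?V"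
    by (rule fs.subspaceI)
      (auto simp: T.proj.add T.proj.scale T.proj.zero intro: fs.subspace_0[OF subspace_J]
        fs.subspace_add[OF subspace_J] fs.subspace_scale[OF subspace_J] fs.subspace_0[OF subspace_tensor_algebra]
        fs.subspace_add[OF subspace_tensor_algebra] fs.subspace_scale[OF subspace_tensor_algebra])
  then have "ideal ?V (ring_on TX)"
  proof (rule ideal_TX_I)
    fix x p assume x: "x \<in> TX" and p: "p \<in> ?V"
    have "proj \<delta> (tensor_gr dg) n (x * p) \<in> J" "proj \<delta> (tensor_gr dg) n (p * x) \<in> J" for n
      by (rule T.proj_mult_in[OF subspace_J]; use x p in \<open>simp add: J_mult_left J_mult_right proj_TX\<close>)+
    then show "x * p \<in> ?V" "p * x \<in> ?V" using x p by (simp_all add: mult_tensor_algebra)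
  qed blast
  moreover have "rels \<subseteq> ?V"
  proof
    fix p assume p: "p \<in> rels"
    then obtain g where "p \<in> tensor_gr dg g" using linrel_gr quadrel_gr by blast
    then have "proj \<delta> (tensor_gr dg) n p \<in> J" for n
      using subsetD[OF rels_J p] fs.subspace_0[OF subspace_J] by (simp add: T.proj_gr)
    then show "p \<in> ?V" using p rels_TX by blast
  qed
  ultimately show "p \<in> J \<Longrightarrow> proj \<delta> (tensor_gr dg) n p \<in> J"
    using J_minimal[of ?V] by blast
qed

text \<open>The submodule J + J' T' + T' J', with \<open>kernel\<close> for J' and \<open>IT\<close>
  for T'.\<close>

definition W :: "('i word \<Rightarrow>\<^sub>0 'k) set" where
  "W = fs.span (J \<union> {q * t | q t. q \<in> kernel \<and> t \<in> IT} \<union> {t * q | q t. q \<in> kernel \<and> t \<in> IT})"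

lemma subspace_W: "fs.subspace W"
  by (simp add: W_def)

lemma W_J: "p \<in> J \<Longrightarrow> p \<in> W"
  and W_left: "q \<in> kernel \<Longrightarrow> t \<in> IT \<Longrightarrow> q * t \<in> W"
  and W_right: "q \<in> kernel \<Longrightarrow> t \<in> IT \<Longrightarrow> t * q \<in> W"
  unfolding W_def by (rule fs.span_base, blast)+

section \<open>The map phi modulo W\<close>

lemma bar_mult_cong:
  assumes "U \<in> IT" "U' \<in> IT" "V \<in> IT" "V' \<in> IT" "e U = e U'" "e V = e V'"
  shows "T.bar U * V - T.bar U' * V' \<in> W"
proof -
  have "T.bar (U - U') \<in> kernel" "V - V' \<in> kernel"
    using assms fs.subspace_diff[OF subspace_tensor_algebra, of U _ U'] fs.subspace_diff[OF subspace_tensor_algebra, of V _ V']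
    by (simp_all add: kernel_def ev_bar bar_TX ev.diff bar.zero)
  \<comment> \<open>Changing one lift at a time writes the difference as two products, each with one
    factor in \<open>kernel\<close>.\<close>
  then have "T.bar (U - U') * V + T.bar U' * (V - V') \<in> W"
    using assms by (intro fs.subspace_add[OF subspace_W] W_left W_right bar_IT)
  then show ?thesis by (simp add: T.bar.diff algebra_simps)
qed

lemma phi_single_cong:
  assumes "U \<in> IT" "V \<in> IT"
  shows "phi (Poly_Mapping.single [e U, e V] 1) - T.bar U * V \<in> W"
  unfolding phi_single fs.scale_one
  by (rule bar_mult_cong[OF lift(1) assms(1) lift(1) assms(2) lift(2) lift(2)]; rule ev_IT; rule assms)

lemma lift_cong: "U \<in> IT \<Longrightarrow> V \<in> IT \<Longrightarrow> u = e U \<Longrightarrow> v = e V \<Longrightarrow> T.bar (lift u) * lift v - T.bar U * V \<in> W"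
  using phi_single_cong by (simp add: phi_single)

text \<open>Sums and multiples of lifts are lifts of the sums and multiples, and modulo
  \<open>W\<close> any lifts may be used; for these the tensor relations hold exactly.\<close>

lemma phi_null: "N 2 \<subseteq> {q. phi q \<in> W}"
proof (rule null_2_le[OF fs.subspace_hom_vimage[OF phi.module_hom_axioms subspace_W]])
  fix x y z assume I: "x \<in> I" "y \<in> I" "z \<in> I"
  have xy: "lift x + lift y \<in> IT" using I by (intro fs.subspace_add[OF subspace_IT] lift)
  have ex: "e (lift x + lift y) = x + y" using I by (simp add: ev.add lift)
  show "Poly_Mapping.single [x + y, z] 1 - Poly_Mapping.single [x, z] 1 - Poly_Mapping.single [y, z] 1 \<in> {q. phi q \<in> W}"
    using lift_cong[OF xy lift(1)[OF I(3)] ex[symmetric] lift(2)[OF I(3), symmetric]]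
    by (simp add: phi.diff phi_single T.bar.add distrib_right diff_diff_eq phi.add)
  show "Poly_Mapping.single [z, x + y] 1 - Poly_Mapping.single [z, x] 1 - Poly_Mapping.single [z, y] 1 \<in> {q. phi q \<in> W}"
    using lift_cong[OF lift(1)[OF I(3)] xy lift(2)[OF I(3), symmetric] ex[symmetric]]
    by (simp add: phi.diff phi_single distrib_left diff_diff_eq phi.add)
next
  fix c x z assume I: "x \<in> I" "z \<in> I"
  have cx: "fscale c (lift x) \<in> IT" using I by (intro fs.subspace_scale[OF subspace_IT] lift)
  have ec: "e (fscale c (lift x)) = scale c x" using I by (simp add: ev.scale lift)
  show "Poly_Mapping.single [scale c x, z] 1 - Poly_Mapping.single [x, z] c \<in> {q. phi q \<in> W}"
    using lift_cong[OF cx lift(1)[OF I(2)] ec[symmetric] lift(2)[OF I(2), symmetric]]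
    by (simp add: phi.diff phi_single T.bar.scale fscale_mult_left)
  show "Poly_Mapping.single [z, scale c x] 1 - Poly_Mapping.single [z, x] c \<in> {q. phi q \<in> W}"
    using lift_cong[OF lift(1)[OF I(2)] cx lift(2)[OF I(2), symmetric] ec[symmetric]]
    by (simp add: phi.diff phi_single fscale_mult_right)
qed

lemma phi_d_word:
  assumes "w \<in> words I 3"
  shows "phi (bar_d_word \<delta> gr w) \<in> W"
proof -
  obtain x y z where w: "w = [x, y, z]" and I: "x \<in> I" "y \<in> I" "z \<in> I"
    using assms by (auto simp: words_3)
  let ?x = "lift x" and ?y = "lift y" and ?z = "lift z"
  note IT = lift(1)[OF I(1)] lift(1)[OF I(2)] lift(1)[OF I(3)]
  note E = lift(2)[OF I(1)] lift(2)[OF I(2)] lift(2)[OF I(3)]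
  have bE: "e (T.bar ?x) = bar x" "e (T.bar ?y) = bar y" using IT E by (simp_all add: ev_bar)
  have "e (T.bar ?x * ?y) = bar x * y" "e (T.bar ?y * ?z) = bar y * z"
    by (simp_all add: ev_mult bE E)
  note xy = this[symmetric]
  \<comment> \<open>The products in A are lifted by products of lifts; with this choice the two
    terms cancel exactly by \<open>T.bar_mult\<close>.\<close>
  have 1: "T.bar (lift (bar x * y)) * ?z - T.bar (T.bar ?x * ?y) * ?z \<in> W"
    by (rule lift_cong[OF mult_IT[OF bar_IT[OF IT(1)] IT(2)] IT(3) xy(1) E(3)[symmetric]])
  have 2: "T.bar (lift (bar x)) * lift (bar y * z) - T.bar (T.bar ?x) * (T.bar ?y * ?z) \<in> W"
    by (rule lift_cong[OF bar_IT[OF IT(1)] mult_IT[OF bar_IT[OF IT(2)] IT(3)] bE(1)[symmetric] xy(2)])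
  have "T.bar (T.bar ?x * ?y) * ?z + T.bar (T.bar ?x) * (T.bar ?y * ?z) = 0"
    by (simp add: T.bar_mult mult.assoc)
  moreover have "phi (bar_d_word \<delta> gr w) - (T.bar (T.bar ?x * ?y) * ?z + T.bar (T.bar ?x) * (T.bar ?y * ?z)) \<in> W"
    using fs.subspace_add[OF subspace_W 1 2] by (simp add: w bar_d_word_3 phi.add phi_single algebra_simps)
  ultimately show ?thesis by simp
qed

text \<open>The polynomials P and Q are lifts of their own values, so modulo \<open>W\<close> the
  image is \<open>quadrel j\<close>, which lies in \<open>J\<close>.\<close>

lemma phi_quadrel:
  assumes "j \<in> Ms"
  shows "phi (\<Sum>\<alpha>\<in>As j. Poly_Mapping.single [e (P j \<alpha>), e (Q j \<alpha>)] 1) \<in> W"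
proof -
  have "phi (\<Sum>\<alpha>\<in>As j. Poly_Mapping.single [e (P j \<alpha>), e (Q j \<alpha>)] 1) - quadrel j
      = (\<Sum>\<alpha>\<in>As j. phi (Poly_Mapping.single [e (P j \<alpha>), e (Q j \<alpha>)] 1) - T.bar (P j \<alpha>) * Q j \<alpha>)"
    by (simp add: phi.sum quadrel_def sum_subtractf)
  also have "\<dots> \<in> W"
    by (intro fs.subspace_sum[OF subspace_W] phi_single_cong P Q assms)
  finally have "phi (\<Sum>\<alpha>\<in>As j. Poly_Mapping.single [e (P j \<alpha>), e (Q j \<alpha>)] 1) - quadrel j + quadrel j \<in> W"
    using W_J rels_J assms by (intro fs.subspace_add[OF subspace_W]) auto
  then show ?thesis by simp
qed

lemma phi_cycle: "q \<in> F 2 \<Longrightarrow> mul q = 0 \<Longrightarrow> phi q \<in> W"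
  using cycles_generated[OF fs.subspace_hom_vimage[OF phi.module_hom_axioms subspace_W] phi_null, of q]
    phi_d_word phi_quadrel by blast

text \<open>Elements that are, modulo \<open>W\<close>, combinations of products with barred first
  factor, the combination being recorded by a 2-chain q. Tying the value of p to \<open>mul\<close>
  of the same q is what makes q a cycle once p lies in the kernel.\<close>

definition D :: "('i word \<Rightarrow>\<^sub>0 'k) set" where
  "D = {p \<in> TX. \<exists>q\<in>F 2. e p = mul q \<and> p - phi q \<in> W}"

lemma D_I: "p \<in> TX \<Longrightarrow> q \<in> F 2 \<Longrightarrow> e p = mul q \<Longrightarrow> p - phi q \<in> W \<Longrightarrow> p \<in> D"
  unfolding D_def by blast

lemma subspace_D: "fs.subspace D"
proof (rule fs.subspaceI)
  show "0 \<in> D"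
    by (rule D_I[of _ 0]) (simp_all add: fs.subspace_0 subspace_tensor_algebra subspace_free_on subspace_W
        ev.zero mul.zero phi.zero)
next
  fix p p' assume "p \<in> D" "p' \<in> D"
  then obtain q q' where p: "p \<in> TX" "p' \<in> TX" and q: "q \<in> F 2" "q' \<in> F 2"
    and e: "e p = mul q" "e p' = mul q'" and w: "p - phi q \<in> W" "p' - phi q' \<in> W"
    unfolding D_def by blast
  show "p + p' \<in> D"
  proof (rule D_I[OF fs.subspace_add[OF subspace_tensor_algebra p] fs.subspace_add[OF subspace_free_on q]])
    show "p + p' - phi (q + q') \<in> W"
      using fs.subspace_add[OF subspace_W w] by (simp add: phi.add algebra_simps)
  qed (simp add: ev.add mul.add e)
next
  fix c p assume "p \<in> D"
  then obtain q where p: "p \<in> TX" and q: "q \<in> F 2" and e: "e p = mul q" and w: "p - phi q \<in> W"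
    unfolding D_def by blast
  show "fscale c p \<in> D"
  proof (rule D_I[OF fs.subspace_scale[OF subspace_tensor_algebra p] fs.subspace_scale[OF subspace_free_on q]])
    show "fscale c p - phi (fscale c q) \<in> W"
      using fs.subspace_scale[OF subspace_W w] by (simp add: phi.scale fs.scale_right_diff_distrib)
  qed (simp add: ev.scale mul.scale e)
qed

lemma J_D: "p \<in> J \<Longrightarrow> p \<in> D"
  by (rule D_I[of _ 0])
    (use J_TX J_kernel W_J in \<open>auto simp: kernel_def mul.zero phi.zero fs.subspace_0[OF subspace_free_on]\<close>)

lemma bar_mult_D: "U \<in> IT \<Longrightarrow> V \<in> IT \<Longrightarrow> T.bar U * V \<in> D"
proof (rule D_I[of _ "Poly_Mapping.single [e U, e V] 1"])
  assume U: "U \<in> IT" and V: "V \<in> IT"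
  show "T.bar U * V \<in> TX" by (rule bar_mult_TX[OF U V])
  show "Poly_Mapping.single [e U, e V] 1 \<in> F 2" by (rule single_F2[OF ev_IT[OF U] ev_IT[OF V]])
  show "e (T.bar U * V) = mul (Poly_Mapping.single [e U, e V] 1)"
    using U by (simp add: ev_mult ev_bar)
  show "T.bar U * V - phi (Poly_Mapping.single [e U, e V] 1) \<in> W"
    using fs.subspace_neg[OF subspace_W phi_single_cong[OF U V]] by simp
qed

text \<open>\<open>T.bar\<close> is an involution preserving \<open>IT\<close>, so every first
  factor can be written as a barred one.\<close>

lemma mult_D: "U \<in> IT \<Longrightarrow> V \<in> IT \<Longrightarrow> U * V \<in> D"
  using bar_mult_D[OF bar_IT, of U V] by simp

text \<open>A linear relation trades \<open>lin (lam r)\<close> for a sum of products modulo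
  \<open>J\<close>, and both pieces belong to \<open>D\<close>.\<close>

lemma lin_D: "c \<in> fs.span (lam ` Rs) \<Longrightarrow> lin c \<in> D"
proof -
  have "fs.span (lam ` Rs) \<subseteq> {c. lin c \<in> D}"
  proof (rule fs.span_minimal[OF _ fs.subspace_hom_vimage[OF fs.module_hom_lin_ext subspace_D]])
    show "lam ` Rs \<subseteq> {c. lin c \<in> D}"
    proof (rule image_subsetI)
      fix r assume r: "r \<in> Rs"
      have "linrel r + (\<Sum>\<beta>\<in>Bs r. T.bar (K r \<beta>) * L r \<beta>) \<in> D"
        using rels_J r by (intro fs.subspace_add[OF subspace_D] fs.subspace_sum[OF subspace_D] bar_mult_D J_D K L r) auto
      then show "lam r \<in> {c. lin c \<in> D}" by (simp add: linrel_def)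
    qed
  qed
  then show "c \<in> fs.span (lam ` Rs) \<Longrightarrow> lin c \<in> D" by blast
qed

text \<open>A one-letter word is linear; a longer word is a letter times a nonempty word, hence a
  product of two elements of \<open>IT\<close>.\<close>

lemma IT_decomposition: "p \<in> IT \<Longrightarrow> \<exists>c\<in>free_on X. p - lin c \<in> D"
proof -
  interpret lin: module_hom fscale fscale lin by (rule fs.module_hom_lin_ext)
  let ?V = "{p. \<exists>c\<in>free_on X. p - lin c \<in> D}"
  have V_I: "p \<in> ?V" if "c \<in> free_on X" "p - lin c \<in> D" for p c using that by blast
  have V: "fs.subspace ?V"
  proof (rule fs.subspaceI)
    show "0 \<in> ?V"
      by (rule V_I[OF fs.subspace_0[OF subspace_free_on]]) (simp add: lin.zero fs.subspace_0[OF subspace_D])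
  next
    fix p p' assume "p \<in> ?V" "p' \<in> ?V"
    then obtain c c' where c: "c \<in> free_on X" "c' \<in> free_on X" and d: "p - lin c \<in> D" "p' - lin c' \<in> D" by blast
    show "p + p' \<in> ?V"
      by (rule V_I[OF fs.subspace_add[OF subspace_free_on c]])
        (use fs.subspace_add[OF subspace_D d] in \<open>simp add: lin.add algebra_simps\<close>)
  next
    fix b p assume "p \<in> ?V"
    then obtain c where c: "c \<in> free_on X" and d: "p - lin c \<in> D" by blast
    show "fscale b p \<in> ?V"
      by (rule V_I[OF fs.subspace_scale[OF subspace_free_on c]])
        (use fs.subspace_scale[OF subspace_D d] in \<open>simp add: lin.scale fs.scale_right_diff_distrib\<close>)
  qed
  have "IT \<subseteq> ?V"
    unfolding IT_free_on
  proof (rule free_on_le[OF V])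
    fix u assume u: "u \<in> {u. set (letters u) \<subseteq> X \<and> letters u \<noteq> []}"
    then obtain i l where il: "letters u = i # l" by (cases "letters u") auto
    then have uw: "u = Word (i # l)" by (cases u) simp
    have i: "i \<in> X" and l: "set l \<subseteq> X" using u il by auto
    show "Poly_Mapping.single u 1 \<in> ?V"
    proof (cases "l = []")
      case True
      show ?thesis
        by (rule V_I[OF single_in_free_on[OF i, of 1]])
          (simp add: uw True tvar_def[symmetric] fs.subspace_0[OF subspace_D])
    next
      case False
      have "Poly_Mapping.single (Word l) 1 \<in> IT"
        unfolding IT_free_on using l False by (intro single_in_free_on) simp
      moreover have "tvar i * Poly_Mapping.single (Word l) 1 = Poly_Mapping.single u (1 :: 'k)"
        by (simp add: tvar_def mult_single uw plus_word_def)
      ultimately have "Poly_Mapping.single u 1 \<in> D"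
        using mult_D[OF tvar_IT[OF i]] by metis
      then show ?thesis
        by (intro V_I[OF fs.subspace_0[OF subspace_free_on]]) (simp add: lin.zero)
    qed
  qed
  then show "p \<in> IT \<Longrightarrow> \<exists>c\<in>free_on X. p - lin c \<in> D" by blast
qed

section \<open>Equality of the kernel with J\<close>

lemma kernel_W: "p \<in> kernel \<Longrightarrow> p \<in> W"
proof -
  assume p: "p \<in> kernel"
  then obtain c where c: "c \<in> free_on X" "p - lin c \<in> D" using IT_decomposition kernel_IT by blast
  then obtain q where q: "q \<in> F 2" "e (p - lin c) = mul q" unfolding D_def by blast
  then have "mul q = - lin_ext scale a c"
    using p by (simp add: ev.diff ev_lin kernel_def)
  then have "lin_ext scale a c = mul (- q)" by (simp add: mul.neg)
  \<comment> \<open>The linear part evaluates to a value of \<open>mul\<close>, so c is a relation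
    between the classes in H_1 and hence a combination of the given ones.\<close>
  then have "lin c \<in> D"
    by (intro lin_D lam_span[OF c(1) fs.subspace_neg[OF subspace_free_on q(1)]])
  from fs.subspace_add[OF subspace_D c(2) this] have "p \<in> D" by simp
  then obtain q' where q': "q' \<in> F 2" "e p = mul q'" "p - phi q' \<in> W" unfolding D_def by blast
  \<comment> \<open>Unlike q in general, the witness q' of p itself has \<open>mul q' = 0\<close>
    and so represents a cycle.\<close>
  then have "phi q' \<in> W" using p by (intro phi_cycle) (simp_all add: kernel_def)
  from fs.subspace_add[OF subspace_W q'(3) this] show "p \<in> W" by simp
qed

lemma proj_kernel_J: "p \<in> kernel \<Longrightarrow> proj \<delta> (tensor_gr dg) n p \<in> J"
proof (induction "nat n" arbitrary: n p rule: less_induct)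
  case less
  have 0: "0 \<in> J" by (rule fs.subspace_0[OF subspace_J])
  have V: "fs.subspace {p. proj \<delta> (tensor_gr dg) n p \<in> J}"
    by (rule fs.subspace_hom_vimage[OF T.module_hom_proj subspace_J])
  \<comment> \<open>For m > 0 the kernel factor has degree below n, so the induction hypothesis, or
    vanishing when k is not positive, puts it into \<open>J\<close>. For other m the factor from
    \<open>IT\<close> is zero.\<close>
  have lower: "proj \<delta> (tensor_gr dg) k q \<in> J \<or> proj \<delta> (tensor_gr dg) m t = 0"
    if "q \<in> kernel" "t \<in> IT" "k + m = n" for q t k m
  proof -
    have qIT: "q \<in> IT" using that(1) kernel_IT by blast
    consider "k < 0" | "k = 0" | "m < 0" | "m = 0" | "k > 0" "m > 0" by linarith
    then show ?thesis
    proof cases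
      case 5
      then have "nat k < nat n" using that(3) by auto
      then show ?thesis using less.hyps[OF _ that(1)] by blast
    qed (use qIT that(2) 0 in \<open>auto simp: proj_neg_TX T.aug_ideal_proj\<close>)
  qed
  have left: "proj \<delta> (tensor_gr dg) n (q * t) \<in> J" if q: "q \<in> kernel" and t: "t \<in> IT" for q t
  proof (rule T.proj_mult_in[OF subspace_J])
    fix k m assume "k + m = n"
    then show "proj \<delta> (tensor_gr dg) k q * proj \<delta> (tensor_gr dg) m t \<in> J"
      using lower[OF q t] J_mult_right[OF proj_TX] t 0 by (metis IntD1 mult_zero_right)
  qed
  have right: "proj \<delta> (tensor_gr dg) n (t * q) \<in> J" if q: "q \<in> kernel" and t: "t \<in> IT" for q t
  proof (rule T.proj_mult_in[OF subspace_J])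
    fix m k assume "m + k = n"
    then have "k + m = n" by simp
    then show "proj \<delta> (tensor_gr dg) m t * proj \<delta> (tensor_gr dg) k q \<in> J"
      using lower[OF q t] J_mult_left[OF proj_TX] t 0 by (metis IntD1 mult_zero_left)
  qed
  have "W \<subseteq> {p. proj \<delta> (tensor_gr dg) n p \<in> J}"
    unfolding W_def by (rule fs.span_minimal[OF _ V]) (use proj_J left right in blast)
  then show ?case using kernel_W[OF less.prems] by blast
qed

lemma kernel_eq_J: "kernel = J"
proof
  show "kernel \<subseteq> J"
  proof
    fix p assume p: "p \<in> kernel"
    obtain K where K: "p = (\<Sum>n\<in>K. proj \<delta> (tensor_gr dg) n p)" using T.sum_proj[of p] by blast
    show "p \<in> J"
      by (subst K) (intro fs.subspace_sum[OF subspace_J] proj_kernel_J p)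
  qed
qed (rule J_kernel)

section \<open>The isomorphism with the quotient algebra\<close>

lemma has_presentation: "has_presentation scale gr X a dg rels"
proof -
  have "ring (ring_on (UNIV :: 'a set))" by (rule ring_ring_on) simp_all
  moreover have "e \<in> ring_hom (ring_on TX) (ring_on (UNIV :: 'a set))"
    by (rule ring_hom_memI) (simp_all add: ev_mult ev.add ev_one)
  ultimately interpret ring_hom_ring "ring_on TX" "ring_on (UNIV :: 'a set)" e
    by (intro ring_hom_ring.intro ring_hom_ring_axioms.intro ring_TX)
  have ker: "a_kernel (ring_on TX) (ring_on (UNIV :: 'a set)) e = J"
    unfolding kernel_eq_J[symmetric] a_kernel_def' by (simp add: kernel_def)
  \<comment> \<open>Evaluation is constant on cosets of its kernel, so the image of a coset is a
    singleton.\<close>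
  let ?h = "\<lambda>Y. the_elem (e ` Y)"
  have iso: "?h \<in> ring_iso (ring_on TX Quot J) (ring_on (UNIV :: 'a set))"
    using FactRing_iso_set ev_surj unfolding ker by simp
  have val: "?h (J +>\<^bsub>ring_on TX\<^esub> p) = e p" if "p \<in> TX" for p
    using the_elem_simp[of p] that unfolding ker by simp
  show ?thesis
    unfolding has_presentation_def Let_def J_def[symmetric]
  proof (intro bexI[OF _ iso] conjI allI ballI)
    fix c p assume "p \<in> carrier (ring_on TX)"
    then show "?h (J +>\<^bsub>ring_on TX\<^esub> fscale c p) = scale c (?h (J +>\<^bsub>ring_on TX\<^esub> p))"
      using fs.subspace_scale[OF subspace_tensor_algebra, of p X c] by (simp add: val ev.scale)
  next
    fix g p assume "p \<in> carrier (ring_on TX) \<inter> tensor_gr dg g"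
    then show "?h (J +>\<^bsub>ring_on TX\<^esub> p) \<in> gr g"
      by (simp add: val ev_gr)
  next
    fix i assume "i \<in> X"
    then show "?h (J +>\<^bsub>ring_on TX\<^esub> tvar i) = a i"
      by (simp add: val tvar_tensor_algebra ev_tvar)
  qed
qed

end

section \<open>Translation of the homological hypotheses into equations in A\<close>

theorem theoremA6:
  fixes scale :: "'k::comm_ring_1 \<Rightarrow> 'a::ring_1 \<Rightarrow> 'a"
    and \<delta> :: "'g::comm_monoid_add \<Rightarrow> int"
    and gr :: "'g \<Rightarrow> 'a set"
    and X :: "'i set" and a :: "'i \<Rightarrow> 'a" and dg :: "'i \<Rightarrow> 'g"
    and Rs :: "'r set" and lam :: "'r \<Rightarrow> 'i \<Rightarrow>\<^sub>0 'k"
    and Bs :: "'r \<Rightarrow> 'b set" and K L :: "'r \<Rightarrow> 'b \<Rightarrow> ('i word \<Rightarrow>\<^sub>0 'k)"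
    and Ms :: "'m set"
    and As :: "'m \<Rightarrow> 'c set" and P Q :: "'m \<Rightarrow> 'c \<Rightarrow> ('i word \<Rightarrow>\<^sub>0 'k)"
  defines "H \<equiv> bar_homology scale \<delta> gr"
    and "cls \<equiv> bar_class scale \<delta> gr"
    and "B \<equiv> bar_module scale \<delta> gr"
    and "tensor \<equiv> bar_tensor scale \<delta> gr"
    and "ev \<equiv> tensor_eval scale a"
    and "IT \<equiv> tensor_algebra X \<inter> aug_ideal \<delta> (tensor_gr dg)"
    and "barT \<equiv> bar_sign \<delta> (tensor_gr dg)"
  defines "z \<equiv> \<lambda>j. \<Oplus>\<^bsub>B 2\<^esub>\<alpha>\<in>As j. tensor [ev (P j \<alpha>), ev (Q j \<alpha>)]"
    and "linrel \<equiv> \<lambda>r. (\<Sum>i\<in>Poly_Mapping.keys (lam r). fscale (Poly_Mapping.lookup (lam r) i) (tvar i))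
                        - (\<Sum>\<beta>\<in>Bs r. barT (K r \<beta>) * L r \<beta>)"
    and "quadrel \<equiv> \<lambda>j. \<Sum>\<alpha>\<in>As j. barT (P j \<alpha>) * Q j \<alpha>"
  assumes A: "connected_graded_algebra scale \<delta> gr"
    and a: "\<forall>i\<in>X. a i \<in> gr (dg i) \<and> 0 < \<delta> (dg i)"
    and gen: "submodule_span (H 1) ((\<lambda>i. cls 1 (tensor [a i])) ` X) = carrier (H 1)"
  shows "subalgebra scale hull (a ` X) = UNIV
    \<and> ((\<forall>r\<in>Rs. Poly_Mapping.keys (lam r) \<subseteq> X \<and> (\<exists>g. \<forall>i\<in>Poly_Mapping.keys (lam r). dg i = g))
        \<and> {c. Poly_Mapping.keys c \<subseteq> X \<and>
             (\<Oplus>\<^bsub>H 1\<^esub>i\<in>Poly_Mapping.keys c. Poly_Mapping.lookup c i \<odot>\<^bsub>H 1\<^esub> cls 1 (tensor [a i])) = \<zero>\<^bsub>H 1\<^esub>}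
            = submodule_span (free_module X) (lam ` Rs)
        \<and> (\<forall>r\<in>Rs. finite (Bs r)
            \<and> (\<forall>\<beta>\<in>Bs r. K r \<beta> \<in> IT \<and> (\<exists>g. K r \<beta> \<in> tensor_gr dg g)
                       \<and> L r \<beta> \<in> IT \<and> (\<exists>g. L r \<beta> \<in> tensor_gr dg g))
            \<and> tensor [\<Sum>i\<in>Poly_Mapping.keys (lam r). scale (Poly_Mapping.lookup (lam r) i) (a i)]
                = bar_d scale \<delta> gr 2 (\<Oplus>\<^bsub>B 2\<^esub>\<beta>\<in>Bs r. tensor [ev (K r \<beta>), ev (L r \<beta>)])
            \<and> (\<exists>g. linrel r \<in> tensor_gr dg g))
        \<and> (\<forall>j\<in>Ms. finite (As j)
            \<and> (\<forall>\<alpha>\<in>As j. P j \<alpha> \<in> IT \<and> (\<exists>g. P j \<alpha> \<in> tensor_gr dg g)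
                       \<and> Q j \<alpha> \<in> IT \<and> (\<exists>g. Q j \<alpha> \<in> tensor_gr dg g))
            \<and> (\<exists>g. z j \<in> bar_homogeneous scale \<delta> gr 2 g)
            \<and> z j \<in> bar_cycles scale \<delta> gr 2
            \<and> (\<exists>g. quadrel j \<in> tensor_gr dg g))
        \<and> submodule_span (H 2) ((\<lambda>j. cls 2 (z j)) ` Ms) = carrier (H 2)
      \<longrightarrow> has_presentation scale gr X a dg (linrel ` Rs \<union> quadrel ` Ms))"
proof -
  interpret A: connected_graded_algebra scale \<delta> gr by (rule A)
  interpret E: graded_evaluation scale \<delta> gr X a dg
    using a by unfold_locales auto
  note defs = H_def cls_def B_def tensor_def ev_def IT_def barT_def
  have aI: "a i \<in> aug_ideal \<delta> gr" if "i \<in> X" for i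
    using a that by (auto simp: A.aug_ideal_proj A.proj_gr)
  \<comment> \<open>Only generation of H_1 enters here, so the first claim is available before the
    hypotheses of the second are introduced.\<close>
  interpret G: bar_generated scale \<delta> gr X a dg
  proof
    fix x assume "x \<in> aug_ideal \<delta> gr"
    then show "\<exists>c\<in>free_on X. \<exists>q\<in>free_on (words (aug_ideal \<delta> gr) 2). x = lin_ext scale a c + A.mul q"
      by (intro A.H1_generators aI gen[unfolded defs])
  qed
  show ?thesis
  proof (intro conjI impI, rule G.subalgebra_hull, elim conjE)
    assume lam: "\<forall>r\<in>Rs. Poly_Mapping.keys (lam r) \<subseteq> X \<and> (\<exists>g. \<forall>i\<in>Poly_Mapping.keys (lam r). dg i = g)"
      and span: "{c. Poly_Mapping.keys c \<subseteq> X \<and>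
             (\<Oplus>\<^bsub>H 1\<^esub>i\<in>Poly_Mapping.keys c. Poly_Mapping.lookup c i \<odot>\<^bsub>H 1\<^esub> cls 1 (tensor [a i])) = \<zero>\<^bsub>H 1\<^esub>}
            = submodule_span (free_module X) (lam ` Rs)"
      and rel: "\<forall>r\<in>Rs. finite (Bs r)
            \<and> (\<forall>\<beta>\<in>Bs r. K r \<beta> \<in> IT \<and> (\<exists>g. K r \<beta> \<in> tensor_gr dg g)
                       \<and> L r \<beta> \<in> IT \<and> (\<exists>g. L r \<beta> \<in> tensor_gr dg g))
            \<and> tensor [\<Sum>i\<in>Poly_Mapping.keys (lam r). scale (Poly_Mapping.lookup (lam r) i) (a i)]
                = bar_d scale \<delta> gr 2 (\<Oplus>\<^bsub>B 2\<^esub>\<beta>\<in>Bs r. tensor [ev (K r \<beta>), ev (L r \<beta>)])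
            \<and> (\<exists>g. linrel r \<in> tensor_gr dg g)"
      and cyc: "\<forall>j\<in>Ms. finite (As j)
            \<and> (\<forall>\<alpha>\<in>As j. P j \<alpha> \<in> IT \<and> (\<exists>g. P j \<alpha> \<in> tensor_gr dg g)
                       \<and> Q j \<alpha> \<in> IT \<and> (\<exists>g. Q j \<alpha> \<in> tensor_gr dg g))
            \<and> (\<exists>g. z j \<in> bar_homogeneous scale \<delta> gr 2 g)
            \<and> z j \<in> bar_cycles scale \<delta> gr 2
            \<and> (\<exists>g. quadrel j \<in> tensor_gr dg g)"
      and gen2: "submodule_span (H 2) ((\<lambda>j. cls 2 (z j)) ` Ms) = carrier (H 2)"
    have lam_free: "lam r \<in> free_on X" if "r \<in> Rs" for r
      using lam that by (simp add: free_on_def)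
    have KL: "finite (Bs r)" "\<And>\<beta>. \<beta> \<in> Bs r \<Longrightarrow> K r \<beta> \<in> IT" "\<And>\<beta>. \<beta> \<in> Bs r \<Longrightarrow> L r \<beta> \<in> IT" if "r \<in> Rs" for r
      using rel that by blast+
    have PQ: "finite (As j)" "\<And>\<alpha>. \<alpha> \<in> As j \<Longrightarrow> P j \<alpha> \<in> IT" "\<And>\<alpha>. \<alpha> \<in> As j \<Longrightarrow> Q j \<alpha> \<in> IT" if "j \<in> Ms" for j
      using cyc that by blast+
    \<comment> \<open>Representatives, in the free module on two-letter words, of the chains
      \<open>z j\<close>; \<open>cycles_generated\<close> speaks of representatives.\<close>
    define \<zeta> where "\<zeta> j = (\<Sum>\<alpha>\<in>As j. Poly_Mapping.single [ev (P j \<alpha>), ev (Q j \<alpha>)] (1 :: 'k))" for j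
    have \<zeta>: "z j = A.tens 2 (\<zeta> j)" "\<zeta> j \<in> free_on (words (aug_ideal \<delta> gr) 2)"
      "A.mul (\<zeta> j) = (\<Sum>\<alpha>\<in>As j. bar_sign \<delta> gr (ev (P j \<alpha>)) * ev (Q j \<alpha>))" if "j \<in> Ms" for j
      unfolding z_def \<zeta>_def B_def tensor_def
      using PQ[OF that] E.ev_IT unfolding ev_def IT_def
      by (intro A.finsum_bar_tensor_2; simp)+
    have \<zeta>_zero: "A.mul (\<zeta> j) = 0" if "j \<in> Ms" for j
      using cyc that \<zeta>[OF that] A.tens_2_cycles_mul_iff by metis
    interpret bar_presented scale \<delta> gr X a dg Rs lam Bs K L Ms As P Q linrel quadrel
    proof
      show "linrel r = lin_ext fscale tvar (lam r) - (\<Sum>\<beta>\<in>Bs r. bar_sign \<delta> (tensor_gr dg) (K r \<beta>) * L r \<beta>)" for r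
        unfolding linrel_def lin_ext_def barT_def ..
      show "quadrel j = (\<Sum>\<alpha>\<in>As j. bar_sign \<delta> (tensor_gr dg) (P j \<alpha>) * Q j \<alpha>)" for j
        unfolding quadrel_def barT_def ..
      show "lin_ext scale a (lam r) = (\<Sum>\<beta>\<in>Bs r. bar_sign \<delta> gr (tensor_eval scale a (K r \<beta>)) * tensor_eval scale a (L r \<beta>))"
        if r: "r \<in> Rs" for r
      proof -
        have uv: "ev (K r \<beta>) \<in> aug_ideal \<delta> gr" "ev (L r \<beta>) \<in> aug_ideal \<delta> gr" if "\<beta> \<in> Bs r" for \<beta>
          using KL(2,3)[OF r that] E.ev_IT unfolding ev_def IT_def by blast+
        let ?q = "\<Sum>\<beta>\<in>Bs r. Poly_Mapping.single [ev (K r \<beta>), ev (L r \<beta>)] (1 :: 'k)"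
        have fin: "(\<Oplus>\<^bsub>B 2\<^esub>\<beta>\<in>Bs r. tensor [ev (K r \<beta>), ev (L r \<beta>)]) = A.tens 2 ?q"
          "?q \<in> free_on (words (aug_ideal \<delta> gr) 2)"
          "A.mul ?q = (\<Sum>\<beta>\<in>Bs r. bar_sign \<delta> gr (ev (K r \<beta>)) * ev (L r \<beta>))"
          unfolding B_def tensor_def by (rule A.finsum_bar_tensor_2[OF KL(1)[OF r]]; rule uv; assumption)+
        have "tensor [\<Sum>i\<in>Poly_Mapping.keys (lam r). scale (Poly_Mapping.lookup (lam r) i) (a i)]
            = bar_d scale \<delta> gr 2 (\<Oplus>\<^bsub>B 2\<^esub>\<beta>\<in>Bs r. tensor [ev (K r \<beta>), ev (L r \<beta>)])"
          using rel r by simp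
        then have "bar_tensor scale \<delta> gr [lin_ext scale a (lam r)]
            = bar_d scale \<delta> gr 2 (A.tens 2 ?q)"
          unfolding lin_ext_def tensor_def[symmetric] by (simp only: fin(1))
        moreover have "lin_ext scale a (lam r) \<in> aug_ideal \<delta> gr"
          by (rule A.lin_ext_in[OF A.subspace_aug_ideal lam_free[OF r] aI])
        ultimately show ?thesis
          using A.bar_tensor_eq_bar_d[OF _ fin(2)] fin(3) unfolding ev_def by simp
      qed
      \<comment> \<open>The equation in A is turned back into a relation in H_1, where completeness
        of the given relations applies.\<close>
      show "c \<in> fs.span (lam ` Rs)"
        if c: "c \<in> free_on X" and q: "q \<in> free_on (words (aug_ideal \<delta> gr) 2)" "lin_ext scale a c = A.mul q" for c q
      proof -
        have "c \<in> submodule_span (free_module X) (lam ` Rs)"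
          unfolding span[symmetric] defs
          using A.H1_relation_iff[OF aI c] c q by (auto simp: free_on_def)
        then show ?thesis
          using submodule_span_free_module[of "lam ` Rs" X] lam_free by (simp add: image_subset_iff)
      qed
      show "(\<Sum>\<alpha>\<in>As j. bar_sign \<delta> gr (tensor_eval scale a (P j \<alpha>)) * tensor_eval scale a (Q j \<alpha>)) = 0"
        if "j \<in> Ms" for j
        using \<zeta>(3)[OF that] \<zeta>_zero[OF that] by (simp add: ev_def)
      show "q \<in> E"
        if "fs.subspace E" "tensor_null scale (aug_ideal \<delta> gr) 2 \<subseteq> E"
          "\<And>w. w \<in> words (aug_ideal \<delta> gr) 3 \<Longrightarrow> bar_d_word \<delta> gr w \<in> E"
          and E: "\<And>j. j \<in> Ms \<Longrightarrow> (\<Sum>\<alpha>\<in>As j. Poly_Mapping.single [tensor_eval scale a (P j \<alpha>), tensor_eval scale a (Q j \<alpha>)] 1) \<in> E"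
          and "q \<in> free_on (words (aug_ideal \<delta> gr) 2)" "A.mul q = 0" for E q
      proof (rule A.H2_generators[OF \<zeta>(2) \<zeta>_zero _ that(1-3) _ that(5,6)])
        have "(\<lambda>j. cls 2 (z j)) ` Ms = (\<lambda>j. A.cl 2 (\<zeta> j)) ` Ms"
          unfolding cls_def using \<zeta>(1) by (intro image_cong refl) simp
        then show "submodule_span (bar_homology scale \<delta> gr 2) ((\<lambda>j. A.cl 2 (\<zeta> j)) ` Ms) = carrier (bar_homology scale \<delta> gr 2)"
          using gen2 unfolding H_def by simp
        show "\<zeta> j \<in> E" if "j \<in> Ms" for j
          using E[OF that] by (simp add: \<zeta>_def ev_def)
      qed
    qed (use lam_free KL PQ rel cyc in \<open>auto simp: IT_def\<close>)
    show "has_presentation scale gr X a dg (linrel ` Rs \<union> quadrel ` Ms)"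
      by (rule has_presentation)
  qed
qed

end
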